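(* For any Lie groupoid $\mathbb{X}=[X_1\rightrightarrows X_0]$, the thin fundamental groupoid $\Pi_{\mathrm{thin}}(\mathbb{X})$ is a diffeological groupoid.
   Context: A Lie groupoid $\mathbb{X}=[X_1\rightrightarrows X_0]$ has submersive source/target $s,t$ and smooth unit, inverse and composition ($\gamma_2\circ\gamma_1$ when $s(\gamma_2)=t(\gamma_1)$). **Lazy $\mathbb{X}$-paths.** A path with sitting instants is a smooth map on $[0,1]$ constant near $0$ and near $1$. A lazy $\mathbb{X}$-path of order $n\ge0$ from $x$ to $y$: $\Gamma=(\gamma_0,\alpha_1,\gamma_1,\dots,\alpha_n,\gamma_n)$, $\alpha_i:[0,1]\to X_0$ paths with sitting instants, $\gamma_i\in X_1$, $s(\gamma_0)=x$, $t(\gamma_n)=y$, $s(\gamma_i)=\alpha_i(1)$ for $0<i\le n$, $t(\gamma_i)=\alpha_{i+1}(0)$ for $0\le i<n$. $P\mathbb{X}$ is the set of all of them. $\alpha^{-1}(r)=\alpha(1-r)$; $\beta*\alpha$ is concatenation (first $\alpha$). Elementary equivalences: (1) if $\alpha_{i+1}$ is constant, replace $\gamma_i,\alpha_{i+1},\gamma_{i+1}$ by $\gamma_{i+1}\circ\gamma_i$, or conversely; (2) if $\gamma_i$ is an identity, $1\le i\le n-1$, replace $\alpha_i,\gamma_i,\alpha_{i+1}$ by $\alpha_{i+1}*\alpha_i$, or conversely; (3) for a path with sitting instants $\zeta_i:[0,1]\to X_1$ with $s\circ\zeta_i=\alpha_i$, replace $\gamma_{i-1},\alpha_i,\gamma_i$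 by $\zeta_i(0)\circ\gamma_{i-1},t\circ\zeta_i,\gamma_i\circ\zeta_i(1)^{-1}$. A thin deformation from $(\gamma_0,\alpha_1,\dots,\gamma_n)$ to $(\gamma_0',\alpha_1',\dots,\gamma_n')$: paths with sitting instants $\zeta_i:[0,1]\to X_1$ from $\gamma_i$ to $\gamma_i'$ with $\alpha_i$ thin homotopic to $(s\circ\zeta_i)^{-1}*\alpha'_i*(t\circ\zeta_{i-1})$ and $s\circ\zeta_0,t\circ\zeta_n$ constant (thin homotopy: smooth homotopy with fixed endpoints, with sitting instants in both variables, with differential of rank $\le1$). Lazy $\mathbb{X}$-path thin homotopy $\sim$ is the equivalence relation on $P\mathbb{X}$ generated by these. **$\Pi_{\mathrm{thin}}(\mathbb{X})$.** Objects $X_0$, morphisms $P\mathbb{X}/{\sim}$, source $[\Gamma]\mapsto s(\gamma_0)$, target $[\Gamma]\mapsto t(\gamma_n)$, composition $[(\gamma'_0,\alpha'_1,\dots,\gamma'_n)]\circ[(\gamma_0,\alpha_1,\dots,\gamma_m)]=[(\gamma_0,\alpha_1,\dots,\alpha_m,\gamma'_0\circ\gamma_m,\alpha'_1,\dots,\gamma'_n)]$, unit $x\mapsto[(1_x,c_x,1_x)]$ with $c_x$ constant, inverse $[(\gamma_0,\alpha_1,\dots,\alpha_n,\gamma_n)]\mapsto[(\gamma_n^{-1},\alpha_n^{-1},\dots,\alpha_1^{-1},\gamma_0^{-1})]$. **Diffeology.** A diffeological groupoid is a groupoid whose object and morphism sets are diffeological spaces and whose structure maps are maps of diffeological spaces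 (send plots to plots). Here $X_0$ has its manifold diffeology. Let $PX_0$ be the set of paths with sitting instants in $X_0$, with plots the maps $p:U\to PX_0$ such that $U\times[0,1]\to X_0$, $(r,a)\mapsto p(r)(a)$ is smooth. The set $P\mathbb{X}_n=X_1\times_{t,X_0,ev_0}PX_0\times_{ev_1,X_0,s}X_1\times\cdots\times X_1$ of lazy $\mathbb{X}$-paths of order $n$ has the fibre product diffeology ($P\mathbb{X}_0=X_1$), $P\mathbb{X}=\sqcup_nP\mathbb{X}_n$ the sum diffeology, and $P\mathbb{X}/{\sim}$ the quotient diffeology. *)

theory Defs
  imports "HOL-Analysis.Analysis" "HOL-Library.Function_Algebras"
begin

section \<open>Smooth maps between open subsets of Euclidean spaces\<close>

text \<open>
  Dimensions are natural numbers (zero included), and the space of dimension \<open>n\<close> is the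
  library's \<open>Euclidean_space n\<close>: the functions \<open>nat \<Rightarrow> real\<close> vanishing from index \<open>n\<close> on.
\<close>

definition partial :: "nat \<Rightarrow> ((nat \<Rightarrow> real) \<Rightarrow> real) \<Rightarrow> (nat \<Rightarrow> real) \<Rightarrow> real" where
  "partial j f x = deriv (\<lambda>t. f (x(j := t))) (x j)"

primrec Ck :: "nat \<Rightarrow> nat \<Rightarrow> (nat \<Rightarrow> real) set \<Rightarrow> ((nat \<Rightarrow> real) \<Rightarrow> real) \<Rightarrow> bool" where
  "Ck 0 n U f \<longleftrightarrow> continuous_on U f"
| "Ck (Suc k) n U f \<longleftrightarrow> continuous_on U f \<and>
     (\<forall>j<n. (\<forall>x\<in>U. (\<lambda>t. f (x(j := t))) field_differentiable at (x j)) \<and> Ck k n U (partial j f))"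

definition smooth_euclid ::
  "nat \<Rightarrow> nat \<Rightarrow> (nat \<Rightarrow> real) set \<Rightarrow> ((nat \<Rightarrow> real) \<Rightarrow> nat \<Rightarrow> real) \<Rightarrow> bool" where
  "smooth_euclid n m U f \<longleftrightarrow>
     openin (Euclidean_space n) U \<and> f ` U \<subseteq> topspace (Euclidean_space m) \<and>
     (\<forall>i<m. \<forall>k. Ck k n U (\<lambda>x. f x i))"


section \<open>Smooth manifolds\<close>

type_synonym 'a chart = "'a set \<times> ('a \<Rightarrow> nat \<Rightarrow> real)"

record 'a manifold =
  mtop :: "'a topology"
  mdim :: nat
  atlas :: "'a chart set"

locale smooth_manifold =
  fixes M :: "'a manifold"
  assumes Hausdorff: "Hausdorff_space (mtop M)"
    and second_countable: "second_countable (mtop M)"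
    and chart_homeo: "\<And>U \<phi>. (U, \<phi>) \<in> atlas M \<Longrightarrow>
          openin (mtop M) U \<and> openin (Euclidean_space (mdim M)) (\<phi> ` U) \<and>
          homeomorphic_map (subtopology (mtop M) U)
            (subtopology (Euclidean_space (mdim M)) (\<phi> ` U)) \<phi>"
    and charts_cover: "(\<Union>(U, \<phi>)\<in>atlas M. U) = topspace (mtop M)"
    and charts_compatible: "\<And>U \<phi> V \<psi>. (U, \<phi>) \<in> atlas M \<Longrightarrow> (V, \<psi>) \<in> atlas M \<Longrightarrow>
          smooth_euclid (mdim M) (mdim M) (\<phi> ` (U \<inter> V)) (\<psi> \<circ> inv_into U \<phi>)"

definition Rn :: "nat \<Rightarrow> (nat \<Rightarrow> real) manifold" where
  "Rn n = \<lparr>mtop = Euclidean_space n, mdim = n,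
           atlas = {(topspace (Euclidean_space n), \<lambda>x. x)}\<rparr>"

definition real_line :: "real manifold" where
  "real_line = \<lparr>mtop = euclideanreal, mdim = 1,
                atlas = {(UNIV, \<lambda>t i. if i = 0 then t else 0)}\<rparr>"

definition prod_manifold :: "'a manifold \<Rightarrow> 'b manifold \<Rightarrow> ('a \<times> 'b) manifold" where
  "prod_manifold M N =
     \<lparr>mtop = prod_topology (mtop M) (mtop N), mdim = mdim M + mdim N,
      atlas = {(U \<times> V, \<lambda>(x, y) i. if i < mdim M then \<phi> x i else \<psi> y (i - mdim M)) | U \<phi> V \<psi>.
                 (U, \<phi>) \<in> atlas M \<and> (V, \<psi>) \<in> atlas N}\<rparr>"

definition smooth_map :: "'a manifold \<Rightarrow> 'b manifold \<Rightarrow> 'a set \<Rightarrow> ('a \<Rightarrow> 'b) \<Rightarrow> bool" where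
  "smooth_map M N W f \<longleftrightarrow> openin (mtop M) W \<and>
     (\<forall>x\<in>W. \<exists>(U, \<phi>)\<in>atlas M. \<exists>(V, \<psi>)\<in>atlas N. \<exists>B.
        openin (mtop M) B \<and> x \<in> B \<and> B \<subseteq> U \<inter> W \<and> f ` B \<subseteq> V \<and>
        smooth_euclid (mdim M) (mdim N) (\<phi> ` B) (\<psi> \<circ> f \<circ> inv_into U \<phi>))"

text \<open>
  Smoothness on an arbitrary subset \<open>S\<close> of a manifold means the existence of local smooth
  extensions. It is applied to submanifolds with boundary or corners (such as
  \<open>[0,1]\<close>, \<open>[0,1] \<times> [0,1]\<close> and \<open>U \<times> [0,1]\<close>) and to the embedded submanifold of composable
  pairs of a Lie groupoid; for these it is the usual notion.
\<close>
definition smooth_on :: "'a manifold \<Rightarrow> 'b manifold \<Rightarrow> 'a set \<Rightarrow> ('a \<Rightarrow> 'b) \<Rightarrow> bool" where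
  "smooth_on M N S f \<longleftrightarrow> S \<subseteq> topspace (mtop M) \<and>
     (\<forall>x\<in>S. \<exists>W g. x \<in> W \<and> smooth_map M N W g \<and> (\<forall>y\<in>W \<inter> S. g y = f y))"

text \<open>The differential at \<open>x\<close> in given charts around \<open>x\<close> and \<open>f x\<close>.\<close>
definition chart_differential ::
  "'a manifold \<Rightarrow> 'b manifold \<Rightarrow> 'a chart \<Rightarrow> 'b chart \<Rightarrow> ('a \<Rightarrow> 'b) \<Rightarrow> 'a
     \<Rightarrow> (nat \<Rightarrow> real) \<Rightarrow> nat \<Rightarrow> real" where
  "chart_differential M N c d f x v = (\<lambda>i. if i < mdim N
     then \<Sum>j<mdim M. partial j (\<lambda>y. snd d (f (inv_into (fst c) (snd c) y)) i) (snd c x) * v j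
     else 0)"

definition submersion :: "'a manifold \<Rightarrow> 'b manifold \<Rightarrow> ('a \<Rightarrow> 'b) \<Rightarrow> bool" where
  "submersion M N f \<longleftrightarrow> smooth_map M N (topspace (mtop M)) f \<and>
     (\<forall>x\<in>topspace (mtop M). \<forall>c\<in>atlas M. \<forall>d\<in>atlas N. x \<in> fst c \<and> f x \<in> fst d \<longrightarrow>
        chart_differential M N c d f x ` topspace (Euclidean_space (mdim M))
          = topspace (Euclidean_space (mdim N)))"

definition differential_rank_le ::
  "nat \<Rightarrow> 'a manifold \<Rightarrow> 'b manifold \<Rightarrow> ('a \<Rightarrow> 'b) \<Rightarrow> 'a \<Rightarrow> bool" where
  "differential_rank_le k M N f x \<longleftrightarrow>
     (\<forall>c\<in>atlas M. \<forall>d\<in>atlas N. x \<in> fst c \<and> f x \<in> fst d \<longrightarrow>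
        vector_space.dim (\<lambda>(a::real) (v::nat \<Rightarrow> real) i. a * v i)
          (chart_differential M N c d f x ` topspace (Euclidean_space (mdim M))) \<le> k)"


section \<open>Lie groupoids\<close>

text \<open>\<open>cmp G h g\<close> is the composite \<open>h \<circ> g\<close>, meaningful when \<open>src G h = tgt G g\<close>.\<close>
record ('o, 'm) groupoid_structure =
  obj :: "'o set"
  mor :: "'m set"
  src :: "'m \<Rightarrow> 'o"
  tgt :: "'m \<Rightarrow> 'o"
  unt :: "'o \<Rightarrow> 'm"
  cmp :: "'m \<Rightarrow> 'm \<Rightarrow> 'm"
  ivs :: "'m \<Rightarrow> 'm"

definition composable :: "('o, 'm) groupoid_structure \<Rightarrow> ('m \<times> 'm) set" where
  "composable G = {(h, g). h \<in> mor G \<and> g \<in> mor G \<and> src G h = tgt G g}"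

locale groupoid =
  fixes G :: "('o, 'm) groupoid_structure"
  assumes src_obj: "g \<in> mor G \<Longrightarrow> src G g \<in> obj G"
    and tgt_obj: "g \<in> mor G \<Longrightarrow> tgt G g \<in> obj G"
    and unt_mor: "x \<in> obj G \<Longrightarrow> unt G x \<in> mor G"
    and src_unt: "x \<in> obj G \<Longrightarrow> src G (unt G x) = x"
    and tgt_unt: "x \<in> obj G \<Longrightarrow> tgt G (unt G x) = x"
    and cmp_mor: "(h, g) \<in> composable G \<Longrightarrow> cmp G h g \<in> mor G"
    and src_cmp: "(h, g) \<in> composable G \<Longrightarrow> src G (cmp G h g) = src G g"
    and tgt_cmp: "(h, g) \<in> composable G \<Longrightarrow> tgt G (cmp G h g) = tgt G h"
    and cmp_assoc: "(k, h) \<in> composable G \<Longrightarrow> (h, g) \<in> composable G \<Longrightarrow>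
          cmp G (cmp G k h) g = cmp G k (cmp G h g)"
    and cmp_unt_right: "g \<in> mor G \<Longrightarrow> cmp G g (unt G (src G g)) = g"
    and cmp_unt_left: "g \<in> mor G \<Longrightarrow> cmp G (unt G (tgt G g)) g = g"
    and ivs_mor: "g \<in> mor G \<Longrightarrow> ivs G g \<in> mor G"
    and src_ivs: "g \<in> mor G \<Longrightarrow> src G (ivs G g) = tgt G g"
    and tgt_ivs: "g \<in> mor G \<Longrightarrow> tgt G (ivs G g) = src G g"
    and cmp_ivs_left: "g \<in> mor G \<Longrightarrow> cmp G (ivs G g) g = unt G (src G g)"
    and cmp_ivs_right: "g \<in> mor G \<Longrightarrow> cmp G g (ivs G g) = unt G (tgt G g)"

locale lie_groupoid =
  groupoid G + base: smooth_manifold X0 + arrows: smooth_manifold X1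
  for X0 :: "'o manifold" and X1 :: "'m manifold" and G :: "('o, 'm) groupoid_structure" +
  assumes obj_eq: "obj G = topspace (mtop X0)"
    and mor_eq: "mor G = topspace (mtop X1)"
    and src_submersion: "submersion X1 X0 (src G)"
    and tgt_submersion: "submersion X1 X0 (tgt G)"
    and unt_smooth: "smooth_map X0 X1 (topspace (mtop X0)) (unt G)"
    and ivs_smooth: "smooth_map X1 X1 (topspace (mtop X1)) (ivs G)"
    and cmp_smooth: "smooth_on (prod_manifold X1 X1) X1 (composable G) (\<lambda>(h, g). cmp G h g)"


section \<open>Paths with sitting instants and thin homotopy\<close>

text \<open>
  Paths are maps defined on \<open>[0,1]\<close> only: as HOL functions they are \<open>extensional\<close>, so that
  equality of paths is equality on \<open>[0,1]\<close>.
\<close>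
definition sitting_paths :: "'a manifold \<Rightarrow> (real \<Rightarrow> 'a) set" where
  "sitting_paths M = {\<alpha>. \<alpha> \<in> extensional {0..1} \<and> smooth_on real_line M {0..1} \<alpha> \<and>
     (\<exists>\<epsilon>>0. \<forall>r\<in>{0..1}. (r \<le> \<epsilon> \<longrightarrow> \<alpha> r = \<alpha> 0) \<and> (1 - \<epsilon> \<le> r \<longrightarrow> \<alpha> r = \<alpha> 1))}"

definition const_path :: "'a \<Rightarrow> real \<Rightarrow> 'a" where
  "const_path x = (\<lambda>r\<in>{0..1}. x)"

definition is_const_path :: "(real \<Rightarrow> 'a) \<Rightarrow> bool" where
  "is_const_path \<alpha> \<longleftrightarrow> (\<exists>x. \<alpha> = const_path x)"

definition map_path :: "('a \<Rightarrow> 'b) \<Rightarrow> (real \<Rightarrow> 'a) \<Rightarrow> real \<Rightarrow> 'b" where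
  "map_path f \<alpha> = (\<lambda>r\<in>{0..1}. f (\<alpha> r))"

definition rev_path :: "(real \<Rightarrow> 'a) \<Rightarrow> real \<Rightarrow> 'a" where
  "rev_path \<alpha> = (\<lambda>r\<in>{0..1}. \<alpha> (1 - r))"

text \<open>\<open>concat_path \<beta> \<alpha>\<close> is \<open>\<beta> * \<alpha>\<close>: first \<open>\<alpha>\<close>, then \<open>\<beta>\<close>.\<close>
definition concat_path :: "(real \<Rightarrow> 'a) \<Rightarrow> (real \<Rightarrow> 'a) \<Rightarrow> real \<Rightarrow> 'a" where
  "concat_path \<beta> \<alpha> = (\<lambda>r\<in>{0..1}. if r \<le> 1 / 2 then \<alpha> (2 * r) else \<beta> (2 * r - 1))"

text \<open>
  The first variable of \<open>H\<close> is the deformation parameter. The rank condition is imposed on the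
  open square; it extends to the closed square by continuity.
\<close>
definition thin_homotopic :: "'a manifold \<Rightarrow> (real \<Rightarrow> 'a) \<Rightarrow> (real \<Rightarrow> 'a) \<Rightarrow> bool" where
  "thin_homotopic M \<alpha> \<beta> \<longleftrightarrow> \<alpha> \<in> sitting_paths M \<and> \<beta> \<in> sitting_paths M \<and>
     (\<exists>H. smooth_on (prod_manifold real_line real_line) M ({0..1} \<times> {0..1}) H \<and>
        (\<exists>\<epsilon>>0. \<forall>q\<in>{0..1}. \<forall>r\<in>{0..1}.
           (q \<le> \<epsilon> \<longrightarrow> H (q, r) = \<alpha> r) \<and> (1 - \<epsilon> \<le> q \<longrightarrow> H (q, r) = \<beta> r) \<and>
           (r \<le> \<epsilon> \<longrightarrow> H (q, r) = \<alpha> 0) \<and> (1 - \<epsilon> \<le> r \<longrightarrow> H (q, r) = \<alpha> 1)) \<and>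
        (\<forall>x\<in>{0<..<1} \<times> {0<..<1}.
           differential_rank_le 1 (prod_manifold real_line real_line) M H x))"


section \<open>Lazy paths\<close>

text \<open>
  The sequence \<open>(\<gamma>\<^sub>0, \<alpha>\<^sub>1, \<gamma>\<^sub>1, \<dots>, \<alpha>\<^sub>n, \<gamma>\<^sub>n)\<close> is encoded as the pair of lists
  \<open>([\<gamma>\<^sub>0, \<dots>, \<gamma>\<^sub>n], [\<alpha>\<^sub>1, \<dots>, \<alpha>\<^sub>n])\<close>; since lists are indexed from zero, \<open>\<alpha>\<^sub>i\<close> is
  the entry of index \<open>i - 1\<close>. The order \<open>n\<close> is the length of the second list.
\<close>
type_synonym ('o, 'm) lazy = "'m list \<times> (real \<Rightarrow> 'o) list"

definition lazy_paths ::
  "'o manifold \<Rightarrow> ('o, 'm) groupoid_structure \<Rightarrow> ('o, 'm) lazy set" where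
  "lazy_paths X0 G = {(\<gamma>s, \<alpha>s).
     length \<gamma>s = Suc (length \<alpha>s) \<and> set \<gamma>s \<subseteq> mor G \<and> set \<alpha>s \<subseteq> sitting_paths X0 \<and>
     (\<forall>i<length \<alpha>s. tgt G (\<gamma>s ! i) = (\<alpha>s ! i) 0 \<and> src G (\<gamma>s ! Suc i) = (\<alpha>s ! i) 1)}"

inductive elementary_equiv ::
  "'m manifold \<Rightarrow> ('o, 'm) groupoid_structure \<Rightarrow> ('o, 'm) lazy \<Rightarrow> ('o, 'm) lazy \<Rightarrow> bool"
  for X1 G where
  drop_constant:
    "length \<alpha>s = length \<gamma>s \<Longrightarrow> is_const_path \<alpha> \<Longrightarrow>
     elementary_equiv X1 G (\<gamma>s @ [g, h] @ \<gamma>s', \<alpha>s @ [\<alpha>] @ \<alpha>s')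
                           (\<gamma>s @ [cmp G h g] @ \<gamma>s', \<alpha>s @ \<alpha>s')"
| drop_identity:
    "length \<gamma>s = Suc (length \<alpha>s) \<Longrightarrow> x \<in> obj G \<Longrightarrow>
     elementary_equiv X1 G (\<gamma>s @ [unt G x] @ \<gamma>s', \<alpha>s @ [\<alpha>, \<beta>] @ \<alpha>s')
                           (\<gamma>s @ \<gamma>s', \<alpha>s @ [concat_path \<beta> \<alpha>] @ \<alpha>s')"
| transport:
    "length \<alpha>s = length \<gamma>s \<Longrightarrow> \<zeta> \<in> sitting_paths X1 \<Longrightarrow> map_path (src G) \<zeta> = \<alpha> \<Longrightarrow>
     elementary_equiv X1 G (\<gamma>s @ [g, h] @ \<gamma>s', \<alpha>s @ [\<alpha>] @ \<alpha>s')
       (\<gamma>s @ [cmp G (\<zeta> 0) g, cmp G h (ivs G (\<zeta> 1))] @ \<gamma>s', \<alpha>s @ [map_path (tgt G) \<zeta>] @ \<alpha>s')"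

definition thin_deformation ::
  "'o manifold \<Rightarrow> 'm manifold \<Rightarrow> ('o, 'm) groupoid_structure
     \<Rightarrow> ('o, 'm) lazy \<Rightarrow> ('o, 'm) lazy \<Rightarrow> bool" where
  "thin_deformation X0 X1 G = (\<lambda>(\<gamma>s, \<alpha>s) (\<gamma>s', \<alpha>s').
     length \<alpha>s' = length \<alpha>s \<and> (\<exists>\<zeta>.
       (\<forall>i\<le>length \<alpha>s. \<zeta> i \<in> sitting_paths X1 \<and> \<zeta> i 0 = \<gamma>s ! i \<and> \<zeta> i 1 = \<gamma>s' ! i) \<and>
       (\<forall>i<length \<alpha>s. thin_homotopic X0 (\<alpha>s ! i)
          (concat_path (rev_path (map_path (src G) (\<zeta> (Suc i))))
             (concat_path (\<alpha>s' ! i) (map_path (tgt G) (\<zeta> i))))) \<and>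
       is_const_path (map_path (src G) (\<zeta> 0)) \<and>
       is_const_path (map_path (tgt G) (\<zeta> (length \<alpha>s)))))"

definition lazy_move ::
  "'o manifold \<Rightarrow> 'm manifold \<Rightarrow> ('o, 'm) groupoid_structure
     \<Rightarrow> ('o, 'm) lazy \<Rightarrow> ('o, 'm) lazy \<Rightarrow> bool" where
  "lazy_move X0 X1 G \<Gamma> \<Gamma>' \<longleftrightarrow> \<Gamma> \<in> lazy_paths X0 G \<and> \<Gamma>' \<in> lazy_paths X0 G \<and>
     (elementary_equiv X1 G \<Gamma> \<Gamma>' \<or> thin_deformation X0 X1 G \<Gamma> \<Gamma>')"

definition lazy_thin_homotopy ::
  "'o manifold \<Rightarrow> 'm manifold \<Rightarrow> ('o, 'm) groupoid_structure \<Rightarrow> ('o, 'm) lazy rel" where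
  "lazy_thin_homotopy X0 X1 G = {(\<Gamma>, \<Gamma>'). \<Gamma> \<in> lazy_paths X0 G \<and> \<Gamma>' \<in> lazy_paths X0 G \<and>
     equivclp (lazy_move X0 X1 G) \<Gamma> \<Gamma>'}"


section \<open>The thin fundamental groupoid\<close>

definition lazy_src :: "('o, 'm) groupoid_structure \<Rightarrow> ('o, 'm) lazy \<Rightarrow> 'o" where
  "lazy_src G \<Gamma> = src G (hd (fst \<Gamma>))"

definition lazy_tgt :: "('o, 'm) groupoid_structure \<Rightarrow> ('o, 'm) lazy \<Rightarrow> 'o" where
  "lazy_tgt G \<Gamma> = tgt G (last (fst \<Gamma>))"

definition lazy_unt :: "('o, 'm) groupoid_structure \<Rightarrow> 'o \<Rightarrow> ('o, 'm) lazy" where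
  "lazy_unt G x = ([unt G x, unt G x], [const_path x])"

definition lazy_cmp ::
  "('o, 'm) groupoid_structure \<Rightarrow> ('o, 'm) lazy \<Rightarrow> ('o, 'm) lazy \<Rightarrow> ('o, 'm) lazy" where
  "lazy_cmp G = (\<lambda>(\<gamma>s', \<alpha>s') (\<gamma>s, \<alpha>s).
     (butlast \<gamma>s @ [cmp G (hd \<gamma>s') (last \<gamma>s)] @ tl \<gamma>s', \<alpha>s @ \<alpha>s'))"

definition lazy_ivs :: "('o, 'm) groupoid_structure \<Rightarrow> ('o, 'm) lazy \<Rightarrow> ('o, 'm) lazy" where
  "lazy_ivs G = (\<lambda>(\<gamma>s, \<alpha>s). (rev (map (ivs G) \<gamma>s), rev (map rev_path \<alpha>s)))"

text \<open>
  Operations on classes take all representatives into account: \<open>the_elem\<close> is specified only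
  if all representatives have the same source (target), and the unions below are equivalence
  classes only if the operation is independent of the representatives.
\<close>
definition thin_groupoid ::
  "'o manifold \<Rightarrow> 'm manifold \<Rightarrow> ('o, 'm) groupoid_structure
     \<Rightarrow> ('o, ('o, 'm) lazy set) groupoid_structure" where
  "thin_groupoid X0 X1 G = (let R = lazy_thin_homotopy X0 X1 G in
     \<lparr>obj = obj G,
      mor = lazy_paths X0 G // R,
      src = (\<lambda>c. the_elem (lazy_src G ` c)),
      tgt = (\<lambda>c. the_elem (lazy_tgt G ` c)),
      unt = (\<lambda>x. R `` {lazy_unt G x}),
      cmp = (\<lambda>c' c. \<Union>\<Gamma>'\<in>c'. \<Union>\<Gamma>\<in>c. R `` {lazy_cmp G \<Gamma>' \<Gamma>}),
      ivs = (\<lambda>c. \<Union>\<Gamma>\<in>c. R `` {lazy_ivs G \<Gamma>})\<rparr>)"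


section \<open>Diffeological spaces\<close>

text \<open>
  \<open>plots D n U\<close> consists of the plots of \<open>D\<close> with domain the open set \<open>U\<close> of the
  \<open>n\<close>-dimensional Euclidean space; the values of a plot outside \<open>U\<close> are irrelevant, whence the
  axiom \<open>plot_cong\<close>.
\<close>
record 'a diffeology =
  dcarrier :: "'a set"
  plots :: "nat \<Rightarrow> (nat \<Rightarrow> real) set \<Rightarrow> ((nat \<Rightarrow> real) \<Rightarrow> 'a) set"

locale diffeological_space =
  fixes D :: "'a diffeology"
  assumes plot_domain: "p \<in> plots D n U \<Longrightarrow> openin (Euclidean_space n) U"
    and plot_range: "p \<in> plots D n U \<Longrightarrow> p ` U \<subseteq> dcarrier D"
    and plot_cong: "p \<in> plots D n U \<Longrightarrow> (\<And>x. x \<in> U \<Longrightarrow> q x = p x) \<Longrightarrow> q \<in> plots D n U"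
    and plot_const: "openin (Euclidean_space n) U \<Longrightarrow> c \<in> dcarrier D \<Longrightarrow> (\<lambda>_. c) \<in> plots D n U"
    and plot_local: "openin (Euclidean_space n) U \<Longrightarrow>
          (\<And>x. x \<in> U \<Longrightarrow> \<exists>V\<subseteq>U. x \<in> V \<and> p \<in> plots D n V) \<Longrightarrow> p \<in> plots D n U"
    and plot_smooth: "p \<in> plots D n U \<Longrightarrow> smooth_euclid m n V f \<Longrightarrow> f ` V \<subseteq> U \<Longrightarrow>
          p \<circ> f \<in> plots D m V"

definition diffeological_map :: "'a diffeology \<Rightarrow> 'b diffeology \<Rightarrow> ('a \<Rightarrow> 'b) \<Rightarrow> bool" where
  "diffeological_map D E f \<longleftrightarrow> f ` dcarrier D \<subseteq> dcarrier E \<and>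
     (\<forall>n U. \<forall>p\<in>plots D n U. f \<circ> p \<in> plots E n U)"

definition manifold_diffeology :: "'a manifold \<Rightarrow> 'a diffeology" where
  "manifold_diffeology M =
     \<lparr>dcarrier = topspace (mtop M), plots = (\<lambda>n U. {p. smooth_map (Rn n) M U p})\<rparr>"

definition subset_diffeology :: "'a diffeology \<Rightarrow> 'a set \<Rightarrow> 'a diffeology" where
  "subset_diffeology D S =
     \<lparr>dcarrier = dcarrier D \<inter> S, plots = (\<lambda>n U. {p \<in> plots D n U. p ` U \<subseteq> S})\<rparr>"

definition prod_diffeology :: "'a diffeology \<Rightarrow> 'b diffeology \<Rightarrow> ('a \<times> 'b) diffeology" where
  "prod_diffeology D E =
     \<lparr>dcarrier = dcarrier D \<times> dcarrier E,
      plots = (\<lambda>n U. {p. fst \<circ> p \<in> plots D n U \<and> snd \<circ> p \<in> plots E n U})\<rparr>"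

text \<open>The \<open>k\<close>-fold power, with lists of length \<open>k\<close> as elements.\<close>
definition power_diffeology :: "nat \<Rightarrow> 'a diffeology \<Rightarrow> 'a list diffeology" where
  "power_diffeology k D =
     \<lparr>dcarrier = {xs. length xs = k \<and> set xs \<subseteq> dcarrier D},
      plots = (\<lambda>n U. {p. openin (Euclidean_space n) U \<and> (\<forall>x\<in>U. length (p x) = k) \<and>
                         (\<forall>i<k. (\<lambda>x. p x ! i) \<in> plots D n U)})\<rparr>"

text \<open>The sum of a family of diffeological spaces with pairwise disjoint carriers.\<close>
definition sum_diffeology :: "('i \<Rightarrow> 'a diffeology) \<Rightarrow> 'a diffeology" where
  "sum_diffeology D =
     \<lparr>dcarrier = (\<Union>i. dcarrier (D i)),
      plots = (\<lambda>n U. {p. openin (Euclidean_space n) U \<and>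
                         (\<forall>x\<in>U. \<exists>V\<subseteq>U. x \<in> V \<and> (\<exists>i. p \<in> plots (D i) n V))})\<rparr>"

definition quotient_diffeology :: "'a diffeology \<Rightarrow> 'a rel \<Rightarrow> 'a set diffeology" where
  "quotient_diffeology D R =
     \<lparr>dcarrier = dcarrier D // R,
      plots = (\<lambda>n U. {p. openin (Euclidean_space n) U \<and>
                         (\<forall>x\<in>U. \<exists>V\<subseteq>U. x \<in> V \<and> (\<exists>q\<in>plots D n V. \<forall>y\<in>V. p y = R `` {q y}))})\<rparr>"

locale diffeological_groupoid =
  groupoid G + base: diffeological_space D0 + arrows: diffeological_space D1
  for D0 :: "'o diffeology" and D1 :: "'m diffeology" and G :: "('o, 'm) groupoid_structure" +
  assumes obj_eq: "obj G = dcarrier D0"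
    and mor_eq: "mor G = dcarrier D1"
    and src_map: "diffeological_map D1 D0 (src G)"
    and tgt_map: "diffeological_map D1 D0 (tgt G)"
    and unt_map: "diffeological_map D0 D1 (unt G)"
    and ivs_map: "diffeological_map D1 D1 (ivs G)"
    and cmp_map: "diffeological_map (subset_diffeology (prod_diffeology D1 D1) (composable G)) D1
          (\<lambda>(h, g). cmp G h g)"


section \<open>The diffeology of the thin fundamental groupoid\<close>

definition path_diffeology :: "'a manifold \<Rightarrow> (real \<Rightarrow> 'a) diffeology" where
  "path_diffeology M =
     \<lparr>dcarrier = sitting_paths M,
      plots = (\<lambda>n U. {p. openin (Euclidean_space n) U \<and> p ` U \<subseteq> sitting_paths M \<and>
         smooth_on (prod_manifold (Rn n) real_line) M (U \<times> {0..1}) (\<lambda>(r, a). p r a)})\<rparr>"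

text \<open>
  The fibre product of lazy paths of order \<open>n\<close>, as a subspace of the product of \<open>n + 1\<close>
  copies of the arrow manifold and \<open>n\<close> copies of the path space.
\<close>
definition lazy_order_diffeology ::
  "'o manifold \<Rightarrow> 'm manifold \<Rightarrow> ('o, 'm) groupoid_structure \<Rightarrow> nat
     \<Rightarrow> ('o, 'm) lazy diffeology" where
  "lazy_order_diffeology X0 X1 G n =
     subset_diffeology
       (prod_diffeology (power_diffeology (Suc n) (manifold_diffeology X1))
                        (power_diffeology n (path_diffeology X0)))
       {\<Gamma> \<in> lazy_paths X0 G. length (snd \<Gamma>) = n}"

definition lazy_diffeology ::
  "'o manifold \<Rightarrow> 'm manifold \<Rightarrow> ('o, 'm) groupoid_structure \<Rightarrow> ('o, 'm) lazy diffeology" where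
  "lazy_diffeology X0 X1 G = sum_diffeology (lazy_order_diffeology X0 X1 G)"

definition thin_arrow_diffeology ::
  "'o manifold \<Rightarrow> 'm manifold \<Rightarrow> ('o, 'm) groupoid_structure
     \<Rightarrow> ('o, 'm) lazy set diffeology" where
  "thin_arrow_diffeology X0 X1 G =
     quotient_diffeology (lazy_diffeology X0 X1 G) (lazy_thin_homotopy X0 X1 G)"

end

theory Submission
  imports Defs
begin

text \<open>
  The groupoid laws are the harder half. Composition of lazy paths is associative on the nose, and
  the unit laws are instances of an elementary equivalence, but composition and inversion have to
  respect the relation on lazy paths. This is not visible for the thin deformations: they change
  all arrows and all paths of a lazy path at once, and reversing one of them produces concatenations
  with another bracketing. They are therefore traded for thin replacements, which put a thin
  homotopic path in the place of a single \<open>\<alpha>\<^sub>i\<close> and fix everything else. Elementary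
  equivalences and thin replacements, together the local moves, are carried to local moves of the
  same kind by composition with a further lazy path, because composition in \<open>\<X>\<close> is associative
  (\<open>local_move_cmp_left\<close>, \<open>local_move_cmp_right\<close>).

  Local moves generate the same relation (\<open>lazy_thin_homotopy_iff\<close>). A thin replacement is a
  thin deformation along constant \<open>\<zeta>\<^sub>i\<close>, since a path is thin homotopic to its concatenation with
  constant paths (\<open>thin_homotopic_pad\<close>). For the converse, a lazy path is regarded as the composite
  of its arrows and paths. Transport along \<open>\<zeta>\<^sub>i\<close> makes the square with sides \<open>s \<circ> \<zeta>\<^sub>i\<close>,
  \<open>t \<circ> \<zeta>\<^sub>i\<close>, \<open>\<zeta>\<^sub>i(0)\<close> and \<open>\<zeta>\<^sub>i(1)\<close> commute, the thin homotopies of a deformation make the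
  squares between neighbouring \<open>\<zeta>\<^sub>i\<close> commute, and pasting all squares yields
  \<open>(t \<circ> \<zeta>\<^sub>n) \<cdot> \<Gamma> = \<Gamma>' \<cdot> (s \<circ> \<zeta>\<^sub>0)\<close> up to local moves (\<open>eqv_square\<close>); the two outer
  paths are constant. Since a path followed by its reverse is thin homotopic to a constant path
  (\<open>thin_homotopic_cancel\<close>), the reverse of a lazy path is its inverse on both sides, and
  uniqueness of inverses shows that inversion is well defined on classes (\<open>eqv_ivs\<close>).

  Apart from the constant ones, all thin homotopies used here arise from given ones by composition with a smooth map from the
  square into the open square; by the chain rule this does not raise the rank of the differential
  (\<open>thin_square_compose\<close>). The change of parameters has to be smooth and to respect sitting
  instants, and this is arranged with a smooth truncation of the line to a subinterval of
  \<open>[0,1]\<close> (\<open>squeeze\<close>).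

  Smoothness of the structure maps is then formal. A plot of classes lifts locally to a plot of
  lazy paths of a fixed order, and there the structure maps act on the entries through the structure
  maps of \<open>\<X>\<close> and the reversal of paths. What is needed is that smooth maps are closed under
  composition and pairing. Smoothness is defined through iterated partial derivatives, so everything
  rests on the chain rule along curves for functions with continuous partial derivatives
  (\<open>chain_rule_curve\<close>).
\<close>

section \<open>Curves in Euclidean space and the chain rule\<close>

abbreviation Eucl :: "nat \<Rightarrow> (nat \<Rightarrow> real) set" where
  "Eucl n \<equiv> topspace (Euclidean_space n)"

lemma Eucl_iff: "x \<in> Eucl n \<longleftrightarrow> (\<forall>i\<ge>n. x i = 0)"
  by (simp add: topspace_Euclidean_space)

lemma openin_Eucl_iff: "openin (Euclidean_space n) U \<longleftrightarrow> openin (top_of_set (Eucl n)) U"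
  by (simp add: Euclidean_space_def euclidean_product_topology)

lemma openin_Eucl_subset: "openin (Euclidean_space n) U \<Longrightarrow> U \<subseteq> Eucl n"
  by (rule openin_subset)

lemma upd_Eucl: "x \<in> Eucl n \<Longrightarrow> j < n \<Longrightarrow> x(j := t) \<in> Eucl n"
  by (simp add: Eucl_iff)

text \<open>A basic open set of the product topology constrains finitely many coordinates. Points of
  \<open>Eucl n\<close> agree in the coordinates from \<open>n\<close> on, so a box in the first \<open>n\<close> coordinates with the
  least of the finitely many radii lies inside it.\<close>

lemma openin_Eucl_box_iff:
  "openin (Euclidean_space n) U \<longleftrightarrow> U \<subseteq> Eucl n \<and>
     (\<forall>x\<in>U. \<exists>e>0. \<forall>y\<in>Eucl n. (\<forall>j<n. \<bar>y j - x j\<bar> < e) \<longrightarrow> y \<in> U)"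
proof (intro iffI conjI ballI)
  assume o: "openin (Euclidean_space n) U"
  then show "U \<subseteq> Eucl n" by (rule openin_subset)
  fix x assume x: "x \<in> U"
  from o obtain T where T: "open T" "U = T \<inter> Eucl n"
    by (auto simp: openin_Eucl_iff openin_open)
  then have "openin (powertop_real UNIV) T" "x \<in> T"
    using x by (simp_all add: euclidean_product_topology)
  from product_topology_open_contains_basis[OF this]
  obtain X where X: "x \<in> Pi\<^sub>E UNIV X" "\<And>i. openin euclidean (X i)"
    "finite {i. X i \<noteq> topspace euclidean}" "Pi\<^sub>E UNIV X \<subseteq> T"
    by blast
  have "\<exists>e>0. \<forall>s. \<bar>s - x j\<bar> < e \<longrightarrow> s \<in> X j" for j
  proof -
    have "open (X j)" "x j \<in> X j" using X(1) X(2)[of j] by (simp_all add: PiE_iff)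
    then show ?thesis unfolding open_dist dist_real_def by blast
  qed
  then obtain d where d: "\<And>j. d j > 0" "\<And>j s. \<bar>s - x j\<bar> < d j \<Longrightarrow> s \<in> X j"
    by metis
  define e where "e = Min (insert 1 (d ` {..<n}))"
  have "e > 0" unfolding e_def using d(1) by (subst Min_gr_iff) auto
  moreover have "y \<in> U" if y: "y \<in> Eucl n" "\<forall>j<n. \<bar>y j - x j\<bar> < e" for y
  proof -
    have "y j \<in> X j" for j
    proof (cases "j < n")
      case True
      then have "e \<le> d j" unfolding e_def by (intro Min_le) auto
      with y True have "\<bar>y j - x j\<bar> < d j" by fastforce
      then show ?thesis by (rule d(2))
    next
      case False
      then have "y j = x j" using y x T by (auto simp: Eucl_iff)
      moreover have "x j \<in> X j" using X(1) by (simp add: PiE_iff)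
      ultimately show ?thesis by simp
    qed
    then have "y \<in> T" using X(4) by (auto simp: PiE_iff)
    with y T show ?thesis by auto
  qed
  ultimately show "\<exists>e>0. \<forall>y\<in>Eucl n. (\<forall>j<n. \<bar>y j - x j\<bar> < e) \<longrightarrow> y \<in> U" by blast
next
  assume U: "U \<subseteq> Eucl n \<and>
     (\<forall>x\<in>U. \<exists>e>0. \<forall>y\<in>Eucl n. (\<forall>j<n. \<bar>y j - x j\<bar> < e) \<longrightarrow> y \<in> U)"
  have "\<exists>T. openin (Euclidean_space n) T \<and> x \<in> T \<and> T \<subseteq> U" if x: "x \<in> U" for x
  proof -
    obtain e where e: "e > 0" "\<And>y. y \<in> Eucl n \<Longrightarrow> (\<forall>j<n. \<bar>y j - x j\<bar> < e) \<Longrightarrow> y \<in> U"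
      using U x by blast
    have "open ((\<lambda>y. y j) -` {x j - e<..<x j + e})" for j
      by (intro open_vimage continuous_on_product_coordinates) auto
    then have "open (\<Inter>j<n. (\<lambda>y. y j) -` {x j - e<..<x j + e})"
      by (intro open_INT) auto
    then have "openin (Euclidean_space n) (Eucl n \<inter> (\<Inter>j<n. (\<lambda>y. y j) -` {x j - e<..<x j + e}))"
      by (auto simp: openin_Eucl_iff openin_open)
    moreover have "x \<in> Eucl n \<inter> (\<Inter>j<n. (\<lambda>y. y j) -` {x j - e<..<x j + e})"
      using x U e by auto
    moreover have "Eucl n \<inter> (\<Inter>j<n. (\<lambda>y. y j) -` {x j - e<..<x j + e}) \<subseteq> U"
      by (auto simp: abs_less_iff intro!: e(2))
    ultimately show ?thesis by blast
  qed
  then show "openin (Euclidean_space n) U" by (subst openin_subopen) blast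
qed

lemma openin_Eucl_boxE:
  assumes "openin (Euclidean_space n) U" "x \<in> U"
  obtains e where "e > 0" "\<And>y. y \<in> Eucl n \<Longrightarrow> (\<And>j. j < n \<Longrightarrow> \<bar>y j - x j\<bar> < e) \<Longrightarrow> y \<in> U"
  using assms unfolding openin_Eucl_box_iff by metis

lemma openin_Eucl_vimage:
  assumes "openin (Euclidean_space n) U" "continuous_on U f" "f ` U \<subseteq> Eucl m"
    "openin (Euclidean_space m) V"
  shows "openin (Euclidean_space n) {x\<in>U. f x \<in> V}"
proof -
  have "openin (top_of_set U) (U \<inter> f -` V)"
    using assms by (intro continuous_openin_preimage[of U f "Eucl m"])
      (auto simp: openin_Eucl_iff)
  then have "openin (Euclidean_space n) (U \<inter> f -` V)"
    using assms(1) unfolding openin_Eucl_iff by (metis openin_trans)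
  moreover have "U \<inter> f -` V = {x\<in>U. f x \<in> V}" by auto
  ultimately show ?thesis by simp
qed

lemma eventually_upd_mem:
  assumes "openin (Euclidean_space n) U" "x \<in> U" "j < n"
  shows "\<forall>\<^sub>F t in nhds (x j). x(j := t) \<in> U"
proof -
  obtain e where e: "e > 0" "\<And>y. y \<in> Eucl n \<Longrightarrow> (\<And>i. i < n \<Longrightarrow> \<bar>y i - x i\<bar> < e) \<Longrightarrow> y \<in> U"
    using openin_Eucl_boxE[OF assms(1,2)] by metis
  have "x \<in> Eucl n" using assms openin_Eucl_subset by blast
  then show ?thesis unfolding eventually_nhds_metric
    using e upd_Eucl[of x n j] assms(3) by (intro exI[of _ e]) (auto simp: dist_real_def)
qed

lemma continuous_real_Eucl_box:
  fixes f :: "(nat \<Rightarrow> real) \<Rightarrow> real"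
  assumes "openin (Euclidean_space n) U" "continuous_on U f" "x \<in> U" "\<epsilon> > 0"
  obtains e where "e > 0"
    "\<And>y. y \<in> Eucl n \<Longrightarrow> (\<And>j. j < n \<Longrightarrow> \<bar>y j - x j\<bar> < e) \<Longrightarrow> y \<in> U \<and> \<bar>f y - f x\<bar> < \<epsilon>"
proof -
  have "openin (top_of_set U) (U \<inter> f -` {f x - \<epsilon><..<f x + \<epsilon>})"
    using assms(2) by (intro continuous_openin_preimage_gen) auto
  then have "openin (Euclidean_space n) (U \<inter> f -` {f x - \<epsilon><..<f x + \<epsilon>})"
    using assms(1) unfolding openin_Eucl_iff by (metis openin_trans)
  moreover have "x \<in> U \<inter> f -` {f x - \<epsilon><..<f x + \<epsilon>}" using assms by auto
  ultimately obtain e where e: "e > 0" "\<And>y. y \<in> Eucl n \<Longrightarrow> (\<And>j. j < n \<Longrightarrow> \<bar>y j - x j\<bar> < e) \<Longrightarrow> y \<in> U \<inter> f -` {f x - \<epsilon><..<f x + \<epsilon>}"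
    using openin_Eucl_boxE by metis
  show ?thesis
  proof (rule that[OF e(1)])
    fix y assume "y \<in> Eucl n" "\<And>j. j < n \<Longrightarrow> \<bar>y j - x j\<bar> < e"
    from e(2)[OF this] show "y \<in> U \<and> \<bar>f y - f x\<bar> < \<epsilon>" by (auto simp: abs_less_iff)
  qed
qed

lemma partial_has_derivative:
  assumes "(\<lambda>t. f (x(j := t))) field_differentiable at (x j)"
  shows "((\<lambda>t. f (x(j := t))) has_real_derivative partial j f x) (at (x j))"
  using assms unfolding partial_def by (rule field_differentiable_derivI)

text \<open>
  By the mean value theorem the increment of \<open>f\<close> in the coordinate \<open>i\<close> is the increment of that
  coordinate times a value of the partial derivative at a nearby point. The remaining coordinates of
  \<open>w\<close> move as well, so it is continuity of the partial derivative in all coordinates that makes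
  this value converge.\<close>

lemma chain_rule_one_coordinate:
  fixes f :: "(nat \<Rightarrow> real) \<Rightarrow> real" and w :: "real \<Rightarrow> nat \<Rightarrow> real"
  assumes V: "openin (Euclidean_space m) V" and i: "i < m"
    and diff: "\<And>x. x \<in> V \<Longrightarrow> (\<lambda>t. f (x(i := t))) field_differentiable at (x i)"
    and cont: "continuous_on V (partial i f)"
    and w: "\<And>t. w t \<in> Eucl m" and wc: "\<And>j. j < m \<Longrightarrow> isCont (\<lambda>t. w t j) t0"
    and w0: "w t0 \<in> V"
    and d: "((\<lambda>t. w t i) has_real_derivative d) (at t0)"
  shows "((\<lambda>t. f (w t) - f ((w t)(i := w t0 i))) has_real_derivative partial i f (w t0) * d) (at t0)"
proof -
  let ?x = "w t0"
  define D where "D t = f (w t) - f ((w t)(i := ?x i))" for t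
  (* The slope between the two points. Where they coincide it is set to the partial derivative, so
     that D = c * (w i - x i) without exception and c has the right limit at t0. *)
  define c where "c t = (if w t i = ?x i then partial i f ?x else D t / (w t i - ?x i))" for t
  have D: "D t = c t * (w t i - ?x i)" for t
    by (auto simp: c_def D_def) (metis fun_upd_triv)
  have "\<forall>\<^sub>F t in at t0. dist (c t) (partial i f ?x) < \<epsilon>" if "\<epsilon> > 0" for \<epsilon>
  proof -
    obtain e where e: "e > 0" "\<And>y. y \<in> Eucl m \<Longrightarrow> (\<And>j. j < m \<Longrightarrow> \<bar>y j - ?x j\<bar> < e) \<Longrightarrow>
        y \<in> V \<and> \<bar>partial i f y - partial i f ?x\<bar> < \<epsilon>"
      using continuous_real_Eucl_box[OF V cont w0 \<open>\<epsilon> > 0\<close>] by metis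
    have "\<forall>\<^sub>F t in at t0. \<forall>j<m. \<bar>w t j - ?x j\<bar> < e"
    proof -
      have "\<forall>\<^sub>F t in at t0. dist (w t j) (?x j) < e" if "j < m" for j
        using wc[OF that] e(1) unfolding isCont_def by (rule tendstoD)
      then have "\<forall>\<^sub>F t in at t0. \<forall>j\<in>{..<m}. \<bar>w t j - ?x j\<bar> < e"
        by (subst eventually_ball_finite_distrib) (auto simp: dist_real_def)
      then show ?thesis by (simp add: Ball_def)
    qed
    then show ?thesis
    proof eventually_elim
      case (elim t)
      show ?case
      proof (cases "w t i = ?x i")
        case True then show ?thesis using \<open>\<epsilon> > 0\<close> by (simp add: c_def)
      next
        case False
        define a where "a = min (w t i) (?x i)"
        define b where "b = max (w t i) (?x i)"
        have ab: "a < b" using False by (auto simp: a_def b_def)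
        let ?\<phi> = "\<lambda>s. f ((w t)(i := s))"
        have near: "\<bar>s - ?x i\<bar> < e" if "a \<le> s" "s \<le> b" for s
        proof -
          have "\<bar>w t i - ?x i\<bar> < e" using elim i by blast
          with that show ?thesis unfolding a_def b_def min_def max_def
            by (cases "w t i \<le> ?x i") auto
        qed
        have mem: "(w t)(i := s) \<in> V \<and> \<bar>partial i f ((w t)(i := s)) - partial i f ?x\<bar> < \<epsilon>"
          if "a \<le> s" "s \<le> b" for s
          using elim near[OF that] upd_Eucl[OF w i] by (intro e(2)) auto
        have der: "(?\<phi> has_real_derivative partial i f ((w t)(i := s))) (at s)" if "a \<le> s" "s \<le> b" for s
          using partial_has_derivative[OF diff[OF conjunct1[OF mem[OF that]]]]
          by (simp only: fun_upd_upd fun_upd_same)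
        obtain z where z: "a < z" "z < b" "?\<phi> b - ?\<phi> a = (b - a) * partial i f ((w t)(i := z))"
          using MVT2[OF ab der] by blast
        have "D t = (w t i - ?x i) * partial i f ((w t)(i := z))"
        proof (cases "w t i < ?x i")
          case True
          then have "a = w t i" "b = ?x i" by (auto simp: a_def b_def)
          with z show ?thesis by (simp add: D_def algebra_simps)
        next
          case F: False
          then have "b = w t i" "a = ?x i" by (auto simp: a_def b_def)
          with z show ?thesis by (simp add: D_def algebra_simps)
        qed
        then have "c t = partial i f ((w t)(i := z))" using False by (simp add: c_def)
        then show ?thesis using mem[of z] z by (simp add: dist_real_def)
      qed
    qed
  qed
  then have c: "(c \<longlongrightarrow> partial i f ?x) (at t0)" by (rule tendstoI)
  have "((\<lambda>t. (w t i - ?x i) / (t - t0)) \<longlongrightarrow> d) (at t0)"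
    using d by (simp add: has_field_derivative_iff)
  from tendsto_mult[OF c this]
  have "((\<lambda>t. (D t - D t0) / (t - t0)) \<longlongrightarrow> partial i f ?x * d) (at t0)"
    by (simp add: D)
  then show ?thesis
    unfolding D_def by (simp add: has_field_derivative_iff)
qed

text \<open>The curve is replaced by the curves \<open>z k\<close> that follow \<open>g\<close> in the first \<open>k\<close> coordinates and
  rest at \<open>g t0\<close> in the others. Passing from \<open>z k\<close> to \<open>z (Suc k)\<close> releases one coordinate and
  contributes one summand.\<close>

lemma chain_rule_curve:
  fixes f :: "(nat \<Rightarrow> real) \<Rightarrow> real" and g :: "real \<Rightarrow> nat \<Rightarrow> real"
  assumes V: "openin (Euclidean_space m) V"
    and diff: "\<And>x i. x \<in> V \<Longrightarrow> i < m \<Longrightarrow> (\<lambda>t. f (x(i := t))) field_differentiable at (x i)"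
    and cont: "\<And>i. i < m \<Longrightarrow> continuous_on V (partial i f)"
    and g: "\<And>t. g t \<in> Eucl m" and g0: "g t0 \<in> V"
    and d: "\<And>i. i < m \<Longrightarrow> ((\<lambda>t. g t i) has_real_derivative d i) (at t0)"
  shows "((\<lambda>t. f (g t)) has_real_derivative (\<Sum>i<m. partial i f (g t0) * d i)) (at t0)"
proof -
  define z where "z k t = (\<lambda>j. if j < k then g t j else g t0 j)" for k t
  have zE: "z k t \<in> Eucl m" for k t using g by (auto simp: z_def Eucl_iff)
  have z0: "z k t0 = g t0" for k by (auto simp: z_def)
  have gc: "isCont (\<lambda>t. g t j) t0" if "j < m" for j using d[OF that] by (rule DERIV_isCont)
  have "((\<lambda>t. f (z k t)) has_real_derivative (\<Sum>i<k. partial i f (g t0) * d i)) (at t0)"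
    if "k \<le> m" for k
    using that
  proof (induction k)
    case 0
    then show ?case by (simp add: z_def)
  next
    case (Suc k)
    then have k: "k < m" by simp
    have "((\<lambda>t. f (z (Suc k) t) - f ((z (Suc k) t)(k := z (Suc k) t0 k))) has_real_derivative
        partial k f (z (Suc k) t0) * d k) (at t0)"
    proof (rule chain_rule_one_coordinate[OF V k])
      show "isCont (\<lambda>t. z (Suc k) t j) t0" if "j < m" for j
        using gc[OF that] by (cases "j < Suc k") (simp_all add: z_def)
      show "((\<lambda>t. z (Suc k) t k) has_real_derivative d k) (at t0)"
        using d[OF k] by (simp add: z_def)
    qed (use diff cont k zE z0 g0 in auto)
    moreover have "(z (Suc k) t)(k := z (Suc k) t0 k) = z k t" for t
      by (auto simp: z_def)
    ultimately have "((\<lambda>t. f (z (Suc k) t) - f (z k t)) has_real_derivative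
        partial k f (g t0) * d k) (at t0)"
      by (simp add: z0)
    from DERIV_add[OF this Suc.IH] k show ?case by (simp add: add.commute)
  qed
  from this[of m] have "((\<lambda>t. f (z m t)) has_real_derivative (\<Sum>i<m. partial i f (g t0) * d i)) (at t0)"
    by simp
  moreover have "z m t = g t" for t
    using g[of t] g[of t0] by (auto simp: z_def Eucl_iff)
  ultimately show ?thesis by simp
qed


section \<open>The classes C^k\<close>

lemma partial_cong:
  assumes "openin (Euclidean_space n) U" "\<And>x. x \<in> U \<Longrightarrow> f x = g x" "x \<in> U" "j < n"
  shows "partial j f x = partial j g x"
  unfolding partial_def
  by (rule deriv_cong_ev, rule eventually_mono[OF eventually_upd_mem[OF assms(1,3,4)]])
    (auto simp: assms(2))

lemma Ck_cong:
  assumes "openin (Euclidean_space n) U" "\<And>x. x \<in> U \<Longrightarrow> f x = g x" "Ck k n U f"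
  shows "Ck k n U g"
  using assms(2,3)
proof (induction k arbitrary: f g)
  case 0
  then show ?case using continuous_on_cong[of U U f g] by simp
next
  case (Suc k)
  have "continuous_on U g" using Suc.prems continuous_on_cong[of U U f g] by simp
  moreover have "(\<lambda>t. g (x(j := t))) field_differentiable at (x j)" if "j < n" "x \<in> U" for j x
  proof -
    have "(\<lambda>t. f (x(j := t))) field_differentiable at (x j)" using Suc.prems that by simp
    then obtain d where "((\<lambda>t. f (x(j := t))) has_field_derivative d) (at (x j))"
      by (auto simp: field_differentiable_def)
    moreover have "\<forall>\<^sub>F t in nhds (x j). f (x(j := t)) = g (x(j := t))"
      by (rule eventually_mono[OF eventually_upd_mem[OF assms(1) that(2,1)]]) (rule Suc.prems(1))
    ultimately have "((\<lambda>t. g (x(j := t))) has_field_derivative d) (at (x j))"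
      by (subst (asm) DERIV_cong_ev[OF refl _ refl])
    then show ?thesis by (auto simp: field_differentiable_def)
  qed
  moreover have "Ck k n U (partial j g)" if "j < n" for j
  proof (rule Suc.IH)
    show "partial j f x = partial j g x" if "x \<in> U" for x
      by (rule partial_cong[OF assms(1) Suc.prems(1) that \<open>j < n\<close>])
    show "Ck k n U (partial j f)" using Suc.prems(2) \<open>j < n\<close> by simp
  qed
  ultimately show ?case by simp
qed

text \<open>The operator \<open>partial\<close> is defined by the total function \<open>deriv\<close>. This rule spares computing
  with it: it suffices to know the partial derivatives on \<open>U\<close>.\<close>

lemma Ck_SucI:
  assumes U: "openin (Euclidean_space n) U" and "continuous_on U f"
    and der: "\<And>j x. j < n \<Longrightarrow> x \<in> U \<Longrightarrow> ((\<lambda>t. f (x(j := t))) has_real_derivative D j x) (at (x j))"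
    and Ck: "\<And>j. j < n \<Longrightarrow> Ck k n U (D j)"
  shows "Ck (Suc k) n U f"
proof -
  have "partial j f x = D j x" if "j < n" "x \<in> U" for j x
    unfolding partial_def by (rule DERIV_imp_deriv[OF der[OF that]])
  then have "Ck k n U (partial j f)" if "j < n" for j
    using that by (intro Ck_cong[OF U _ Ck]) auto
  then show ?thesis unfolding Ck.simps field_differentiable_def using assms(2) der by blast
qed

lemma Ck_SucD:
  assumes "Ck (Suc k) n U f" "j < n"
  shows "x \<in> U \<Longrightarrow> ((\<lambda>t. f (x(j := t))) has_real_derivative partial j f x) (at (x j))"
    and "Ck k n U (partial j f)"
  using assms by (auto intro!: partial_has_derivative)

lemma Ck_continuous: "Ck k n U f \<Longrightarrow> continuous_on U f"
  by (cases k) auto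

lemma Ck_Suc_imp: "Ck (Suc k) n U f \<Longrightarrow> Ck k n U f"
  by (induction k arbitrary: f) auto

lemma Ck_subset: "Ck k n U f \<Longrightarrow> V \<subseteq> U \<Longrightarrow> Ck k n V f"
  by (induction k arbitrary: f) (auto intro: continuous_on_subset)

lemma Ck_const: 
  assumes "openin (Euclidean_space n) U" shows "Ck k n U (\<lambda>_. c)"
proof (induction k arbitrary: c)
  case (Suc k)
  show ?case by (rule Ck_SucI[where D = "\<lambda>_ _. 0"]) (use Suc assms in auto)
qed auto

lemma continuous_on_coordinate: "continuous_on U (\<lambda>x::nat \<Rightarrow> real. x i)"
  by (rule continuous_on_subset[OF continuous_on_product_coordinates]) auto

lemma Ck_coordinate:
  assumes "openin (Euclidean_space n) U" shows "Ck k n U (\<lambda>x. x i)"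
proof (cases k)
  case (Suc k')
  show ?thesis unfolding Suc
  proof (rule Ck_SucI[where D = "\<lambda>j _. if i = j then 1 else 0", OF assms continuous_on_coordinate])
    show "((\<lambda>t. (x(j := t)) i) has_real_derivative (if i = j then 1 else 0)) (at (x j))" for j x
      by (cases "i = j") auto
  qed (use Ck_const[OF assms] in auto)
qed (auto intro: continuous_on_coordinate)

lemma Ck_add:
  assumes U: "openin (Euclidean_space n) U" and "Ck k n U f" "Ck k n U g"
  shows "Ck k n U (\<lambda>x. f x + g x)"
  using assms(2,3)
proof (induction k arbitrary: f g)
  case (Suc k)
  show ?case
    by (rule Ck_SucI[OF U _ DERIV_add[OF Ck_SucD(1)[OF Suc.prems(1)] Ck_SucD(1)[OF Suc.prems(2)]]])
      (use Suc.prems in \<open>auto intro!: continuous_on_add Suc.IH\<close>)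
qed (auto intro: continuous_on_add)

lemma Ck_mult:
  assumes U: "openin (Euclidean_space n) U" and "Ck k n U f" "Ck k n U g"
  shows "Ck k n U (\<lambda>x. f x * g x)"
  using assms(2,3)
proof (induction k arbitrary: f g)
  case (Suc k)
  show ?case
  proof (rule Ck_SucI[OF U, where D = "\<lambda>j x. partial j f x * g x + partial j g x * f x"])
    show "continuous_on U (\<lambda>x. f x * g x)" using Suc.prems by (auto intro: continuous_on_mult)
    show "((\<lambda>t. f (x(j := t)) * g (x(j := t))) has_real_derivative
        partial j f x * g x + partial j g x * f x) (at (x j))" if "j < n" "x \<in> U" for j x
      using DERIV_mult[OF Ck_SucD(1)[OF Suc.prems(1) that] Ck_SucD(1)[OF Suc.prems(2) that]]
      by (simp only: fun_upd_triv)
    show "Ck k n U (\<lambda>x. partial j f x * g x + partial j g x * f x)" if "j < n" for j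
      by (rule Ck_add[OF U Suc.IH[OF Ck_SucD(2)[OF Suc.prems(1) that] Ck_Suc_imp[OF Suc.prems(2)]]
            Suc.IH[OF Ck_SucD(2)[OF Suc.prems(2) that] Ck_Suc_imp[OF Suc.prems(1)]]])
  qed
qed (auto intro: continuous_on_mult)

lemma Ck_sum:
  assumes "openin (Euclidean_space n) U" "\<And>i. i \<in> I \<Longrightarrow> Ck k n U (f i)"
  shows "Ck k n U (\<lambda>x. \<Sum>i\<in>I. f i x)"
  using assms(2)
proof (induction I rule: infinite_finite_induct)
  case (insert a I)
  then show ?case using Ck_add[OF assms(1), of k "f a" "\<lambda>x. \<Sum>i\<in>I. f i x"]
    by (simp del: Ck.simps)
qed (simp_all add: Ck_const[OF assms(1)] del: Ck.simps)

text \<open>The curve \<open>t \<mapsto> h (x(j := t))\<close> is defined as long as \<open>x(j := t)\<close> stays in \<open>U\<close>; further away it is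
  continued by the constant \<open>h x\<close>, which does not affect the derivative at \<open>x j\<close>.\<close>

lemma chain_rule_partial:
  assumes U: "openin (Euclidean_space n) U" and V: "openin (Euclidean_space m) V"
    and f: "Ck (Suc 0) m V f" and h: "\<And>i. i < m \<Longrightarrow> Ck (Suc 0) n U (\<lambda>x. h x i)"
    and hV: "h ` U \<subseteq> V" and x: "x \<in> U" and j: "j < n"
  shows "((\<lambda>t. f (h (x(j := t)))) has_real_derivative
           (\<Sum>i<m. partial i f (h x) * partial j (\<lambda>x. h x i) x)) (at (x j))"
proof -
  let ?g = "\<lambda>t. if x(j := t) \<in> U then h (x(j := t)) else h x"
  have ev: "\<forall>\<^sub>F t in nhds (x j). x(j := t) \<in> U" by (rule eventually_upd_mem[OF U x j])
  have "((\<lambda>t. f (?g t)) has_real_derivative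
           (\<Sum>i<m. partial i f (?g (x j)) * partial j (\<lambda>x. h x i) x)) (at (x j))"
  proof (rule chain_rule_curve[OF V])
    show "?g t \<in> Eucl m" for t using hV x openin_Eucl_subset[OF V] by auto
    show "?g (x j) \<in> V" using hV x by auto
    fix i assume i: "i < m"
    have "((\<lambda>t. h (x(j := t)) i) has_real_derivative partial j (\<lambda>x. h x i) x) (at (x j))"
      using Ck_SucD(1)[OF h[OF i] j x] .
    moreover have "\<forall>\<^sub>F t in nhds (x j). h (x(j := t)) i = ?g t i"
      by (rule eventually_mono[OF ev]) simp
    ultimately show "((\<lambda>t. ?g t i) has_real_derivative partial j (\<lambda>x. h x i) x) (at (x j))"
      by (subst (asm) DERIV_cong_ev[OF refl _ refl])
    show "continuous_on V (partial i f)" using f i unfolding Ck.simps by blast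
    show "(\<lambda>t. f (y(i := t))) field_differentiable at (y i)" if "y \<in> V" for y
      using f i that unfolding Ck.simps by blast
  qed
  moreover have "\<forall>\<^sub>F t in nhds (x j). f (?g t) = f (h (x(j := t)))"
    by (rule eventually_mono[OF ev]) simp
  ultimately show ?thesis using x
    by (subst (asm) DERIV_cong_ev[OF refl _ refl]) auto
qed

lemma continuous_on_Eucl:
  assumes "h ` U \<subseteq> Eucl m" "\<And>i. i < m \<Longrightarrow> continuous_on U (\<lambda>x. h x i)"
  shows "continuous_on U h"
proof (rule continuous_on_coordinatewise_then_product)
  fix i show "continuous_on U (\<lambda>x. h x i)"
  proof (cases "i < m")
    case False
    then have "\<And>x. x \<in> U \<Longrightarrow> h x i = 0" using assms(1) by (auto simp: Eucl_iff image_subset_iff)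
    then show ?thesis by (subst continuous_on_cong[OF refl, where g = "\<lambda>_. 0"]) auto
  qed (rule assms(2))
qed

lemma Ck_compose_Suc:
  assumes U: "openin (Euclidean_space n) U" and V: "openin (Euclidean_space m) V"
    and f: "Ck (Suc k) m V f" and h: "\<And>i. i < m \<Longrightarrow> Ck (Suc k) n U (\<lambda>x. h x i)" and hV: "h ` U \<subseteq> V"
    and IH: "\<And>f. Ck k m V f \<Longrightarrow> Ck k n U (\<lambda>x. f (h x))"
  shows "Ck (Suc k) n U (\<lambda>x. f (h x))"
proof (rule Ck_SucI[OF U, where D = "\<lambda>j x. \<Sum>i<m. partial i f (h x) * partial j (\<lambda>x. h x i) x"])
  have mono: "Ck (Suc k) l W p \<Longrightarrow> Ck (Suc 0) l W p" for l W p
    by (auto simp: Ck_continuous)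
  show "((\<lambda>t. f (h (x(j := t)))) has_real_derivative
      (\<Sum>i<m. partial i f (h x) * partial j (\<lambda>x. h x i) x)) (at (x j))" if "j < n" "x \<in> U" for j x
    by (rule chain_rule_partial[OF U V mono[OF f] mono[OF h] hV that(2,1)])
  show "continuous_on U (\<lambda>x. f (h x))"
    using IH[OF Ck_Suc_imp[OF f]] by (rule Ck_continuous)
  show "Ck k n U (\<lambda>x. \<Sum>i<m. partial i f (h x) * partial j (\<lambda>x. h x i) x)" if "j < n" for j
  proof (rule Ck_sum[OF U])
    fix i assume "i \<in> {..<m}"
    then have i: "i < m" by simp
    show "Ck k n U (\<lambda>x. partial i f (h x) * partial j (\<lambda>x. h x i) x)"
      by (rule Ck_mult[OF U IH[OF Ck_SucD(2)[OF f i]] Ck_SucD(2)[OF h[OF i] that]])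
  qed
qed

lemma Ck_compose:
  assumes U: "openin (Euclidean_space n) U" and V: "openin (Euclidean_space m) V"
    and hV: "h ` U \<subseteq> V"
  shows "Ck k m V f \<Longrightarrow> (\<And>i. i < m \<Longrightarrow> Ck k n U (\<lambda>x. h x i)) \<Longrightarrow> Ck k n U (\<lambda>x. f (h x))"
proof (induction k arbitrary: f)
  case 0
  have "h ` U \<subseteq> Eucl m" using hV openin_Eucl_subset[OF V] by (rule order_trans)
  moreover have "continuous_on U (\<lambda>x. h x i)" if "i < m" for i using 0(2)[OF that] by simp
  ultimately have "continuous_on U h" by (rule continuous_on_Eucl)
  moreover have "continuous_on V f" using 0(1) by simp
  ultimately show ?case using continuous_on_compose2[of V f U h] hV by simp
next
  case (Suc k)
  have "Ck k n U (\<lambda>x. h x i)" if "i < m" for i using Suc.prems(2)[OF that] by (rule Ck_Suc_imp)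
  then have "Ck k n U (\<lambda>x. f (h x))" if "Ck k m V f" for f using that by (rule Suc.IH[rotated])
  with Suc.prems show ?case by (rule Ck_compose_Suc[OF U V _ _ hV])
qed

text \<open>Functions of one variable enter through families that are closed under differentiation. This
  applies to functions whose iterated derivatives have no manageable closed form.\<close>

lemma Ck_compose_family:
  assumes U: "openin (Euclidean_space n) U"
    and F: "\<And>i x. (F i has_real_derivative F (d i) x) (at x)"
    and "Ck k n U g"
  shows "Ck k n U (\<lambda>x. F i (g x))"
  using assms(3)
proof (induction k arbitrary: i)
  case 0
  have Fc: "continuous_on UNIV (F i)"
    by (rule DERIV_continuous_on[OF has_field_derivative_at_within[OF F]])
  then show ?case using 0 continuous_on_compose2[OF Fc] by simp
next
  case (Suc k)
  have Fc: "continuous_on UNIV (F i)"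
    by (rule DERIV_continuous_on[OF has_field_derivative_at_within[OF F]])
  show ?case
  proof (rule Ck_SucI[OF U, where D = "\<lambda>j x. F (d i) (g x) * partial j g x"])
    show "continuous_on U (\<lambda>x. F i (g x))"
      using continuous_on_compose2[OF Fc Ck_continuous[OF Suc.prems]] by simp
    show "((\<lambda>t. F i (g (x(j := t)))) has_real_derivative F (d i) (g x) * partial j g x) (at (x j))"
      if "j < n" "x \<in> U" for j x
      using DERIV_chain2[of "F i" _ "\<lambda>t. g (x(j := t))" "x j", OF F Ck_SucD(1)[OF Suc.prems that]]
      by (simp only: fun_upd_triv)
    show "Ck k n U (\<lambda>x. F (d i) (g x) * partial j g x)" if "j < n" for j
      by (rule Ck_mult[OF U Suc.IH[OF Ck_Suc_imp[OF Suc.prems]] Ck_SucD(2)[OF Suc.prems that]])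
  qed
qed

definition smooth_fun :: "nat \<Rightarrow> (nat \<Rightarrow> real) set \<Rightarrow> ((nat \<Rightarrow> real) \<Rightarrow> real) \<Rightarrow> bool" where
  "smooth_fun n U f \<longleftrightarrow> openin (Euclidean_space n) U \<and> (\<forall>k. Ck k n U f)"

lemma smooth_euclid_iff:
  "smooth_euclid n m U f \<longleftrightarrow> openin (Euclidean_space n) U \<and> f ` U \<subseteq> Eucl m \<and>
     (\<forall>i<m. smooth_fun n U (\<lambda>x. f x i))"
  by (auto simp: smooth_euclid_def smooth_fun_def)

lemma smooth_fun_const: "openin (Euclidean_space n) U \<Longrightarrow> smooth_fun n U (\<lambda>_. c)"
  by (simp add: smooth_fun_def Ck_const del: Ck.simps)

lemma smooth_fun_coordinate: "openin (Euclidean_space n) U \<Longrightarrow> smooth_fun n U (\<lambda>x. x i)"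
  by (simp add: smooth_fun_def Ck_coordinate del: Ck.simps)

lemma smooth_fun_add: "smooth_fun n U f \<Longrightarrow> smooth_fun n U g \<Longrightarrow> smooth_fun n U (\<lambda>x. f x + g x)"
  by (simp add: smooth_fun_def Ck_add del: Ck.simps)

lemma smooth_fun_mult: "smooth_fun n U f \<Longrightarrow> smooth_fun n U g \<Longrightarrow> smooth_fun n U (\<lambda>x. f x * g x)"
  by (simp add: smooth_fun_def Ck_mult del: Ck.simps)

lemma smooth_fun_open: "smooth_fun n U f \<Longrightarrow> openin (Euclidean_space n) U"
  by (simp add: smooth_fun_def)

lemma smooth_fun_diff:
  assumes "smooth_fun n U f" "smooth_fun n U g" shows "smooth_fun n U (\<lambda>x. f x - g x)"
  using smooth_fun_add[OF assms(1) smooth_fun_mult[OF smooth_fun_const[of n U "-1"] assms(2)]] assms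
  by (simp add: smooth_fun_open)

lemma smooth_fun_cong:
  "(\<And>x. x \<in> U \<Longrightarrow> f x = g x) \<Longrightarrow> smooth_fun n U f \<Longrightarrow> smooth_fun n U g"
  unfolding smooth_fun_def using Ck_cong by blast

lemma smooth_fun_subset:
  "smooth_fun n U f \<Longrightarrow> openin (Euclidean_space n) V \<Longrightarrow> V \<subseteq> U \<Longrightarrow> smooth_fun n V f"
  unfolding smooth_fun_def using Ck_subset by blast

lemma smooth_euclid_subset:
  "smooth_euclid n m U f \<Longrightarrow> openin (Euclidean_space n) V \<Longrightarrow> V \<subseteq> U \<Longrightarrow> smooth_euclid n m V f"
  unfolding smooth_euclid_iff using smooth_fun_subset by (metis image_mono order_trans)

lemma smooth_euclid_cong:
  assumes eq: "\<And>x. x \<in> U \<Longrightarrow> f x = g x" and f: "smooth_euclid n m U f"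
  shows "smooth_euclid n m U g"
  unfolding smooth_euclid_iff
proof (intro conjI allI impI)
  show "smooth_fun n U (\<lambda>x. g x i)" if "i < m" for i
  proof (rule smooth_fun_cong[of U "\<lambda>x. f x i"])
    show "smooth_fun n U (\<lambda>x. f x i)" using f that by (simp add: smooth_euclid_iff)
  qed (simp add: eq)
  show "g ` U \<subseteq> Eucl m" using f eq by (simp add: smooth_euclid_iff image_subset_iff)
qed (use f in \<open>simp add: smooth_euclid_iff\<close>)

lemma smooth_euclid_id: "openin (Euclidean_space n) U \<Longrightarrow> smooth_euclid n n U (\<lambda>x. x)"
  using openin_Eucl_subset by (simp add: smooth_euclid_iff smooth_fun_coordinate)

lemma smooth_euclid_continuous:
  assumes "smooth_euclid n m U f" shows "continuous_on U f"
proof (rule continuous_on_Eucl)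
  show "f ` U \<subseteq> Eucl m" using assms by (simp add: smooth_euclid_iff)
  show "continuous_on U (\<lambda>x. f x i)" if "i < m" for i
    using assms that unfolding smooth_euclid_iff smooth_fun_def by (metis Ck_continuous)
qed

lemma smooth_fun_compose:
  assumes f: "smooth_euclid n m U f" and g: "smooth_fun m V g" and fUV: "f ` U \<subseteq> V"
  shows "smooth_fun n U (\<lambda>x. g (f x))"
  unfolding smooth_fun_def
proof (intro conjI allI)
  show U: "openin (Euclidean_space n) U" using f by (simp add: smooth_euclid_iff)
  fix k
  show "Ck k n U (\<lambda>x. g (f x))"
  proof (rule Ck_compose[OF U _ fUV])
    show "Ck k n U (\<lambda>x. f x i)" if "i < m" for i
      using f that unfolding smooth_euclid_iff smooth_fun_def by blast
  qed (use g in \<open>simp_all add: smooth_fun_def del: Ck.simps\<close>)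
qed

lemma smooth_euclid_compose:
  assumes f: "smooth_euclid n m U f" and g: "smooth_euclid m l V g" and "f ` U \<subseteq> V"
  shows "smooth_euclid n l U (g \<circ> f)"
proof -
  have "smooth_fun n U (\<lambda>x. g (f x) i)" if "i < l" for i
  proof (rule smooth_fun_compose[OF f])
    show "smooth_fun m V (\<lambda>y. g y i)" using g that by (simp add: smooth_euclid_iff)
  qed fact
  then show ?thesis using assms unfolding smooth_euclid_iff by (simp add: image_subset_iff)
qed

section \<open>A smooth step and a smooth truncation\<close>

text \<open>Polynomials in \<open>1 / x\<close> times \<open>exp (- 1 / x)\<close>, continued by zero, form a family closed under
  differentiation that contains the usual function that is flat at \<open>0\<close>.\<close>

definition flat_fun :: "real poly \<Rightarrow> real \<Rightarrow> real" where
  "flat_fun p x = (if x > 0 then poly p (1 / x) * exp (- (1 / x)) else 0)"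

lemma poly_times_exp_minus_tendsto_0: "((\<lambda>y::real. poly p y * exp (- y)) \<longlongrightarrow> 0) at_top"
proof -
  have "((\<lambda>y. \<Sum>i\<le>degree p. coeff p i * (y ^ i / exp y)) \<longlongrightarrow> (\<Sum>i\<le>degree p. coeff p i * 0)) at_top"
    by (intro tendsto_sum tendsto_mult tendsto_const tendsto_power_div_exp_0)
  moreover have "poly p y * exp (- y) = (\<Sum>i\<le>degree p. coeff p i * (y ^ i / exp y))" for y :: real
    by (simp add: poly_altdef exp_minus sum_distrib_right divide_inverse mult.assoc)
  ultimately show ?thesis by simp
qed

lemma flat_fun_tendsto_0: "((\<lambda>x. flat_fun p x) \<longlongrightarrow> 0) (at_right 0)"
proof -
  have "((\<lambda>x. poly p (inverse x) * exp (- inverse x)) \<longlongrightarrow> 0) (at_right (0::real))"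
    by (rule filterlim_compose[OF poly_times_exp_minus_tendsto_0 filterlim_inverse_at_top_right])
  moreover have "\<forall>\<^sub>F x in at_right (0::real). poly p (inverse x) * exp (- inverse x) = flat_fun p x"
    using eventually_at_right_less[of 0] by eventually_elim (simp add: flat_fun_def inverse_eq_divide)
  ultimately show ?thesis by (rule Lim_transform_eventually)
qed

lemma flat_fun_derivative:
  "(flat_fun p has_real_derivative flat_fun ([:0, 0, 1:] * (p - pderiv p)) x) (at x)"
proof -
  consider "x > 0" | "x < 0" | "x = 0" by linarith
  then show ?thesis
  proof cases
    case 1
    have "((\<lambda>x. poly p (1 / x) * exp (- (1 / x))) has_real_derivative
       flat_fun ([:0, 0, 1:] * (p - pderiv p)) x) (at x)"
      using 1 by (auto intro!: derivative_eq_intros simp: flat_fun_def field_simps power2_eq_square)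
    moreover have "\<forall>\<^sub>F y in nhds x. poly p (1 / y) * exp (- (1 / y)) = flat_fun p y"
      using eventually_nhds_in_open[of "{0<..}" x] 1
      by (auto elim!: eventually_mono simp: flat_fun_def)
    ultimately show ?thesis by (subst (asm) DERIV_cong_ev[OF refl _ refl])
  next
    case 2
    have "\<forall>\<^sub>F y in nhds x. 0 = flat_fun p y"
      using eventually_nhds_in_open[of "{..<0}" x] 2
      by (auto elim!: eventually_mono simp: flat_fun_def)
    moreover have "((\<lambda>_. 0) has_real_derivative 0) (at x)" by simp
    ultimately have "(flat_fun p has_real_derivative 0) (at x)"
      by (subst (asm) DERIV_cong_ev[OF refl _ refl])
    then show ?thesis using 2 by (simp add: flat_fun_def)
  next
    case 3
    have "((\<lambda>h. flat_fun p h / h) \<longlongrightarrow> 0) (at_right 0)"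
    proof (rule Lim_transform_eventually[OF flat_fun_tendsto_0[of "pCons 0 p"]])
      show "\<forall>\<^sub>F x in at_right 0. flat_fun (pCons 0 p) x = flat_fun p x / x"
        using eventually_at_right_less[of 0] by eventually_elim (simp add: flat_fun_def)
    qed
    moreover have "((\<lambda>h. flat_fun p h / h) \<longlongrightarrow> 0) (at_left 0)"
    proof (rule Lim_transform_eventually[OF tendsto_const])
      show "\<forall>\<^sub>F x in at_left 0. 0 = flat_fun p x / x"
        by (auto simp: eventually_at_filter flat_fun_def)
    qed
    ultimately have "((\<lambda>h. flat_fun p h / h) \<longlongrightarrow> 0) (at 0)"
      by (simp add: filterlim_at_split)
    then show ?thesis using 3 by (simp add: has_field_derivative_iff flat_fun_def)
  qed
qed

lemma smooth_fun_flat: "smooth_fun n U g \<Longrightarrow> smooth_fun n U (\<lambda>x. flat_fun p (g x))"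
  unfolding smooth_fun_def
  using Ck_compose_family[where F = flat_fun and d = "\<lambda>p. [:0, 0, 1:] * (p - pderiv p)",
      OF _ flat_fun_derivative]
  by blast

text \<open>For \<open>x \<le> 0\<close> the argument of the outer \<open>flat_fun 1\<close> is not positive, and for \<open>x \<ge> 1\<close> it is
  the constant \<open>flat_fun 1 1\<close>. Iterating the flat function in this way gives a smooth step whose
  only denominator is a constant.\<close>

definition smooth_step :: "real \<Rightarrow> real" where
  "smooth_step x = flat_fun 1 (flat_fun 1 1 - flat_fun 1 (1 - x)) / flat_fun 1 (flat_fun 1 1)"

lemma flat_fun_1_mono: "x \<le> y \<Longrightarrow> flat_fun 1 x \<le> flat_fun 1 y"
  by (auto simp: flat_fun_def frac_le)

lemma flat_fun_1_pos: "x > 0 \<Longrightarrow> flat_fun 1 x > 0"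
  by (simp add: flat_fun_def)

lemma flat_fun_nonpos: "x \<le> 0 \<Longrightarrow> flat_fun p x = 0"
  by (simp add: flat_fun_def)

lemma smooth_step_0: "x \<le> 0 \<Longrightarrow> smooth_step x = 0"
  using flat_fun_1_mono[of 1 "1 - x"] by (simp add: smooth_step_def flat_fun_nonpos)

lemma smooth_step_1: "x \<ge> 1 \<Longrightarrow> smooth_step x = 1"
  using flat_fun_1_pos[OF flat_fun_1_pos[of 1]] by (simp add: smooth_step_def flat_fun_nonpos)

lemma smooth_step_bounds: "0 \<le> smooth_step x" "smooth_step x \<le> 1"
proof -
  have pos: "flat_fun 1 (flat_fun 1 1) > 0" by (intro flat_fun_1_pos) auto
  have nonneg: "0 \<le> flat_fun 1 y" for y by (simp add: flat_fun_def)
  show "0 \<le> smooth_step x" unfolding smooth_step_def by (intro divide_nonneg_nonneg nonneg)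
  show "smooth_step x \<le> 1" unfolding smooth_step_def using pos
    by (simp add: divide_le_eq_1) (rule flat_fun_1_mono, simp add: nonneg)
qed

lemma smooth_fun_step: "smooth_fun n U g \<Longrightarrow> smooth_fun n U (\<lambda>x. smooth_step (g x))"
  using smooth_fun_mult[OF smooth_fun_const[of n U "1 / flat_fun 1 (flat_fun 1 1)"]
    smooth_fun_flat[OF smooth_fun_diff[OF smooth_fun_const[of n U "flat_fun 1 1"]
      smooth_fun_flat[OF smooth_fun_diff[OF smooth_fun_const[of n U 1]]]]], of g 1 1]
  by (simp add: smooth_step_def smooth_fun_open)

text \<open>For \<open>0 < a \<le> 1/4\<close> the function \<open>squeeze a\<close> maps the line into \<open>[a, 1 - a]\<close>, is the identity on
  \<open>[2a, 1 - 2a]\<close>, and moves the remaining points of \<open>[0,1]\<close> only within \<open>[0, 2a]\<close> and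
  \<open>[1 - 2a, 1]\<close>. A path that is constant on these two intervals does not change when composed with
  it, while a reparametrisation followed by it takes values in the open interval \<open>(0,1)\<close>.\<close>

definition cut_below :: "real \<Rightarrow> real \<Rightarrow> real" where
  "cut_below a x = a + smooth_step ((x - a) / a) * (x - a)"

definition squeeze :: "real \<Rightarrow> real \<Rightarrow> real" where
  "squeeze a x = 1 - cut_below a (1 - cut_below a x)"

lemma cut_below:
  assumes "a > 0"
  shows "x \<le> a \<Longrightarrow> cut_below a x = a" "x \<ge> 2 * a \<Longrightarrow> cut_below a x = x"
    "cut_below a x \<ge> a" "x \<le> 2 * a \<Longrightarrow> cut_below a x \<le> 2 * a" "x \<ge> a \<Longrightarrow> cut_below a x \<le> x"
proof -
  show 1: "x \<le> a \<Longrightarrow> cut_below a x = a"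
    using assms by (simp add: cut_below_def smooth_step_0 divide_nonpos_pos)
  show "x \<ge> 2 * a \<Longrightarrow> cut_below a x = x"
    using assms by (simp add: cut_below_def smooth_step_1)
  show "cut_below a x \<ge> a"
    using 1 by (cases "x \<le> a") (auto simp: cut_below_def smooth_step_bounds)
  show 2: "x \<ge> a \<Longrightarrow> cut_below a x \<le> x"
    using mult_right_mono[OF smooth_step_bounds(2), of "x - a" "(x - a) / a"] by (simp add: cut_below_def)
  show "x \<le> 2 * a \<Longrightarrow> cut_below a x \<le> 2 * a"
    using 1 2 assms by (cases "x \<le> a") auto
qed

lemma squeeze:
  assumes "0 < a" "a \<le> 1 / 4"
  shows "a \<le> squeeze a x" "squeeze a x \<le> 1 - a"
    "2 * a \<le> x \<Longrightarrow> x \<le> 1 - 2 * a \<Longrightarrow> squeeze a x = x"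
    "x \<le> 2 * a \<Longrightarrow> squeeze a x \<le> 2 * a" "1 - 2 * a \<le> x \<Longrightarrow> 1 - 2 * a \<le> squeeze a x"
    "x \<le> a \<Longrightarrow> squeeze a x = a" "1 - a \<le> x \<Longrightarrow> squeeze a x = 1 - a"
proof -
  note c = cut_below[OF assms(1)]
  show "squeeze a x \<le> 1 - a" using c(3)[of "1 - cut_below a x"] by (simp add: squeeze_def)
  show "2 * a \<le> x \<Longrightarrow> x \<le> 1 - 2 * a \<Longrightarrow> squeeze a x = x" by (simp add: squeeze_def c(2))
  show l: "squeeze a x \<le> 2 * a" if "x \<le> 2 * a"
    using c(4)[OF that] assms by (simp add: squeeze_def c(2))
  show "squeeze a x = a" if "x \<le> a" using that assms by (simp add: squeeze_def c(1,2))
  show "1 - a \<le> x \<Longrightarrow> squeeze a x = 1 - a" using assms by (simp add: squeeze_def c(1,2))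
  show g: "1 - 2 * a \<le> squeeze a x" if "1 - 2 * a \<le> x"
    using that assms c(4)[of "1 - x"] by (simp add: squeeze_def c(2))
  show "a \<le> squeeze a x"
  proof (cases "cut_below a x \<le> 1 - a")
    case True
    with c(5)[of "1 - cut_below a x"] c(3)[of x] show ?thesis by (simp add: squeeze_def)
  next
    case False
    then show ?thesis using assms by (simp add: squeeze_def c(1))
  qed
qed

lemma smooth_fun_squeeze:
  assumes "smooth_fun n U g" shows "smooth_fun n U (\<lambda>x. squeeze a (g x))"
proof -
  note o = smooth_fun_open[OF assms]
  have *: "smooth_fun n U (\<lambda>x. cut_below a (h x))" if h: "smooth_fun n U h" for h
  proof -
    have "smooth_fun n U (\<lambda>x. a + smooth_step ((1 / a) * (h x - a)) * (h x - a))"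
      by (intro smooth_fun_add smooth_fun_mult smooth_fun_step smooth_fun_diff h smooth_fun_const o)
    then show ?thesis by (simp add: cut_below_def)
  qed
  show ?thesis unfolding squeeze_def
    by (intro smooth_fun_diff smooth_fun_const * o assms)
qed

section \<open>Charts and smooth maps\<close>

text \<open>Openness of images and of preimages together say that a chart is a homeomorphism onto its image.
  In this form the conditions pass to products by looking at small boxes.\<close>

locale charted =
  fixes M :: "'a manifold"
  assumes chart_open: "(U, \<phi>) \<in> atlas M \<Longrightarrow> openin (mtop M) U"
    and chart_inj: "(U, \<phi>) \<in> atlas M \<Longrightarrow> inj_on \<phi> U"
    and chart_image: "(U, \<phi>) \<in> atlas M \<Longrightarrow> openin (mtop M) B \<Longrightarrow> B \<subseteq> U \<Longrightarrow>
          openin (Euclidean_space (mdim M)) (\<phi> ` B)"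
    and chart_vimage: "(U, \<phi>) \<in> atlas M \<Longrightarrow> openin (Euclidean_space (mdim M)) S \<Longrightarrow>
          openin (mtop M) {x\<in>U. \<phi> x \<in> S}"
    and chart_ex: "x \<in> topspace (mtop M) \<Longrightarrow> \<exists>U \<phi>. (U, \<phi>) \<in> atlas M \<and> x \<in> U"
    and chart_compatible: "(U, \<phi>) \<in> atlas M \<Longrightarrow> (V, \<psi>) \<in> atlas M \<Longrightarrow>
          smooth_euclid (mdim M) (mdim M) (\<phi> ` (U \<inter> V)) (\<psi> \<circ> inv_into U \<phi>)"

sublocale smooth_manifold \<subseteq> charted
proof
  fix U \<phi> assume c: "(U, \<phi>) \<in> atlas M"
  note h = chart_homeo[OF c]
  show "openin (mtop M) U" using h by blast
  have US: "U \<subseteq> topspace (mtop M)" using h openin_subset by blast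
  have VS: "\<phi> ` U \<subseteq> topspace (Euclidean_space (mdim M))" using h openin_subset by blast
  have hm: "homeomorphic_map (subtopology (mtop M) U) (subtopology (Euclidean_space (mdim M)) (\<phi> ` U)) \<phi>"
    using h by blast
  show "inj_on \<phi> U" using homeomorphic_imp_injective_map[OF hm] US by (simp add: Int_absorb1)
  show "openin (Euclidean_space (mdim M)) (\<phi> ` B)" if "openin (mtop M) B" "B \<subseteq> U" for B
  proof -
    have "openin (subtopology (mtop M) U) B" using that by (simp add: openin_subset_topspace_eq openin_open_subtopology h)
    then have "openin (subtopology (Euclidean_space (mdim M)) (\<phi> ` U)) (\<phi> ` B)"
      using homeomorphic_imp_open_map[OF hm] by (simp add: open_map_def)
    then show ?thesis using h by (simp add: openin_open_subtopology)
  qed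
  show "openin (mtop M) {x\<in>U. \<phi> x \<in> S}" if "openin (Euclidean_space (mdim M)) S" for S
  proof -
    have "openin (subtopology (Euclidean_space (mdim M)) (\<phi> ` U)) (S \<inter> \<phi> ` U)"
      using that by (auto simp: openin_subtopology)
    from openin_continuous_map_preimage[OF homeomorphic_imp_continuous_map[OF hm] this]
    have "openin (subtopology (mtop M) U) {x \<in> topspace (subtopology (mtop M) U). \<phi> x \<in> S \<inter> \<phi> ` U}" .
    moreover have "{x \<in> topspace (subtopology (mtop M) U). \<phi> x \<in> S \<inter> \<phi> ` U} = {x\<in>U. \<phi> x \<in> S}"
      using US by auto
    ultimately show ?thesis using h by (simp add: openin_open_subtopology)
  qed
next
  show "\<exists>U \<phi>. (U, \<phi>) \<in> atlas M \<and> x \<in> U" if "x \<in> topspace (mtop M)" for x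
  proof -
    have "x \<in> (\<Union>(U, \<phi>)\<in>atlas M. U)" using that charts_cover by simp
    then show ?thesis by fast
  qed
qed (rule charts_compatible)

lemma (in charted) inv_chart: "(U, \<phi>) \<in> atlas M \<Longrightarrow> x \<in> U \<Longrightarrow> inv_into U \<phi> (\<phi> x) = x"
  using chart_inj by simp

lemma (in charted) chart_subset: "(U, \<phi>) \<in> atlas M \<Longrightarrow> U \<subseteq> topspace (mtop M)"
  using chart_open openin_subset by blast

lemma smooth_mapI:
  assumes "openin (mtop M) W"
    and "\<And>x. x \<in> W \<Longrightarrow> \<exists>U \<phi> V \<psi> B. (U, \<phi>) \<in> atlas M \<and> (V, \<psi>) \<in> atlas N \<and>
       openin (mtop M) B \<and> x \<in> B \<and> B \<subseteq> U \<inter> W \<and> f ` B \<subseteq> V \<and>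
       smooth_euclid (mdim M) (mdim N) (\<phi> ` B) (\<psi> \<circ> f \<circ> inv_into U \<phi>)"
  shows "smooth_map M N W f"
  unfolding smooth_map_def
proof (intro conjI ballI assms(1))
  fix x assume "x \<in> W"
  from assms(2)[OF this] obtain U \<phi> V \<psi> B where
    "(U, \<phi>) \<in> atlas M" "(V, \<psi>) \<in> atlas N" "openin (mtop M) B \<and> x \<in> B \<and> B \<subseteq> U \<inter> W \<and> f ` B \<subseteq> V \<and>
       smooth_euclid (mdim M) (mdim N) (\<phi> ` B) (\<psi> \<circ> f \<circ> inv_into U \<phi>)" by blast
  then show "\<exists>(U, \<phi>)\<in>atlas M. \<exists>(V, \<psi>)\<in>atlas N. \<exists>B.
        openin (mtop M) B \<and> x \<in> B \<and> B \<subseteq> U \<inter> W \<and> f ` B \<subseteq> V \<and>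
        smooth_euclid (mdim M) (mdim N) (\<phi> ` B) (\<psi> \<circ> f \<circ> inv_into U \<phi>)"
    by (intro bexI[of _ "(U, \<phi>)"] bexI[of _ "(V, \<psi>)"] case_prodI) auto
qed

lemma smooth_mapE:
  assumes "smooth_map M N W f" "x \<in> W"
  obtains U \<phi> V \<psi> B where "(U, \<phi>) \<in> atlas M" "(V, \<psi>) \<in> atlas N" "openin (mtop M) B"
    "x \<in> B" "B \<subseteq> U" "B \<subseteq> W" "f ` B \<subseteq> V"
    "smooth_euclid (mdim M) (mdim N) (\<phi> ` B) (\<psi> \<circ> f \<circ> inv_into U \<phi>)"
proof -
  from assms have "\<exists>(U, \<phi>)\<in>atlas M. \<exists>(V, \<psi>)\<in>atlas N. \<exists>B.
        openin (mtop M) B \<and> x \<in> B \<and> B \<subseteq> U \<inter> W \<and> f ` B \<subseteq> V \<and>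
        smooth_euclid (mdim M) (mdim N) (\<phi> ` B) (\<psi> \<circ> f \<circ> inv_into U \<phi>)"
    unfolding smooth_map_def by blast
  then obtain U \<phi> V \<psi> B where "(U, \<phi>) \<in> atlas M" "(V, \<psi>) \<in> atlas N"
     "openin (mtop M) B \<and> x \<in> B \<and> B \<subseteq> U \<inter> W \<and> f ` B \<subseteq> V \<and>
        smooth_euclid (mdim M) (mdim N) (\<phi> ` B) (\<psi> \<circ> f \<circ> inv_into U \<phi>)"
    by fast
  then show ?thesis using that by blast
qed

lemma smooth_map_open: "smooth_map M N W f \<Longrightarrow> openin (mtop M) W"
  by (simp add: smooth_map_def)

text \<open>Continuity of a map that is smooth in one pair of charts: the preimage of \<open>S\<close> is computed in the
  coordinates and carried back by the chart \<open>\<phi>\<close>.\<close>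

lemma chart_map_vimage_open:
  assumes M: "charted M" and N: "charted N"
    and c: "(U, \<phi>) \<in> atlas M" and d: "(V, \<psi>) \<in> atlas N"
    and B: "openin (mtop M) B" "B \<subseteq> U" "f ` B \<subseteq> V"
    and f: "smooth_euclid (mdim M) (mdim N) (\<phi> ` B) (\<psi> \<circ> f \<circ> inv_into U \<phi>)"
    and S: "openin (mtop N) S"
  shows "openin (mtop M) {x\<in>B. f x \<in> S}"
proof -
  interpret M: charted M by fact
  interpret N: charted N by fact
  let ?F = "\<psi> \<circ> f \<circ> inv_into U \<phi>"
  have "openin (mtop N) (V \<inter> S)" by (rule openin_Int[OF N.chart_open[OF d] S])
  then have "openin (Euclidean_space (mdim N)) (\<psi> ` (V \<inter> S))" by (rule N.chart_image[OF d]) simp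
  then have o: "openin (Euclidean_space (mdim M)) {z\<in>\<phi> ` B. ?F z \<in> \<psi> ` (V \<inter> S)}"
    using f by (intro openin_Eucl_vimage[OF _ smooth_euclid_continuous[OF f]]) (simp_all add: smooth_euclid_iff)
  have "{x\<in>U. \<phi> x \<in> {z\<in>\<phi> ` B. ?F z \<in> \<psi> ` (V \<inter> S)}} = {x\<in>B. f x \<in> S}"
  proof (intro set_eqI iffI)
    fix x assume "x \<in> {x\<in>U. \<phi> x \<in> {z\<in>\<phi> ` B. ?F z \<in> \<psi> ` (V \<inter> S)}}"
    then have x: "x \<in> U" "\<phi> x \<in> \<phi> ` B" "?F (\<phi> x) \<in> \<psi> ` (V \<inter> S)" by auto
    then have "x \<in> B" using B(2) M.chart_inj[OF c] by (auto dest: inj_onD)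
    moreover have "\<psi> (f x) \<in> \<psi> ` (V \<inter> S)" using x(1,3) M.inv_chart[OF c] by simp
    then have "f x \<in> S" using N.chart_inj[OF d] B(3) \<open>x \<in> B\<close> by (auto dest: inj_onD)
    ultimately show "x \<in> {x\<in>B. f x \<in> S}" by simp
  next
    fix x assume x: "x \<in> {x\<in>B. f x \<in> S}"
    then have "inv_into U \<phi> (\<phi> x) = x" using M.inv_chart[OF c] B(2) by blast
    with x B show "x \<in> {x\<in>U. \<phi> x \<in> {z\<in>\<phi> ` B. ?F z \<in> \<psi> ` (V \<inter> S)}}" by auto
  qed
  with M.chart_vimage[OF c o] show ?thesis by simp
qed

lemma smooth_map_vimage_open:
  assumes M: "charted M" and N: "charted N" and f: "smooth_map M N W f" and S: "openin (mtop N) S"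
  shows "openin (mtop M) {x\<in>W. f x \<in> S}"
proof (subst openin_subopen, intro ballI)
  fix x assume x: "x \<in> {x\<in>W. f x \<in> S}"
  then obtain U \<phi> V \<psi> B where B: "(U, \<phi>) \<in> atlas M" "(V, \<psi>) \<in> atlas N" "openin (mtop M) B"
    "x \<in> B" "B \<subseteq> U" "B \<subseteq> W" "f ` B \<subseteq> V"
    "smooth_euclid (mdim M) (mdim N) (\<phi> ` B) (\<psi> \<circ> f \<circ> inv_into U \<phi>)"
    using smooth_mapE[OF f, of x] by blast
  from chart_map_vimage_open[OF M N B(1-3,5,7,8) S] B(4,6) x
  show "\<exists>T. openin (mtop M) T \<and> x \<in> T \<and> T \<subseteq> {x\<in>W. f x \<in> S}" by blast
qed

lemma smooth_map_range:
  assumes N: "charted N" and f: "smooth_map M N W f" shows "f ` W \<subseteq> topspace (mtop N)"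
proof
  interpret N: charted N by fact
  fix y assume "y \<in> f ` W"
  then obtain x where x: "x \<in> W" "y = f x" by blast
  with smooth_mapE[OF f x(1)] show "y \<in> topspace (mtop N)" using N.chart_subset by (metis image_subset_iff subsetD)
qed

text \<open>
  Smoothness is defined by the existence of a suitable pair of charts at each point. Changing
  coordinates on both sides, by compatibility of charts, gives it in any pair of charts there.\<close>

lemma smooth_map_in_charts:
  assumes M: "charted M" and N: "charted N" and f: "smooth_map M N W f"
    and c: "(U, \<phi>) \<in> atlas M" and d: "(V, \<psi>) \<in> atlas N" and x: "x \<in> W" "x \<in> U" "f x \<in> V"
  obtains B where "openin (mtop M) B" "x \<in> B" "B \<subseteq> U" "B \<subseteq> W" "f ` B \<subseteq> V"
    "smooth_euclid (mdim M) (mdim N) (\<phi> ` B) (\<psi> \<circ> f \<circ> inv_into U \<phi>)"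
proof -
  interpret M: charted M by fact
  interpret N: charted N by fact
  obtain U' \<phi>' V' \<psi>' B' where B': "(U', \<phi>') \<in> atlas M" "(V', \<psi>') \<in> atlas N" "openin (mtop M) B'"
    "x \<in> B'" "B' \<subseteq> U'" "B' \<subseteq> W" "f ` B' \<subseteq> V'"
    "smooth_euclid (mdim M) (mdim N) (\<phi>' ` B') (\<psi>' \<circ> f \<circ> inv_into U' \<phi>')"
    by (rule smooth_mapE[OF f x(1)])
  define B where "B = {y\<in>B'. f y \<in> V} \<inter> U"
  have "openin (mtop M) B" unfolding B_def
    by (intro openin_Int M.chart_open[OF c]
        chart_map_vimage_open[OF M N B'(1-3,5,7,8)] N.chart_open[OF d])
  moreover have "smooth_euclid (mdim M) (mdim N) (\<phi> ` B) (\<psi> \<circ> f \<circ> inv_into U \<phi>)"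
  proof (rule smooth_euclid_cong)
    have oB: "openin (Euclidean_space (mdim M)) (\<phi> ` B)"
      using \<open>openin (mtop M) B\<close> by (rule M.chart_image[OF c]) (simp add: B_def)
    have 1: "smooth_euclid (mdim M) (mdim M) (\<phi> ` B) (\<phi>' \<circ> inv_into U \<phi>)"
      using M.chart_compatible[OF c B'(1)] oB
      by (rule smooth_euclid_subset) (use B'(5) B_def in blast)
    have inv: "inv_into U \<phi> (\<phi> y) = y" if "y \<in> B" for y
      using that by (intro M.inv_chart[OF c]) (simp add: B_def)
    have inv': "inv_into U' \<phi>' (\<phi>' y) = y" if "y \<in> B" for y
      using that B'(5) by (intro M.inv_chart[OF B'(1)]) (auto simp: B_def)
    have 2: "smooth_euclid (mdim M) (mdim N) (\<phi> ` B) ((\<psi>' \<circ> f \<circ> inv_into U' \<phi>') \<circ> (\<phi>' \<circ> inv_into U \<phi>))"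
      by (rule smooth_euclid_compose[OF 1 B'(8)]) (auto simp: inv B_def)
    have 3: "smooth_euclid (mdim M) (mdim N) (\<phi> ` B)
       ((\<psi> \<circ> inv_into V' \<psi>') \<circ> ((\<psi>' \<circ> f \<circ> inv_into U' \<phi>') \<circ> (\<phi>' \<circ> inv_into U \<phi>)))"
    proof (rule smooth_euclid_compose[OF 2 N.chart_compatible[OF B'(2) d]])
      show "((\<psi>' \<circ> f \<circ> inv_into U' \<phi>') \<circ> (\<phi>' \<circ> inv_into U \<phi>)) ` \<phi> ` B \<subseteq> \<psi>' ` (V' \<inter> V)"
        using B'(7) by (auto simp: inv inv' B_def)
    qed
    show "smooth_euclid (mdim M) (mdim N) (\<phi> ` B)
       ((\<psi> \<circ> inv_into V' \<psi>') \<circ> ((\<psi>' \<circ> f \<circ> inv_into U' \<phi>') \<circ> (\<phi>' \<circ> inv_into U \<phi>)))" by (rule 3)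
    fix z assume "z \<in> \<phi> ` B"
    then obtain y where y: "y \<in> B" "z = \<phi> y" by blast
    then have "f y \<in> V'" using B'(7) by (auto simp: B_def)
    then show "((\<psi> \<circ> inv_into V' \<psi>') \<circ> ((\<psi>' \<circ> f \<circ> inv_into U' \<phi>') \<circ> (\<phi>' \<circ> inv_into U \<phi>))) z =
       (\<psi> \<circ> f \<circ> inv_into U \<phi>) z"
      using y by (simp add: inv inv' N.inv_chart[OF B'(2)])
  qed
  ultimately show ?thesis
    using x B' by (intro that[of B]) (auto simp: B_def)
qed

lemma smooth_map_subset:
  assumes M: "charted M" and f: "smooth_map M N W f" and W: "openin (mtop M) W'" "W' \<subseteq> W"
  shows "smooth_map M N W' f"
proof (rule smooth_mapI[OF W(1)])
  interpret M: charted M by fact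
  fix x assume x: "x \<in> W'"
  then obtain U \<phi> V \<psi> B where B: "(U, \<phi>) \<in> atlas M" "(V, \<psi>) \<in> atlas N" "openin (mtop M) B"
    "x \<in> B" "B \<subseteq> U" "B \<subseteq> W" "f ` B \<subseteq> V"
    "smooth_euclid (mdim M) (mdim N) (\<phi> ` B) (\<psi> \<circ> f \<circ> inv_into U \<phi>)"
    using smooth_mapE[OF f, of x] W by blast
  have o: "openin (mtop M) (B \<inter> W')" using B W by blast
  have "smooth_euclid (mdim M) (mdim N) (\<phi> ` (B \<inter> W')) (\<psi> \<circ> f \<circ> inv_into U \<phi>)"
    using B(5) by (intro smooth_euclid_subset[OF B(8)] M.chart_image[OF B(1) o]) auto
  with B o x show "\<exists>U \<phi> V \<psi> B. (U, \<phi>) \<in> atlas M \<and> (V, \<psi>) \<in> atlas N \<and>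
       openin (mtop M) B \<and> x \<in> B \<and> B \<subseteq> U \<inter> W' \<and> f ` B \<subseteq> V \<and>
       smooth_euclid (mdim M) (mdim N) (\<phi> ` B) (\<psi> \<circ> f \<circ> inv_into U \<phi>)"
    by (intro exI[of _ U] exI[of _ \<phi>] exI[of _ V] exI[of _ \<psi>] exI[of _ "B \<inter> W'"]) auto
qed

lemma smooth_map_local:
  assumes "\<And>x. x \<in> W \<Longrightarrow> \<exists>W'. x \<in> W' \<and> W' \<subseteq> W \<and> smooth_map M N W' f"
  shows "smooth_map M N W f"
proof (rule smooth_mapI)
  show "openin (mtop M) W" using assms by (subst openin_subopen) (meson smooth_map_open)
  fix x assume "x \<in> W"
  then obtain W' where W': "x \<in> W'" "W' \<subseteq> W" "smooth_map M N W' f" using assms by blast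
  then obtain U \<phi> V \<psi> B where B: "(U, \<phi>) \<in> atlas M" "(V, \<psi>) \<in> atlas N" "openin (mtop M) B"
    "x \<in> B" "B \<subseteq> U" "B \<subseteq> W'" "f ` B \<subseteq> V"
    "smooth_euclid (mdim M) (mdim N) (\<phi> ` B) (\<psi> \<circ> f \<circ> inv_into U \<phi>)"
    using smooth_mapE by metis
  with W' show "\<exists>U \<phi> V \<psi> B. (U, \<phi>) \<in> atlas M \<and> (V, \<psi>) \<in> atlas N \<and>
       openin (mtop M) B \<and> x \<in> B \<and> B \<subseteq> U \<inter> W \<and> f ` B \<subseteq> V \<and>
       smooth_euclid (mdim M) (mdim N) (\<phi> ` B) (\<psi> \<circ> f \<circ> inv_into U \<phi>)"
    by (intro exI[of _ U] exI[of _ \<phi>] exI[of _ V] exI[of _ \<psi>] exI[of _ B]) auto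
qed

lemma smooth_map_cong:
  assumes M: "charted M" and eq: "\<And>x. x \<in> W \<Longrightarrow> f x = g x" and f: "smooth_map M N W f"
  shows "smooth_map M N W g"
proof (rule smooth_mapI[OF smooth_map_open[OF f]])
  interpret M: charted M by fact
  fix x assume x: "x \<in> W"
  then obtain U \<phi> V \<psi> B where B: "(U, \<phi>) \<in> atlas M" "(V, \<psi>) \<in> atlas N" "openin (mtop M) B"
    "x \<in> B" "B \<subseteq> U" "B \<subseteq> W" "f ` B \<subseteq> V"
    "smooth_euclid (mdim M) (mdim N) (\<phi> ` B) (\<psi> \<circ> f \<circ> inv_into U \<phi>)"
    using smooth_mapE[OF f, of x] by blast
  have "smooth_euclid (mdim M) (mdim N) (\<phi> ` B) (\<psi> \<circ> g \<circ> inv_into U \<phi>)"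
  proof (rule smooth_euclid_cong[OF _ B(8)])
    fix z assume "z \<in> \<phi> ` B"
    then obtain y where y: "y \<in> B" "z = \<phi> y" by blast
    then have "inv_into U \<phi> z = y" using M.inv_chart[OF B(1)] B(5) by blast
    then show "(\<psi> \<circ> f \<circ> inv_into U \<phi>) z = (\<psi> \<circ> g \<circ> inv_into U \<phi>) z"
      using y B(6) eq by auto
  qed
  moreover have "g ` B \<subseteq> V" using B(6,7) eq by (metis image_subset_iff subsetD)
  ultimately show "\<exists>U \<phi> V \<psi> B. (U, \<phi>) \<in> atlas M \<and> (V, \<psi>) \<in> atlas N \<and>
       openin (mtop M) B \<and> x \<in> B \<and> B \<subseteq> U \<inter> W \<and> g ` B \<subseteq> V \<and>
       smooth_euclid (mdim M) (mdim N) (\<phi> ` B) (\<psi> \<circ> g \<circ> inv_into U \<phi>)"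
    using B by (intro exI[of _ U] exI[of _ \<phi>] exI[of _ V] exI[of _ \<psi>] exI[of _ B]) auto
qed

lemma smooth_map_compose:
  assumes M: "charted M" and N: "charted N" and P: "charted P"
    and f: "smooth_map M N W f" and g: "smooth_map N P W' g" and fW: "f ` W \<subseteq> W'"
  shows "smooth_map M P W (g \<circ> f)"
proof (rule smooth_mapI[OF smooth_map_open[OF f]])
  interpret M: charted M by fact
  interpret N: charted N by fact
  fix x assume x: "x \<in> W"
  obtain U \<phi> V \<psi> B where B: "(U, \<phi>) \<in> atlas M" "(V, \<psi>) \<in> atlas N" "openin (mtop M) B"
    "x \<in> B" "B \<subseteq> U" "B \<subseteq> W" "f ` B \<subseteq> V"
    "smooth_euclid (mdim M) (mdim N) (\<phi> ` B) (\<psi> \<circ> f \<circ> inv_into U \<phi>)"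
    using smooth_mapE[OF f x] by blast
  obtain V' \<psi>' Z \<theta> B' where B': "(V', \<psi>') \<in> atlas N" "(Z, \<theta>) \<in> atlas P" "openin (mtop N) B'"
    "f x \<in> B'" "B' \<subseteq> V'" "B' \<subseteq> W'" "g ` B' \<subseteq> Z"
    "smooth_euclid (mdim N) (mdim P) (\<psi>' ` B') (\<theta> \<circ> g \<circ> inv_into V' \<psi>')"
    using smooth_mapE[OF g, of "f x"] x fW by blast
  have "f x \<in> V" using B(4,7) by auto
  from smooth_map_in_charts[OF N P g B(2) B'(2) _ this] obtain B'' where
    B'': "openin (mtop N) B''" "f x \<in> B''" "B'' \<subseteq> V" "g ` B'' \<subseteq> Z"
    "smooth_euclid (mdim N) (mdim P) (\<psi> ` B'') (\<theta> \<circ> g \<circ> inv_into V \<psi>)"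
    using x fW B'(4,7) by (metis image_subset_iff)
  define C where "C = {y\<in>B. f y \<in> B''}"
  have C: "openin (mtop M) C" unfolding C_def
    by (rule chart_map_vimage_open[OF M N B(1-3,5,7,8) B''(1)])
  have inv: "inv_into U \<phi> (\<phi> y) = y" if "y \<in> C" for y
    using that B(5) by (intro M.inv_chart[OF B(1)]) (auto simp: C_def)
  have "smooth_euclid (mdim M) (mdim P) (\<phi> ` C) ((\<theta> \<circ> g \<circ> inv_into V \<psi>) \<circ> (\<psi> \<circ> f \<circ> inv_into U \<phi>))"
  proof (rule smooth_euclid_compose[OF smooth_euclid_subset[OF B(8)] B''(5)])
    show "openin (Euclidean_space (mdim M)) (\<phi> ` C)"
      by (rule M.chart_image[OF B(1) C]) (use B(5) C_def in blast)
    show "(\<psi> \<circ> f \<circ> inv_into U \<phi>) ` \<phi> ` C \<subseteq> \<psi> ` B''" by (auto simp: inv) (auto simp: C_def)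
  qed (auto simp: C_def)
  then have "smooth_euclid (mdim M) (mdim P) (\<phi> ` C) (\<theta> \<circ> (g \<circ> f) \<circ> inv_into U \<phi>)"
    by (rule smooth_euclid_cong[rotated])
      (use B''(3) in \<open>auto simp: inv, auto simp: C_def N.inv_chart[OF B(2)] subset_iff\<close>)
  moreover have "(g \<circ> f) ` C \<subseteq> Z" using B''(4) by (auto simp: C_def)
  moreover have "x \<in> C" "C \<subseteq> U \<inter> W" using B B'' by (auto simp: C_def)
  ultimately show "\<exists>U \<phi> V \<psi> B. (U, \<phi>) \<in> atlas M \<and> (V, \<psi>) \<in> atlas P \<and>
       openin (mtop M) B \<and> x \<in> B \<and> B \<subseteq> U \<inter> W \<and> (g \<circ> f) ` B \<subseteq> V \<and>
       smooth_euclid (mdim M) (mdim P) (\<phi> ` B) (\<psi> \<circ> (g \<circ> f) \<circ> inv_into U \<phi>)"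
    using B(1) B'(2) C by blast
qed

lemma smooth_map_const:
  assumes M: "charted M" and N: "charted N" and W: "openin (mtop M) W" and y: "y \<in> topspace (mtop N)"
  shows "smooth_map M N W (\<lambda>_. y)"
proof (rule smooth_mapI[OF W])
  interpret M: charted M by fact
  interpret N: charted N by fact
  fix x assume x: "x \<in> W"
  then obtain U \<phi> where c: "(U, \<phi>) \<in> atlas M" "x \<in> U" using M.chart_ex W openin_subset by blast
  obtain V \<psi> where d: "(V, \<psi>) \<in> atlas N" "y \<in> V" using N.chart_ex[OF y] by blast
  have o: "openin (mtop M) (U \<inter> W)" using M.chart_open[OF c(1)] W by blast
  have oi: "openin (Euclidean_space (mdim M)) (\<phi> ` (U \<inter> W))" by (rule M.chart_image[OF c(1) o]) simp
  have "\<psi> ` V \<subseteq> Eucl (mdim N)"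
    by (rule openin_Eucl_subset) (rule N.chart_image[OF d(1) N.chart_open[OF d(1)] order_refl])
  then have "\<psi> y \<in> Eucl (mdim N)" using d(2) by blast
  then have "smooth_euclid (mdim M) (mdim N) (\<phi> ` (U \<inter> W)) (\<psi> \<circ> (\<lambda>_. y) \<circ> inv_into U \<phi>)"
    using oi unfolding smooth_euclid_iff by (auto simp: smooth_fun_const)
  with c d x o show "\<exists>U \<phi> V \<psi> B. (U, \<phi>) \<in> atlas M \<and> (V, \<psi>) \<in> atlas N \<and>
       openin (mtop M) B \<and> x \<in> B \<and> B \<subseteq> U \<inter> W \<and> (\<lambda>_. y) ` B \<subseteq> V \<and>
       smooth_euclid (mdim M) (mdim N) (\<phi> ` B) (\<psi> \<circ> (\<lambda>_. y) \<circ> inv_into U \<phi>)"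
    by (intro exI[of _ U] exI[of _ \<phi>] exI[of _ V] exI[of _ \<psi>] exI[of _ "U \<inter> W"]) auto
qed

section \<open>Products of manifolds\<close>

text \<open>The coordinates in a product chart: the coordinates \<open>a\<close> of the first factor, of which there are
  \<open>m\<close>, followed by the coordinates \<open>b\<close> of the second. The maps \<open>fstc\<close> and \<open>sndc\<close> separate them
  again.\<close>

definition joinc :: "nat \<Rightarrow> (nat \<Rightarrow> real) \<Rightarrow> (nat \<Rightarrow> real) \<Rightarrow> nat \<Rightarrow> real" where
  "joinc m a b = (\<lambda>i. if i < m then a i else b (i - m))"

lemma atlas_prod:
  "atlas (prod_manifold M N) = {(U \<times> V, \<lambda>(x, y). joinc (mdim M) (\<phi> x) (\<psi> y)) | U \<phi> V \<psi>.
     (U, \<phi>) \<in> atlas M \<and> (V, \<psi>) \<in> atlas N}"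
  by (simp add: prod_manifold_def joinc_def)

lemma mtop_prod: "mtop (prod_manifold M N) = prod_topology (mtop M) (mtop N)"
  by (simp add: prod_manifold_def)

lemma mdim_prod: "mdim (prod_manifold M N) = mdim M + mdim N"
  by (simp add: prod_manifold_def)

lemma joinc_eq_iff:
  assumes "a \<in> Eucl m" "a' \<in> Eucl m"
  shows "joinc m a b = joinc m a' b' \<longleftrightarrow> a = a' \<and> b = b'"
proof
  assume eq: "joinc m a b = joinc m a' b'"
  have "a i = a' i" for i
    using fun_cong[OF eq, of i] assms by (cases "i < m") (auto simp: joinc_def Eucl_iff)
  moreover have "b i = b' i" for i
    using fun_cong[OF eq, of "i + m"] by (simp add: joinc_def)
  ultimately show "a = a' \<and> b = b'" by blast
qed simp

lemma joinc_Eucl: "a \<in> Eucl m \<Longrightarrow> b \<in> Eucl n \<Longrightarrow> joinc m a b \<in> Eucl (m + n)"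
  by (auto simp: Eucl_iff joinc_def)

definition fstc :: "nat \<Rightarrow> (nat \<Rightarrow> real) \<Rightarrow> nat \<Rightarrow> real" where
  "fstc m z = (\<lambda>i. if i < m then z i else 0)"

definition sndc :: "nat \<Rightarrow> (nat \<Rightarrow> real) \<Rightarrow> nat \<Rightarrow> real" where
  "sndc m z = (\<lambda>i. z (i + m))"

lemma fstc_joinc: "a \<in> Eucl m \<Longrightarrow> fstc m (joinc m a b) = a"
  by (auto simp: fstc_def joinc_def Eucl_iff)

lemma sndc_joinc: "sndc m (joinc m a b) = b"
  by (simp add: sndc_def joinc_def)

lemma joinc_parts: "joinc m (fstc m z) (sndc m z) = z"
  by (auto simp: fstc_def joinc_def sndc_def)

lemma fstc_smooth: "openin (Euclidean_space k) S \<Longrightarrow> smooth_euclid k m S (fstc m)"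
  by (auto simp: smooth_euclid_iff Eucl_iff fstc_def intro: smooth_fun_coordinate)

lemma sndc_smooth: "openin (Euclidean_space (m + n)) S \<Longrightarrow> smooth_euclid (m + n) n S (sndc m)"
  using openin_Eucl_subset[of "m + n" S]
  by (auto simp: smooth_euclid_iff Eucl_iff sndc_def subset_iff intro!: smooth_fun_coordinate)

lemma joinc_smooth:
  assumes "smooth_euclid k m S f" "smooth_euclid k n S g"
  shows "smooth_euclid k (m + n) S (\<lambda>z. joinc m (f z) (g z))"
  unfolding smooth_euclid_iff
proof (intro conjI allI impI)
  show "(\<lambda>z. joinc m (f z) (g z)) ` S \<subseteq> Eucl (m + n)"
    using assms by (auto simp: smooth_euclid_iff image_subset_iff intro!: joinc_Eucl)
  show "smooth_fun k S (\<lambda>z. joinc m (f z) (g z) i)" if "i < m + n" for i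
    using assms that by (cases "i < m") (simp_all add: smooth_euclid_iff joinc_def)
qed (use assms in \<open>simp add: smooth_euclid_iff\<close>)

lemma (in charted) chart_Eucl: "(U, \<phi>) \<in> atlas M \<Longrightarrow> x \<in> U \<Longrightarrow> \<phi> x \<in> Eucl (mdim M)"
  using openin_Eucl_subset[OF chart_image[OF _ chart_open order_refl]] by blast

lemma smooth_euclid_vimage_open:
  assumes "smooth_euclid n m S f" "openin (Euclidean_space m) T"
  shows "openin (Euclidean_space n) {x\<in>S. f x \<in> T}"
  using openin_Eucl_vimage[OF _ smooth_euclid_continuous[OF assms(1)] _ assms(2)] assms(1)
  by (simp add: smooth_euclid_iff)

lemma charted_prod_image:
  assumes M: "charted M" and N: "charted N"
    and c: "(U, \<phi>) \<in> atlas M" and d: "(V, \<psi>) \<in> atlas N"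
    and B: "openin (prod_topology (mtop M) (mtop N)) B" "B \<subseteq> U \<times> V"
  shows "openin (Euclidean_space (mdim M + mdim N)) ((\<lambda>(x, y). joinc (mdim M) (\<phi> x) (\<psi> y)) ` B)"
proof (subst openin_subopen, intro ballI)
  interpret M: charted M by fact
  interpret N: charted N by fact
  let ?J = "\<lambda>(x, y). joinc (mdim M) (\<phi> x) (\<psi> y)"
  let ?E = "Euclidean_space (mdim M + mdim N)"
  have E: "openin ?E (topspace ?E)" by blast
  fix z assume "z \<in> ?J ` B"
  then obtain x y where xy: "(x, y) \<in> B" "z = joinc (mdim M) (\<phi> x) (\<psi> y)" by auto
  obtain B1 B2 where B12: "openin (mtop M) B1" "openin (mtop N) B2" "x \<in> B1" "y \<in> B2" "B1 \<times> B2 \<subseteq> B"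
    using B(1)[unfolded openin_prod_topology_alt, rule_format, OF xy(1)] by metis
  have U: "B1 \<subseteq> U" "B2 \<subseteq> V" using B12 B(2) by blast+
  let ?S = "{w\<in>Eucl (mdim M + mdim N). fstc (mdim M) w \<in> \<phi> ` B1}"
  have f: "smooth_euclid (mdim M + mdim N) (mdim M) (Eucl (mdim M + mdim N)) (fstc (mdim M))"
    by (rule fstc_smooth[OF E])
  have o1: "openin ?E ?S"
    by (rule smooth_euclid_vimage_open[OF f M.chart_image[OF c B12(1) U(1)]])
  have g: "smooth_euclid (mdim M + mdim N) (mdim N) ?S (sndc (mdim M))"
    by (rule sndc_smooth[OF o1])
  have o2: "openin ?E {w\<in>?S. sndc (mdim M) w \<in> \<psi> ` B2}"
    by (rule smooth_euclid_vimage_open[OF g N.chart_image[OF d B12(2) U(2)]])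
  moreover have "z \<in> {w\<in>?S. sndc (mdim M) w \<in> \<psi> ` B2}"
    using xy B12(3,4) U M.chart_Eucl[OF c] N.chart_Eucl[OF d]
    by (auto simp: fstc_joinc sndc_joinc intro!: joinc_Eucl)
  moreover have "{w\<in>?S. sndc (mdim M) w \<in> \<psi> ` B2} \<subseteq> ?J ` B"
  proof
    fix w assume "w \<in> {w\<in>?S. sndc (mdim M) w \<in> \<psi> ` B2}"
    then obtain x' y' where "x' \<in> B1" "fstc (mdim M) w = \<phi> x'" "y' \<in> B2" "sndc (mdim M) w = \<psi> y'" by blast
    then have "w = ?J (x', y')" "(x', y') \<in> B" using joinc_parts[of "mdim M" w] B12(5) by auto
    then show "w \<in> ?J ` B" by blast
  qed
  ultimately show "\<exists>T. openin ?E T \<and> z \<in> T \<and> T \<subseteq> ?J ` B" by blast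
qed

lemma charted_prod_vimage:
  assumes M: "charted M" and N: "charted N"
    and c: "(U, \<phi>) \<in> atlas M" and d: "(V, \<psi>) \<in> atlas N"
    and S: "openin (Euclidean_space (mdim M + mdim N)) S"
  shows "openin (prod_topology (mtop M) (mtop N)) {p\<in>U \<times> V. (\<lambda>(x, y). joinc (mdim M) (\<phi> x) (\<psi> y)) p \<in> S}"
proof (subst openin_subopen, intro ballI)
  interpret M: charted M by fact
  interpret N: charted N by fact
  let ?J = "\<lambda>(x, y). joinc (mdim M) (\<phi> x) (\<psi> y)"
  have box: "openin (Euclidean_space n) {w\<in>Eucl n. \<forall>j<n. \<bar>w j - v j\<bar> < e}" for n v and e :: real
    unfolding openin_Eucl_box_iff
  proof (intro conjI ballI)
    fix w assume w: "w \<in> {w\<in>Eucl n. \<forall>j<n. \<bar>w j - v j\<bar> < e}"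
    define \<delta> where "\<delta> = Min (insert 1 ((\<lambda>j. e - \<bar>w j - v j\<bar>) ` {..<n}))"
    have "\<delta> > 0" unfolding \<delta>_def using w by (subst Min_gr_iff) auto
    moreover have "\<delta> \<le> e - \<bar>w j - v j\<bar>" if "j < n" for j
      unfolding \<delta>_def using that by (intro Min_le) auto
    ultimately show "\<exists>ea>0. \<forall>y\<in>Eucl n. (\<forall>j<n. \<bar>y j - w j\<bar> < ea) \<longrightarrow>
        y \<in> {w \<in> Eucl n. \<forall>j<n. \<bar>w j - v j\<bar> < e}"
      by (intro exI[of _ \<delta>]) fastforce
  qed auto
  fix p assume p: "p \<in> {p\<in>U \<times> V. ?J p \<in> S}"
  then obtain x y where xy: "p = (x, y)" "x \<in> U" "y \<in> V" "joinc (mdim M) (\<phi> x) (\<psi> y) \<in> S" by auto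
  obtain e where e: "e > 0" "\<And>w. w \<in> Eucl (mdim M + mdim N) \<Longrightarrow>
      (\<And>j. j < mdim M + mdim N \<Longrightarrow> \<bar>w j - joinc (mdim M) (\<phi> x) (\<psi> y) j\<bar> < e) \<Longrightarrow> w \<in> S"
    using openin_Eucl_boxE[OF S xy(4)] by metis
  define B1 where "B1 = {x'\<in>U. \<phi> x' \<in> {w\<in>Eucl (mdim M). \<forall>j<mdim M. \<bar>w j - \<phi> x j\<bar> < e}}"
  define B2 where "B2 = {y'\<in>V. \<psi> y' \<in> {w\<in>Eucl (mdim N). \<forall>j<mdim N. \<bar>w j - \<psi> y j\<bar> < e}}"
  have "openin (mtop M) B1" unfolding B1_def by (rule M.chart_vimage[OF c box])
  moreover have "openin (mtop N) B2" unfolding B2_def by (rule N.chart_vimage[OF d box])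
  ultimately have "openin (prod_topology (mtop M) (mtop N)) (B1 \<times> B2)"
    by (simp add: openin_prod_Times_iff)
  moreover have "p \<in> B1 \<times> B2"
    using xy e(1) M.chart_Eucl[OF c] N.chart_Eucl[OF d] by (auto simp: B1_def B2_def)
  moreover have "B1 \<times> B2 \<subseteq> {p\<in>U \<times> V. ?J p \<in> S}"
  proof
    fix q assume "q \<in> B1 \<times> B2"
    then obtain x' y' where q: "q = (x', y')" "x' \<in> B1" "y' \<in> B2" by auto
    have "joinc (mdim M) (\<phi> x') (\<psi> y') \<in> S"
    proof (rule e(2))
      show "joinc (mdim M) (\<phi> x') (\<psi> y') \<in> Eucl (mdim M + mdim N)"
        using q by (intro joinc_Eucl) (auto simp: B1_def B2_def)
      show "\<bar>joinc (mdim M) (\<phi> x') (\<psi> y') j - joinc (mdim M) (\<phi> x) (\<psi> y) j\<bar> < e"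
        if "j < mdim M + mdim N" for j
        using q that by (cases "j < mdim M") (auto simp: B1_def B2_def joinc_def)
    qed
    then show "q \<in> {p\<in>U \<times> V. ?J p \<in> S}" using q by (simp add: B1_def B2_def)
  qed
  ultimately show "\<exists>T. openin (prod_topology (mtop M) (mtop N)) T \<and> p \<in> T \<and> T \<subseteq> {p\<in>U \<times> V. ?J p \<in> S}"
    by blast
qed

lemma charted_prod:
  assumes M: "charted M" and N: "charted N" shows "charted (prod_manifold M N)"
proof
  interpret M: charted M by fact
  interpret N: charted N by fact
  fix Z \<theta> assume "(Z, \<theta>) \<in> atlas (prod_manifold M N)"
  then obtain U \<phi> V \<psi> where c: "(U, \<phi>) \<in> atlas M" and d: "(V, \<psi>) \<in> atlas N"
    and Z: "Z = U \<times> V" and \<theta>: "\<theta> = (\<lambda>(x, y). joinc (mdim M) (\<phi> x) (\<psi> y))"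
    unfolding atlas_prod by blast
  show oZ: "openin (mtop (prod_manifold M N)) Z"
    unfolding Z mtop_prod using M.chart_open[OF c] N.chart_open[OF d] by (simp add: openin_prod_Times_iff)
  show inj: "inj_on \<theta> Z"
    unfolding Z \<theta> inj_on_def using M.chart_inj[OF c] N.chart_inj[OF d] M.chart_Eucl[OF c]
    by (auto simp: joinc_eq_iff dest: inj_onD)
  show img: "openin (Euclidean_space (mdim (prod_manifold M N))) (\<theta> ` B)"
    if "openin (mtop (prod_manifold M N)) B" "B \<subseteq> Z" for B
    using charted_prod_image[OF M N c d, of B] that unfolding mtop_prod mdim_prod Z \<theta> by blast
  show "openin (mtop (prod_manifold M N)) {x\<in>Z. \<theta> x \<in> S}"
    if "openin (Euclidean_space (mdim (prod_manifold M N))) S" for S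
    using charted_prod_vimage[OF M N c d, of S] that unfolding mtop_prod mdim_prod Z \<theta> by blast
  fix Z' \<theta>' assume c': "(Z', \<theta>') \<in> atlas (prod_manifold M N)"
  then obtain U' \<phi>' V' \<psi>' where c': "(U', \<phi>') \<in> atlas M" and d': "(V', \<psi>') \<in> atlas N"
    and Z': "Z' = U' \<times> V'" and \<theta>': "\<theta>' = (\<lambda>(x, y). joinc (mdim M) (\<phi>' x) (\<psi>' y))"
    unfolding atlas_prod by blast
  have "openin (mtop (prod_manifold M N)) (Z \<inter> Z')"
    unfolding mtop_prod Z Z' Times_Int_Times openin_prod_Times_iff
    using M.chart_open[OF c] N.chart_open[OF d] M.chart_open[OF c'] N.chart_open[OF d'] by blast
  then have o: "openin (Euclidean_space (mdim M + mdim N)) (\<theta> ` (Z \<inter> Z'))"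
    using img by (simp add: mdim_prod)
  have 1: "smooth_euclid (mdim M + mdim N) (mdim M) (\<theta> ` (Z \<inter> Z'))
      ((\<phi>' \<circ> inv_into U \<phi>) \<circ> fstc (mdim M))"
    by (rule smooth_euclid_compose[OF fstc_smooth[OF o] M.chart_compatible[OF c c']])
      (use M.chart_Eucl[OF c] in \<open>auto simp: \<theta> Z Z' fstc_joinc\<close>)
  have 2: "smooth_euclid (mdim M + mdim N) (mdim N) (\<theta> ` (Z \<inter> Z'))
      ((\<psi>' \<circ> inv_into V \<psi>) \<circ> sndc (mdim M))"
    by (rule smooth_euclid_compose[OF sndc_smooth[OF o] N.chart_compatible[OF d d']])
      (auto simp: \<theta> Z Z' sndc_joinc)
  have "smooth_euclid (mdim M + mdim N) (mdim M + mdim N) (\<theta> ` (Z \<inter> Z')) (\<theta>' \<circ> inv_into Z \<theta>)"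
  proof (rule smooth_euclid_cong[OF _ joinc_smooth[OF 1 2]])
    fix z assume "z \<in> \<theta> ` (Z \<inter> Z')"
    then obtain p where p: "p \<in> Z" "p \<in> Z'" "z = \<theta> p" by blast
    obtain x y where xy: "p = (x, y)" by (cases p)
    have "inv_into Z \<theta> z = p" using p inj by simp
    then show "joinc (mdim M) (((\<phi>' \<circ> inv_into U \<phi>) \<circ> fstc (mdim M)) z) (((\<psi>' \<circ> inv_into V \<psi>) \<circ> sndc (mdim M)) z)
       = (\<theta>' \<circ> inv_into Z \<theta>) z"
      using p xy M.chart_Eucl[OF c] M.inv_chart[OF c] N.inv_chart[OF d]
      by (simp add: \<theta> \<theta>' Z Z' fstc_joinc sndc_joinc)
  qed
  then show "smooth_euclid (mdim (prod_manifold M N)) (mdim (prod_manifold M N))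
     (\<theta> ` (Z \<inter> Z')) (\<theta>' \<circ> inv_into Z \<theta>)" by (simp add: mdim_prod)
next
  interpret M: charted M by fact
  interpret N: charted N by fact
  fix p assume "p \<in> topspace (mtop (prod_manifold M N))"
  then obtain x y where "p = (x, y)" "x \<in> topspace (mtop M)" "y \<in> topspace (mtop N)"
    by (auto simp: mtop_prod)
  with M.chart_ex[of x] N.chart_ex[of y] show "\<exists>U \<phi>. (U, \<phi>) \<in> atlas (prod_manifold M N) \<and> p \<in> U"
    unfolding atlas_prod by blast
qed

lemma prod_chart: "(U, \<phi>) \<in> atlas M \<Longrightarrow> (V, \<psi>) \<in> atlas N \<Longrightarrow>
    (U \<times> V, \<lambda>(x, y). joinc (mdim M) (\<phi> x) (\<psi> y)) \<in> atlas (prod_manifold M N)"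
  unfolding atlas_prod by blast

lemma smooth_map_fst:
  assumes M: "charted M" and N: "charted N" and W: "openin (mtop (prod_manifold M N)) W"
  shows "smooth_map (prod_manifold M N) M W fst"
proof (rule smooth_mapI[OF W])
  interpret M: charted M by fact
  interpret N: charted N by fact
  interpret P: charted "prod_manifold M N" by (rule charted_prod[OF M N])
  fix p assume p: "p \<in> W"
  have "W \<subseteq> topspace (mtop M) \<times> topspace (mtop N)" using openin_subset[OF W] by (simp add: mtop_prod)
  with p obtain x y where xy: "p = (x, y)" "x \<in> topspace (mtop M)" "y \<in> topspace (mtop N)" by blast
  obtain U \<phi> where c: "(U, \<phi>) \<in> atlas M" "x \<in> U" using M.chart_ex[OF xy(2)] by blast
  obtain V \<psi> where d: "(V, \<psi>) \<in> atlas N" "y \<in> V" using N.chart_ex[OF xy(3)] by blast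
  let ?\<theta> = "\<lambda>(x, y). joinc (mdim M) (\<phi> x) (\<psi> y)"
  note e = prod_chart[OF c(1) d(1)]
  have o: "openin (mtop (prod_manifold M N)) (U \<times> V \<inter> W)" by (rule openin_Int[OF P.chart_open[OF e] W])
  have oi: "openin (Euclidean_space (mdim (prod_manifold M N))) (?\<theta> ` (U \<times> V \<inter> W))"
    by (rule P.chart_image[OF e o]) simp
  have "smooth_euclid (mdim (prod_manifold M N)) (mdim M) (?\<theta> ` (U \<times> V \<inter> W)) (\<phi> \<circ> fst \<circ> inv_into (U \<times> V) ?\<theta>)"
  proof (rule smooth_euclid_cong[OF _ fstc_smooth[OF oi]])
    fix z assume "z \<in> ?\<theta> ` (U \<times> V \<inter> W)"
    then obtain x' y' where q: "x' \<in> U" "y' \<in> V" "z = ?\<theta> (x', y')" by auto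
    have "inv_into (U \<times> V) ?\<theta> z = (x', y')" unfolding q(3) by (rule P.inv_chart[OF e]) (use q in auto)
    then show "fstc (mdim M) z = (\<phi> \<circ> fst \<circ> inv_into (U \<times> V) ?\<theta>) z"
      using q M.chart_Eucl[OF c(1)] by (simp add: fstc_joinc)
  qed
  with e c d o p xy show "\<exists>U \<phi> V \<psi> B. (U, \<phi>) \<in> atlas (prod_manifold M N) \<and> (V, \<psi>) \<in> atlas M \<and>
       openin (mtop (prod_manifold M N)) B \<and> p \<in> B \<and> B \<subseteq> U \<inter> W \<and> fst ` B \<subseteq> V \<and>
       smooth_euclid (mdim (prod_manifold M N)) (mdim M) (\<phi> ` B) (\<psi> \<circ> fst \<circ> inv_into U \<phi>)"
    by (intro exI[of _ "U \<times> V"] exI[of _ ?\<theta>] exI[of _ U] exI[of _ \<phi>] exI[of _ "U \<times> V \<inter> W"]) auto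
qed

lemma smooth_map_snd:
  assumes M: "charted M" and N: "charted N" and W: "openin (mtop (prod_manifold M N)) W"
  shows "smooth_map (prod_manifold M N) N W snd"
proof (rule smooth_mapI[OF W])
  interpret M: charted M by fact
  interpret N: charted N by fact
  interpret P: charted "prod_manifold M N" by (rule charted_prod[OF M N])
  fix p assume p: "p \<in> W"
  have "W \<subseteq> topspace (mtop M) \<times> topspace (mtop N)" using openin_subset[OF W] by (simp add: mtop_prod)
  with p obtain x y where xy: "p = (x, y)" "x \<in> topspace (mtop M)" "y \<in> topspace (mtop N)" by blast
  obtain U \<phi> where c: "(U, \<phi>) \<in> atlas M" "x \<in> U" using M.chart_ex[OF xy(2)] by blast
  obtain V \<psi> where d: "(V, \<psi>) \<in> atlas N" "y \<in> V" using N.chart_ex[OF xy(3)] by blast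
  let ?\<theta> = "\<lambda>(x, y). joinc (mdim M) (\<phi> x) (\<psi> y)"
  note e = prod_chart[OF c(1) d(1)]
  have o: "openin (mtop (prod_manifold M N)) (U \<times> V \<inter> W)" by (rule openin_Int[OF P.chart_open[OF e] W])
  have oi: "openin (Euclidean_space (mdim M + mdim N)) (?\<theta> ` (U \<times> V \<inter> W))"
    using P.chart_image[OF e o] by (simp add: mdim_prod)
  have "smooth_euclid (mdim M + mdim N) (mdim N) (?\<theta> ` (U \<times> V \<inter> W)) (\<psi> \<circ> snd \<circ> inv_into (U \<times> V) ?\<theta>)"
  proof (rule smooth_euclid_cong[OF _ sndc_smooth[OF oi]])
    fix z assume "z \<in> ?\<theta> ` (U \<times> V \<inter> W)"
    then obtain x' y' where q: "x' \<in> U" "y' \<in> V" "z = ?\<theta> (x', y')" by auto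
    have "inv_into (U \<times> V) ?\<theta> z = (x', y')" unfolding q(3) by (rule P.inv_chart[OF e]) (use q in auto)
    then show "sndc (mdim M) z = (\<psi> \<circ> snd \<circ> inv_into (U \<times> V) ?\<theta>) z"
      using q by (simp add: sndc_joinc)
  qed
  with e c d o p xy show "\<exists>U \<phi> V \<psi> B. (U, \<phi>) \<in> atlas (prod_manifold M N) \<and> (V, \<psi>) \<in> atlas N \<and>
       openin (mtop (prod_manifold M N)) B \<and> p \<in> B \<and> B \<subseteq> U \<inter> W \<and> snd ` B \<subseteq> V \<and>
       smooth_euclid (mdim (prod_manifold M N)) (mdim N) (\<phi> ` B) (\<psi> \<circ> snd \<circ> inv_into U \<phi>)"
    by (intro exI[of _ "U \<times> V"] exI[of _ ?\<theta>] exI[of _ V] exI[of _ \<psi>] exI[of _ "U \<times> V \<inter> W"])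
      (auto simp: mdim_prod)
qed

lemma smooth_map_pair:
  assumes L: "charted L" and M: "charted M" and N: "charted N"
    and f: "smooth_map L M W f" and g: "smooth_map L N W g"
  shows "smooth_map L (prod_manifold M N) W (\<lambda>x. (f x, g x))"
proof (rule smooth_mapI[OF smooth_map_open[OF f]])
  interpret L: charted L by fact
  interpret M: charted M by fact
  interpret N: charted N by fact
  fix p assume p: "p \<in> W"
  have "p \<in> topspace (mtop L)" using p openin_subset[OF smooth_map_open[OF f]] by blast
  then obtain Z \<theta> where c: "(Z, \<theta>) \<in> atlas L" "p \<in> Z" using L.chart_ex by blast
  obtain U \<phi> where d: "(U, \<phi>) \<in> atlas M" "f p \<in> U"
    using M.chart_ex[OF subsetD[OF smooth_map_range[OF M f] imageI[OF p]]] by blast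
  obtain V \<psi> where e: "(V, \<psi>) \<in> atlas N" "g p \<in> V"
    using N.chart_ex[OF subsetD[OF smooth_map_range[OF N g] imageI[OF p]]] by blast
  obtain B where B: "openin (mtop L) B" "p \<in> B" "B \<subseteq> Z" "B \<subseteq> W" "f ` B \<subseteq> U"
    "smooth_euclid (mdim L) (mdim M) (\<theta> ` B) (\<phi> \<circ> f \<circ> inv_into Z \<theta>)"
    by (rule smooth_map_in_charts[OF L M f c(1) d(1) p c(2) d(2)])
  obtain C where C: "openin (mtop L) C" "p \<in> C" "C \<subseteq> Z" "C \<subseteq> W" "g ` C \<subseteq> V"
    "smooth_euclid (mdim L) (mdim N) (\<theta> ` C) (\<psi> \<circ> g \<circ> inv_into Z \<theta>)"
    by (rule smooth_map_in_charts[OF L N g c(1) e(1) p c(2) e(2)])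
  let ?\<theta> = "\<lambda>(x, y). joinc (mdim M) (\<phi> x) (\<psi> y)"
  have o: "openin (mtop L) (B \<inter> C)" using B(1) C(1) by (rule openin_Int)
  have oi: "openin (Euclidean_space (mdim L)) (\<theta> ` (B \<inter> C))"
    by (rule L.chart_image[OF c(1) o]) (use B(3) in blast)
  have "smooth_euclid (mdim L) (mdim M + mdim N) (\<theta> ` (B \<inter> C))
     (\<lambda>z. joinc (mdim M) ((\<phi> \<circ> f \<circ> inv_into Z \<theta>) z) ((\<psi> \<circ> g \<circ> inv_into Z \<theta>) z))"
    by (intro joinc_smooth smooth_euclid_subset[OF B(6) oi] smooth_euclid_subset[OF C(6) oi]) auto
  moreover have "(\<lambda>z. joinc (mdim M) ((\<phi> \<circ> f \<circ> inv_into Z \<theta>) z) ((\<psi> \<circ> g \<circ> inv_into Z \<theta>) z))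
     = ?\<theta> \<circ> (\<lambda>x. (f x, g x)) \<circ> inv_into Z \<theta>" by auto
  ultimately have "smooth_euclid (mdim L) (mdim (prod_manifold M N)) (\<theta> ` (B \<inter> C))
     (?\<theta> \<circ> (\<lambda>x. (f x, g x)) \<circ> inv_into Z \<theta>)" by (simp add: mdim_prod)
  with c(1) prod_chart[OF d(1) e(1)] o B C
  show "\<exists>U \<phi> V \<psi> B. (U, \<phi>) \<in> atlas L \<and> (V, \<psi>) \<in> atlas (prod_manifold M N) \<and>
       openin (mtop L) B \<and> p \<in> B \<and> B \<subseteq> U \<inter> W \<and> (\<lambda>x. (f x, g x)) ` B \<subseteq> V \<and>
       smooth_euclid (mdim L) (mdim (prod_manifold M N)) (\<phi> ` B) (\<psi> \<circ> (\<lambda>x. (f x, g x)) \<circ> inv_into U \<phi>)"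
    by (intro exI[of _ Z] exI[of _ \<theta>] exI[of _ "U \<times> V"] exI[of _ ?\<theta>] exI[of _ "B \<inter> C"]) auto
qed

section \<open>Euclidean spaces and the real line\<close>

lemma charted_Rn: "charted (Rn n)"
proof
  have *: "inv_into (Eucl n) (\<lambda>x. x) z = z" if "z \<in> Eucl n" for z
    using that by (intro inv_into_f_eq) auto
  show "smooth_euclid (mdim (Rn n)) (mdim (Rn n)) (\<phi> ` (U \<inter> V)) (\<psi> \<circ> inv_into U \<phi>)"
    if "(U, \<phi>) \<in> atlas (Rn n)" "(V, \<psi>) \<in> atlas (Rn n)" for U \<phi> V \<psi>
    using that smooth_euclid_cong[OF _ smooth_euclid_id[of n "Eucl n"], of "inv_into (Eucl n) (\<lambda>x. x)"] *
    by (auto simp: Rn_def comp_def)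
  show "openin (mtop (Rn n)) {x\<in>U. \<phi> x \<in> S}"
    if "(U, \<phi>) \<in> atlas (Rn n)" "openin (Euclidean_space (mdim (Rn n))) S" for U \<phi> S
  proof -
    have "{x \<in> Eucl n. x \<in> S} = S" using that openin_Eucl_subset[of n S] by (auto simp: Rn_def)
    then show ?thesis using that by (simp add: Rn_def)
  qed
qed (auto simp: Rn_def)

definition line_coord :: "real \<Rightarrow> nat \<Rightarrow> real" where
  "line_coord t = (\<lambda>i. if i = 0 then t else 0)"

lemma line_coord_0 [simp]: "line_coord t 0 = t"
  by (simp add: line_coord_def)

lemma atlas_real_line: "atlas real_line = {(UNIV, line_coord)}"
  and mtop_real_line: "mtop real_line = euclideanreal" and mdim_real_line: "mdim real_line = 1"
  by (simp_all add: real_line_def line_coord_def[abs_def])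

lemma line_coord_image: "line_coord ` B = {z\<in>Eucl 1. z 0 \<in> B}"
proof (intro set_eqI iffI)
  fix z assume z: "z \<in> {z\<in>Eucl 1. z 0 \<in> B}"
  then have "z = line_coord (z 0)" by (auto simp: line_coord_def Eucl_iff)
  with z show "z \<in> line_coord ` B" by blast
qed (auto simp: line_coord_def Eucl_iff)

lemma inj_line_coord: "inj line_coord"
  by (rule injI) (metis line_coord_0)

lemma continuous_on_line_coord: "continuous_on A line_coord"
proof (rule continuous_on_coordinatewise_then_product)
  show "continuous_on A (\<lambda>x. line_coord x i)" for i by (cases "i = 0") (auto simp: line_coord_def)
qed

lemma charted_real_line: "charted real_line"
proof
  have op: "openin (Euclidean_space 1) {z\<in>Eucl 1. z 0 \<in> B}" if "open B" for B :: "real set"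
  proof -
    have "open ((\<lambda>z::nat \<Rightarrow> real. z 0) -` B)"
      using that by (intro open_vimage continuous_on_product_coordinates)
    moreover have "{z\<in>Eucl 1. z 0 \<in> B} = Eucl 1 \<inter> (\<lambda>z. z 0) -` B" by blast
    ultimately show ?thesis unfolding openin_Eucl_iff openin_open by blast
  qed
  show "openin (Euclidean_space (mdim real_line)) (\<phi> ` B)"
    if "(U, \<phi>) \<in> atlas real_line" "openin (mtop real_line) B" for U \<phi> B
    using that op by (simp add: atlas_real_line mtop_real_line mdim_real_line line_coord_image)
  show "openin (mtop real_line) {x\<in>U. \<phi> x \<in> S}"
    if "(U, \<phi>) \<in> atlas real_line" "openin (Euclidean_space (mdim real_line)) S" for U \<phi> S
  proof -
    obtain T where T: "open T" "S = T \<inter> Eucl 1"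
      using \<open>openin (Euclidean_space (mdim real_line)) S\<close> unfolding mdim_real_line openin_Eucl_iff openin_open by blast
    have "{x. line_coord x \<in> S} = line_coord -` T"
      unfolding T by (auto simp: line_coord_def Eucl_iff)
    then show ?thesis using that T(1) continuous_on_line_coord
      by (simp add: atlas_real_line mtop_real_line open_vimage)
  qed
  show "smooth_euclid (mdim real_line) (mdim real_line) (\<phi> ` (U \<inter> V)) (\<psi> \<circ> inv_into U \<phi>)"
    if "(U, \<phi>) \<in> atlas real_line" "(V, \<psi>) \<in> atlas real_line" for U \<phi> V \<psi>
  proof -
    have "smooth_euclid 1 1 (line_coord ` UNIV) (line_coord \<circ> inv_into UNIV line_coord)"
    proof (rule smooth_euclid_cong[OF _ smooth_euclid_id])
      show "openin (Euclidean_space 1) (range line_coord)"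
        unfolding line_coord_image by (rule op) simp
    qed (simp add: f_inv_into_f)
    then show ?thesis using that by (simp add: atlas_real_line mdim_real_line)
  qed
  show "inj_on \<phi> U" if "(U, \<phi>) \<in> atlas real_line" for U \<phi>
    using that inj_line_coord by (simp add: atlas_real_line)
qed (auto simp: atlas_real_line mtop_real_line)

abbreviation plane :: "(real \<times> real) manifold" where
  "plane \<equiv> prod_manifold real_line real_line"

lemma charted_plane: "charted plane"
  by (intro charted_prod charted_real_line)

lemma smooth_map_real_global_chart:
  assumes c: "(UNIV, \<phi>) \<in> atlas M" and M: "charted M" and f: "smooth_fun (mdim M) (\<phi> ` UNIV) F"
    and eq: "\<And>x. F (\<phi> x) = f x"
  shows "smooth_map M real_line UNIV f"
proof -
  interpret M: charted M by fact
  show ?thesis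
  proof (rule smooth_mapI[OF M.chart_open[OF c]])
    fix x
    have "smooth_euclid (mdim M) 1 (\<phi> ` UNIV) (line_coord \<circ> f \<circ> inv_into UNIV \<phi>)"
      unfolding smooth_euclid_iff
    proof (intro conjI allI impI)
      show "openin (Euclidean_space (mdim M)) (range \<phi>)" by (rule smooth_fun_open[OF f])
      show "(line_coord \<circ> f \<circ> inv_into UNIV \<phi>) ` range \<phi> \<subseteq> Eucl 1"
        by (auto simp: line_coord_def Eucl_iff)
      fix i :: nat assume "i < 1"
      then show "smooth_fun (mdim M) (range \<phi>) (\<lambda>x. (line_coord \<circ> f \<circ> inv_into UNIV \<phi>) x i)"
        by (intro smooth_fun_cong[OF _ f]) (use M.inv_chart[OF c] eq in auto)
    qed
    with c M.chart_open[OF c] show "\<exists>U \<phi> V \<psi> B. (U, \<phi>) \<in> atlas M \<and> (V, \<psi>) \<in> atlas real_line \<and>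
       openin (mtop M) B \<and> x \<in> B \<and> B \<subseteq> U \<inter> UNIV \<and> f ` B \<subseteq> V \<and>
       smooth_euclid (mdim M) (mdim real_line) (\<phi> ` B) (\<psi> \<circ> f \<circ> inv_into U \<phi>)"
      by (intro exI[of _ UNIV] exI[of _ \<phi>] exI[of _ UNIV] exI[of _ line_coord] exI[of _ UNIV])
        (auto simp: atlas_real_line mdim_real_line)
  qed
qed

text \<open>The hypothesis, that composition with \<open>f\<close> preserves smooth functions, is the form in which the
  closure properties of \<open>smooth_fun\<close> prove smoothness of an explicit \<open>f\<close>.\<close>

lemma smooth_map_line_real:
  assumes "\<And>n U g. smooth_fun n U g \<Longrightarrow> smooth_fun n U (\<lambda>z. f (g z))"
  shows "smooth_map real_line real_line UNIV f"
proof (rule smooth_map_real_global_chart[where \<phi> = line_coord and F = "\<lambda>z. f (z 0)", OF _ charted_real_line])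
  interpret charted real_line by (rule charted_real_line)
  have c: "(UNIV, line_coord) \<in> atlas real_line" by (simp add: atlas_real_line)
  show "smooth_fun (mdim real_line) (range line_coord) (\<lambda>z. f (z 0))"
    using chart_image[OF c chart_open[OF c]] by (intro assms smooth_fun_coordinate) simp
qed (auto simp: atlas_real_line)

lemma smooth_map_plane_real:
  assumes "\<And>n U g h. smooth_fun n U g \<Longrightarrow> smooth_fun n U h \<Longrightarrow> smooth_fun n U (\<lambda>z. f (g z, h z))"
  shows "smooth_map plane real_line UNIV f"
proof (rule smooth_map_real_global_chart[where \<phi> = "\<lambda>(x, y). joinc 1 (line_coord x) (line_coord y)"
      and F = "\<lambda>z. f (z 0, z 1)", OF _ charted_plane])
  interpret charted plane by (rule charted_plane)
  show c: "(UNIV, \<lambda>(x, y). joinc 1 (line_coord x) (line_coord y)) \<in> atlas plane"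
    using prod_chart[of UNIV line_coord real_line UNIV line_coord real_line]
    by (simp add: atlas_real_line mdim_real_line)
  show "smooth_fun (mdim plane) (range (\<lambda>(x, y). joinc 1 (line_coord x) (line_coord y))) (\<lambda>z. f (z 0, z 1))"
    using chart_image[OF c chart_open[OF c]] by (intro assms smooth_fun_coordinate) simp_all
qed (auto simp: joinc_def)

section \<open>Smoothness on subsets\<close>

lemma smooth_on_of_map:
  "smooth_map M N W f \<Longrightarrow> S \<subseteq> W \<Longrightarrow> smooth_on M N S f"
  unfolding smooth_on_def using openin_subset[OF smooth_map_open] by blast

lemma smooth_on_cong: "smooth_on M N S f \<Longrightarrow> (\<And>x. x \<in> S \<Longrightarrow> f x = g x) \<Longrightarrow> smooth_on M N S g"
  unfolding smooth_on_def by (metis Int_iff)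

lemma smooth_onE:
  assumes "smooth_on M N S f" "x \<in> S"
  obtains W g where "x \<in> W" "smooth_map M N W g" "\<And>y. y \<in> W \<Longrightarrow> y \<in> S \<Longrightarrow> g y = f y"
  using assms unfolding smooth_on_def by blast

lemma smooth_on_local:
  assumes M: "charted M"
    and ex: "\<And>x. x \<in> S \<Longrightarrow> \<exists>W. openin (mtop M) W \<and> x \<in> W \<and> smooth_on M N (S \<inter> W) f"
  shows "smooth_on M N S f"
  unfolding smooth_on_def
proof (intro conjI ballI subsetI)
  fix x assume x: "x \<in> S"
  then obtain W where W: "openin (mtop M) W" "x \<in> W" "smooth_on M N (S \<inter> W) f" using ex by blast
  then show "x \<in> topspace (mtop M)" using openin_subset by blast
  obtain W' g where g: "x \<in> W'" "smooth_map M N W' g" "\<And>y. y \<in> W' \<Longrightarrow> y \<in> S \<inter> W \<Longrightarrow> g y = f y"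
    using smooth_onE[OF W(3)] x W(2) by (metis IntI)
  have "openin (mtop M) (W' \<inter> W)" using smooth_map_open[OF g(2)] W(1) by (rule openin_Int)
  then have "smooth_map M N (W' \<inter> W) g" by (rule smooth_map_subset[OF M g(2)]) simp
  then show "\<exists>W g. x \<in> W \<and> smooth_map M N W g \<and> (\<forall>y\<in>W \<inter> S. g y = f y)"
    using g W(2) by (intro exI[of _ "W' \<inter> W"] exI[of _ g]) auto
qed

lemma smooth_on_compose:
  assumes M: "charted M" and N: "charted N" and P: "charted P"
    and f: "smooth_on M N S f" and g: "smooth_on N P T g" and fST: "\<And>x. x \<in> S \<Longrightarrow> f x \<in> T"
  shows "smooth_on M P S (\<lambda>x. g (f x))"
  unfolding smooth_on_def
proof (intro conjI ballI)
  show "S \<subseteq> topspace (mtop M)" using f by (simp add: smooth_on_def)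
  fix x assume x: "x \<in> S"
  obtain W f' where f': "x \<in> W" "smooth_map M N W f'" "\<And>y. y \<in> W \<Longrightarrow> y \<in> S \<Longrightarrow> f' y = f y"
    using smooth_onE[OF f x] by metis
  obtain Z g' where g': "f x \<in> Z" "smooth_map N P Z g'" "\<And>y. y \<in> Z \<Longrightarrow> y \<in> T \<Longrightarrow> g' y = g y"
    using smooth_onE[OF g fST[OF x]] by metis
  let ?W = "{y\<in>W. f' y \<in> Z}"
  have "openin (mtop M) ?W" by (rule smooth_map_vimage_open[OF M N f'(2) smooth_map_open[OF g'(2)]])
  then have "smooth_map M N ?W f'" by (rule smooth_map_subset[OF M f'(2)]) blast
  then have "smooth_map M P ?W (g' \<circ> f')" by (rule smooth_map_compose[OF M N P _ g'(2)]) blast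
  moreover have "x \<in> ?W" using f'(1) g'(1) f'(3)[OF f'(1) x] by simp
  moreover have "\<forall>y\<in>?W \<inter> S. (g' \<circ> f') y = g (f y)"
  proof
    fix y assume y: "y \<in> ?W \<inter> S"
    then have "f' y = f y" using f'(3) by simp
    with y g'(3)[OF _ fST] show "(g' \<circ> f') y = g (f y)" by simp
  qed
  ultimately show "\<exists>W h. x \<in> W \<and> smooth_map M P W h \<and> (\<forall>y\<in>W \<inter> S. h y = g (f y))"
    by (intro exI[of _ ?W] exI[of _ "g' \<circ> f'"]) (intro conjI)
qed

lemma smooth_on_pair:
  assumes L: "charted L" and M: "charted M" and N: "charted N"
    and f: "smooth_on L M S f" and g: "smooth_on L N S g"
  shows "smooth_on L (prod_manifold M N) S (\<lambda>x. (f x, g x))"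
  unfolding smooth_on_def
proof (intro conjI ballI)
  show "S \<subseteq> topspace (mtop L)" using f by (simp add: smooth_on_def)
  fix x assume x: "x \<in> S"
  obtain W f' where f': "x \<in> W" "smooth_map L M W f'" "\<And>y. y \<in> W \<Longrightarrow> y \<in> S \<Longrightarrow> f' y = f y"
    using smooth_onE[OF f x] by metis
  obtain Z g' where g': "x \<in> Z" "smooth_map L N Z g'" "\<And>y. y \<in> Z \<Longrightarrow> y \<in> S \<Longrightarrow> g' y = g y"
    using smooth_onE[OF g x] by metis
  have o: "openin (mtop L) (W \<inter> Z)" using smooth_map_open[OF f'(2)] smooth_map_open[OF g'(2)] by blast
  have "smooth_map L M (W \<inter> Z) f'" "smooth_map L N (W \<inter> Z) g'"
    by (rule smooth_map_subset[OF L f'(2) o], simp) (rule smooth_map_subset[OF L g'(2) o], simp)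
  from smooth_map_pair[OF L M N this]
  show "\<exists>W h. x \<in> W \<and> smooth_map L (prod_manifold M N) W h \<and> (\<forall>y\<in>W \<inter> S. h y = (f y, g y))"
    using f'(1,3) g'(1,3) by (intro exI[of _ "W \<inter> Z"] exI[of _ "\<lambda>x. (f' x, g' x)"]) auto
qed

lemma smooth_on_imp_smooth_map:
  assumes M: "charted M" and f: "smooth_on M N S f" and S: "openin (mtop M) S"
  shows "smooth_map M N S f"
proof (rule smooth_map_local)
  fix x assume x: "x \<in> S"
  obtain W g where g: "x \<in> W" "smooth_map M N W g" "\<And>y. y \<in> W \<Longrightarrow> y \<in> S \<Longrightarrow> g y = f y"
    using smooth_onE[OF f x] by metis
  have "openin (mtop M) (W \<inter> S)" using smooth_map_open[OF g(2)] S by (rule openin_Int)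
  then have "smooth_map M N (W \<inter> S) g" by (rule smooth_map_subset[OF M g(2)]) simp
  then have "smooth_map M N (W \<inter> S) f" by (rule smooth_map_cong[OF M, rotated]) (use g(3) in auto)
  then show "\<exists>W'. x \<in> W' \<and> W' \<subseteq> S \<and> smooth_map M N W' f"
    using g(1) x by (intro exI[of _ "W \<inter> S"]) simp
qed

lemma smooth_on_range: "charted N \<Longrightarrow> smooth_on M N S f \<Longrightarrow> x \<in> S \<Longrightarrow> f x \<in> topspace (mtop N)"
  by (erule (1) smooth_onE) (metis image_subset_iff smooth_map_range)

lemma smooth_on_const:
  assumes "charted M" "charted N" "S \<subseteq> topspace (mtop M)" "y \<in> topspace (mtop N)"
  shows "smooth_on M N S (\<lambda>_. y)"
  by (rule smooth_on_of_map[OF smooth_map_const[OF assms(1,2) openin_topspace assms(4)] assms(3)])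

section \<open>The differential\<close>

lemma chart_differential_cong:
  assumes M: "charted M" and c: "c \<in> atlas M" "x \<in> fst c"
    and W: "openin (mtop M) W" "x \<in> W" "\<And>y. y \<in> W \<Longrightarrow> f y = g y"
  shows "chart_differential M N c d f x = chart_differential M N c d g x"
proof -
  interpret M: charted M by fact
  obtain U \<phi> where U: "c = (U, \<phi>)" by (cases c)
  note c = c[unfolded U fst_conv]
  have o: "openin (Euclidean_space (mdim M)) (\<phi> ` (U \<inter> W))"
    by (rule M.chart_image[OF c(1) openin_Int[OF M.chart_open[OF c(1)] W(1)]]) simp
  have "partial j (\<lambda>y. snd d (f (inv_into U \<phi> y)) i) (\<phi> x) = partial j (\<lambda>y. snd d (g (inv_into U \<phi> y)) i) (\<phi> x)"
    if "j < mdim M" for i j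
  proof (rule partial_cong[OF o _ _ that])
    fix z assume "z \<in> \<phi> ` (U \<inter> W)"
    then have "inv_into U \<phi> z \<in> W" using M.inv_chart[OF c(1)] by auto
    then show "snd d (f (inv_into U \<phi> z)) i = snd d (g (inv_into U \<phi> z)) i" by (simp add: W(3))
  qed (use c W in blast)
  then show ?thesis unfolding chart_differential_def U fst_conv snd_conv
    by (intro ext if_cong refl sum.cong arg_cong2[where f = "(*)"]) simp
qed

lemma smooth_fun_has_partial:
  assumes "smooth_fun n U f" shows "Ck (Suc 0) n U f"
  using assms unfolding smooth_fun_def by blast

text \<open>In charts the composite is a composite of maps between open subsets of Euclidean spaces, and the
  matrix of its partial derivatives is the product of the two matrices.\<close>

lemma chart_differential_compose:
  assumes L: "charted L" and M: "charted M" and N: "charted N"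
    and v: "smooth_map L M W v" and f: "smooth_map M N W' f" and x: "x \<in> W" "v x \<in> W'"
    and c: "c \<in> atlas L" "x \<in> fst c" and d: "d \<in> atlas M" "v x \<in> fst d"
    and e: "e \<in> atlas N" "f (v x) \<in> fst e"
  shows "chart_differential L N c e (f \<circ> v) x w =
    chart_differential M N d e f (v x) (chart_differential L M c d v x w)"
proof -
  interpret L: charted L by fact
  interpret M: charted M by fact
  interpret N: charted N by fact
  obtain U \<phi> V \<psi> Z \<theta> where cde: "c = (U, \<phi>)" "d = (V, \<psi>)" "e = (Z, \<theta>)" by (metis surj_pair)
  note c = c[unfolded cde fst_conv] and d = d[unfolded cde fst_conv] and e = e[unfolded cde fst_conv]
  obtain B' where B': "openin (mtop M) B'" "v x \<in> B'" "B' \<subseteq> V" "B' \<subseteq> W'" "f ` B' \<subseteq> Z"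
    "smooth_euclid (mdim M) (mdim N) (\<psi> ` B') (\<theta> \<circ> f \<circ> inv_into V \<psi>)"
    by (rule smooth_map_in_charts[OF M N f d(1) e(1) x(2) d(2) e(2)])
  obtain C where C: "openin (mtop L) C" "x \<in> C" "C \<subseteq> U" "C \<subseteq> W" "v ` C \<subseteq> V"
    "smooth_euclid (mdim L) (mdim M) (\<phi> ` C) (\<psi> \<circ> v \<circ> inv_into U \<phi>)"
    by (rule smooth_map_in_charts[OF L M v c(1) d(1) x(1) c(2) d(2)])
  define B where "B = {y\<in>C. v y \<in> B'}"
  have oB: "openin (mtop L) B" unfolding B_def
    by (rule chart_map_vimage_open[OF L M c(1) d(1) C(1,3,5,6) B'(1)])
  have BC: "B \<subseteq> C" "B \<subseteq> U" "x \<in> B" using C(2,3) B'(2) unfolding B_def by blast+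
  have o: "openin (Euclidean_space (mdim L)) (\<phi> ` B)"
    by (rule L.chart_image[OF c(1) oB BC(2)])
  define H where "H = \<psi> \<circ> v \<circ> inv_into U \<phi>"
  define F where "F = \<theta> \<circ> f \<circ> inv_into V \<psi>"
  have H: "smooth_euclid (mdim L) (mdim M) (\<phi> ` B) H"
    unfolding H_def by (rule smooth_euclid_subset[OF C(6) o]) (use BC in blast)
  have F: "smooth_euclid (mdim M) (mdim N) (\<psi> ` B') F" unfolding F_def by (rule B'(6))
  have inv: "inv_into U \<phi> (\<phi> y) = y" if "y \<in> U" for y using L.inv_chart[OF c(1) that] .
  have inv': "inv_into V \<psi> (\<psi> y) = y" if "y \<in> V" for y using M.inv_chart[OF d(1) that] .
  have HB: "H ` \<phi> ` B \<subseteq> \<psi> ` B'" using BC(2) inv by (auto simp: H_def B_def)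
  have Hx: "H (\<phi> x) = \<psi> (v x)" using inv[OF c(2)] by (simp add: H_def)
  have eq: "\<theta> ((f \<circ> v) (inv_into U \<phi> z)) i = F (H z) i" if z: "z \<in> \<phi> ` B" for z i
  proof -
    obtain y where y: "y \<in> B" "z = \<phi> y" using z by blast
    then have "inv_into U \<phi> z = y" "v y \<in> V" using BC(2) inv B'(3) by (auto simp: B_def)
    then show ?thesis by (simp add: F_def H_def inv')
  qed
  have "partial j (\<lambda>z. \<theta> ((f \<circ> v) (inv_into U \<phi> z)) i) (\<phi> x) =
      (\<Sum>l<mdim M. partial l (\<lambda>z. F z i) (\<psi> (v x)) * partial j (\<lambda>z. H z l) (\<phi> x))"
    if "i < mdim N" "j < mdim L" for i j
  proof -
    have "partial j (\<lambda>z. \<theta> ((f \<circ> v) (inv_into U \<phi> z)) i) (\<phi> x) = partial j (\<lambda>z. F (H z) i) (\<phi> x)"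
      by (rule partial_cong[OF o eq _ that(2)]) (use BC in auto)
    also have "\<dots> = (\<Sum>l<mdim M. partial l (\<lambda>z. F z i) (H (\<phi> x)) * partial j (\<lambda>z. H z l) (\<phi> x))"
      unfolding partial_def[of j "\<lambda>z. F (H z) i"]
    proof (rule DERIV_imp_deriv, rule chain_rule_partial[OF o _ _ _ HB _ that(2)])
      show "openin (Euclidean_space (mdim M)) (\<psi> ` B')" by (rule M.chart_image[OF d(1) B'(1,3)])
      show "Ck (Suc 0) (mdim M) (\<psi> ` B') (\<lambda>z. F z i)"
        using F that unfolding smooth_euclid_iff by (intro smooth_fun_has_partial) blast
      show "Ck (Suc 0) (mdim L) (\<phi> ` B) (\<lambda>x. H x l)" if "l < mdim M" for l
        using H that unfolding smooth_euclid_iff by (intro smooth_fun_has_partial) blast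
      show "\<phi> x \<in> \<phi> ` B" using BC by blast
    qed
    finally show ?thesis by (simp add: Hx)
  qed
  note P = this
  show ?thesis
  proof (rule ext)
    fix i
    show "chart_differential L N c e (f \<circ> v) x w i =
      chart_differential M N d e f (v x) (chart_differential L M c d v x w) i"
    proof (cases "i < mdim N")
      case True
      have "(\<Sum>j<mdim L. partial j (\<lambda>z. \<theta> ((f \<circ> v) (inv_into U \<phi> z)) i) (\<phi> x) * w j) =
         (\<Sum>j<mdim L. \<Sum>l<mdim M. partial l (\<lambda>z. F z i) (\<psi> (v x)) * partial j (\<lambda>z. H z l) (\<phi> x) * w j)"
        by (intro sum.cong refl, subst P[OF True]) (simp_all add: sum_distrib_right)
      also have "\<dots> = (\<Sum>l<mdim M. \<Sum>j<mdim L. partial l (\<lambda>z. F z i) (\<psi> (v x)) * partial j (\<lambda>z. H z l) (\<phi> x) * w j)"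
        by (rule sum.swap)
      also have "\<dots> = (\<Sum>l<mdim M. partial l (\<lambda>z. F z i) (\<psi> (v x)) * (\<Sum>j<mdim L. partial j (\<lambda>z. H z l) (\<phi> x) * w j))"
        by (simp add: sum_distrib_left mult.assoc)
      finally show ?thesis using True by (simp add: chart_differential_def cde F_def H_def)
    qed (simp add: chart_differential_def)
  qed
qed

lemma vector_space_nat_real: "vector_space (\<lambda>(a::real) (v::nat \<Rightarrow> real) i. a * v i)"
  by unfold_locales (auto simp: fun_eq_iff algebra_simps)

text \<open>The dimension that defines the rank is taken in the space of all sequences, which is not finite
  dimensional, and there \<open>dim\<close> is monotone only on sets with a finite spanning set. The columns of
  the matrix of partial derivatives form such a set.\<close>

lemma chart_differential_in_span:
  "\<exists>F. finite F \<and> card F \<le> mdim M \<and> (\<forall>w. chart_differential M N c d f x w \<in>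
     module.span (\<lambda>(a::real) (v::nat \<Rightarrow> real) i. a * v i) F)"
proof -
  interpret vector_space "\<lambda>(a::real) (v::nat \<Rightarrow> real) i. a * v i" by (rule vector_space_nat_real)
  have sum_apply: "(\<Sum>j<m. h j) i = (\<Sum>j<m. h j i)" for h :: "nat \<Rightarrow> nat \<Rightarrow> real" and m i
    by (induction m) auto
  define b where "b j = (\<lambda>i. if i < mdim N
     then partial j (\<lambda>y. snd d (f (inv_into (fst c) (snd c) y)) i) (snd c x) else 0)" for j
  have "chart_differential M N c d f x w = (\<Sum>j<mdim M. (\<lambda>i. w j * b j i))" for w
    by (rule ext) (simp add: chart_differential_def b_def sum_apply mult.commute)
  moreover have "(\<Sum>j<mdim M. (\<lambda>i. w j * b j i)) \<in> span (b ` {..<mdim M})" for w :: "nat \<Rightarrow> real"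
    by (intro span_sum span_scale span_base) auto
  ultimately have "\<forall>w. chart_differential M N c d f x w \<in> span (b ` {..<mdim M})" by simp
  moreover have "card (b ` {..<mdim M}) \<le> mdim M" using card_image_le[of "{..<mdim M}" b] by simp
  ultimately show ?thesis by (intro exI[of _ "b ` {..<mdim M}"] conjI) simp_all
qed

lemma differential_rank_le_mdim: "differential_rank_le (mdim M) M N f x"
  unfolding differential_rank_le_def
proof (intro ballI impI)
  interpret vector_space "\<lambda>(a::real) (v::nat \<Rightarrow> real) i. a * v i" by (rule vector_space_nat_real)
  fix c d
  obtain F where F: "finite F" "card F \<le> mdim M" "\<And>w. chart_differential M N c d f x w \<in> span F"
    using chart_differential_in_span[of M N c d f x] by metis
  have "dim (chart_differential M N c d f x ` topspace (Euclidean_space (mdim M))) \<le> card F"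
    by (rule dim_le_card) (use F in auto)
  then show "dim (chart_differential M N c d f x ` topspace (Euclidean_space (mdim M))) \<le> mdim M"
    using F(2) by simp
qed

text \<open>By the chain rule the image of the differential of \<open>f \<circ> v\<close> is contained in that of \<open>f\<close>.\<close>

lemma differential_rank_le_compose:
  assumes L: "charted L" and M: "charted M" and N: "charted N"
    and v: "smooth_map L M W v" and f: "smooth_map M N W' f" and x: "x \<in> W" "v x \<in> W'"
    and rank: "differential_rank_le k M N f (v x)"
  shows "differential_rank_le k L N (f \<circ> v) x"
  unfolding differential_rank_le_def
proof (intro ballI impI)
  interpret vector_space "\<lambda>(a::real) (v::nat \<Rightarrow> real) i. a * v i" by (rule vector_space_nat_real)
  interpret M: charted M by fact
  fix c e assume c: "c \<in> atlas L" and e: "e \<in> atlas N" and xf: "x \<in> fst c \<and> (f \<circ> v) x \<in> fst e"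
  have "v x \<in> topspace (mtop M)" using smooth_map_range[OF M v] x(1) by blast
  then obtain d where d: "d \<in> atlas M" "v x \<in> fst d" using M.chart_ex by fastforce
  let ?A = "chart_differential L N c e (f \<circ> v) x ` Eucl (mdim L)"
  let ?B = "chart_differential M N d e f (v x) ` Eucl (mdim M)"
  have sub: "?A \<subseteq> ?B"
  proof
    fix y assume "y \<in> ?A"
    then obtain w where y: "y = chart_differential L N c e (f \<circ> v) x w" by blast
    have "y = chart_differential M N d e f (v x) (chart_differential L M c d v x w)"
      unfolding y by (rule chart_differential_compose[OF L M N v f x c _ d e]) (use xf in auto)
    moreover have "chart_differential L M c d v x w \<in> Eucl (mdim M)"
      by (auto simp: chart_differential_def Eucl_iff)
    ultimately show "y \<in> ?B" by blast
  qed
  obtain F where F: "finite F" "\<And>w. chart_differential M N d e f (v x) w \<in> span F"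
    using chart_differential_in_span[of M N d e f "v x"] by metis
  obtain b where b: "b \<subseteq> ?B" "independent b" "?B \<subseteq> span b" "card b = dim ?B"
    using basis_exists by blast
  have "b \<subseteq> span F" using b(1) F(2) by blast
  then have "finite b" using independent_span_bound[OF F(1) b(2)] by blast
  then have "dim ?A \<le> card b" using sub b(3) by (intro dim_le_card) auto
  also have "card b \<le> k" using rank d e xf b(4) unfolding differential_rank_le_def by auto
  finally show "dim ?A \<le> k" .
qed

lemma differential_rank_le_cong:
  assumes M: "charted M" and W: "openin (mtop M) W" "x \<in> W" "\<And>y. y \<in> W \<Longrightarrow> f y = g y"
    and f: "differential_rank_le k M N f x"
  shows "differential_rank_le k M N g x"
  using f W(3)[OF W(2)] chart_differential_cong[OF M _ _ W, where N = N]
  unfolding differential_rank_le_def by simp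

section \<open>Paths with sitting instants\<close>

lemma topspace_real_line [simp]: "topspace (mtop real_line) = UNIV"
  by (simp add: mtop_real_line)

lemma openin_real_line [simp]: "openin (mtop real_line) W \<longleftrightarrow> open W"
  by (simp add: mtop_real_line)

lemma openin_plane [simp]: "openin (mtop plane) W \<longleftrightarrow> open W"
  by (simp add: mtop_prod mtop_real_line)

lemma sitting_pathI:
  assumes "\<alpha> \<in> extensional {0..1}" "smooth_on real_line M {0..1} \<alpha>" "\<epsilon> > 0"
    "\<And>r. 0 \<le> r \<Longrightarrow> r \<le> 1 \<Longrightarrow> r \<le> \<epsilon> \<Longrightarrow> \<alpha> r = \<alpha> 0"
    "\<And>r. 0 \<le> r \<Longrightarrow> r \<le> 1 \<Longrightarrow> 1 - \<epsilon> \<le> r \<Longrightarrow> \<alpha> r = \<alpha> 1"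
  shows "\<alpha> \<in> sitting_paths M"
proof -
  have "\<forall>r\<in>{0..1}. (r \<le> \<epsilon> \<longrightarrow> \<alpha> r = \<alpha> 0) \<and> (1 - \<epsilon> \<le> r \<longrightarrow> \<alpha> r = \<alpha> 1)"
    by (intro ballI conjI impI assms(4,5)) simp_all
  then show ?thesis using assms(1-3) unfolding sitting_paths_def by blast
qed

lemma sitting_path_smooth: "\<alpha> \<in> sitting_paths M \<Longrightarrow> smooth_on real_line M {0..1} \<alpha>"
  by (simp add: sitting_paths_def)

lemma sitting_path_mem:
  "charted M \<Longrightarrow> \<alpha> \<in> sitting_paths M \<Longrightarrow> 0 \<le> r \<Longrightarrow> r \<le> 1 \<Longrightarrow> \<alpha> r \<in> topspace (mtop M)"
  by (rule smooth_on_range[OF _ sitting_path_smooth]) simp_all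

lemma sitting_pathE:
  assumes "\<alpha> \<in> sitting_paths M" "b > 0"
  obtains \<epsilon> where "\<epsilon> > 0" "\<epsilon> \<le> b"
    "\<And>r. 0 \<le> r \<Longrightarrow> r \<le> 1 \<Longrightarrow> r \<le> \<epsilon> \<Longrightarrow> \<alpha> r = \<alpha> 0"
    "\<And>r. 0 \<le> r \<Longrightarrow> r \<le> 1 \<Longrightarrow> 1 - \<epsilon> \<le> r \<Longrightarrow> \<alpha> r = \<alpha> 1"
proof -
  from assms(1) obtain \<epsilon> where e: "\<epsilon> > 0" "\<forall>r\<in>{0..1}. (r \<le> \<epsilon> \<longrightarrow> \<alpha> r = \<alpha> 0) \<and> (1 - \<epsilon> \<le> r \<longrightarrow> \<alpha> r = \<alpha> 1)"
    unfolding sitting_paths_def by blast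
  show ?thesis
  proof (rule that[of "min \<epsilon> b"])
    show "\<alpha> r = \<alpha> 0" if "0 \<le> r" "r \<le> 1" "r \<le> min \<epsilon> b" for r
      using e(2)[rule_format, of r] that by simp
    show "\<alpha> r = \<alpha> 1" if "0 \<le> r" "r \<le> 1" "1 - min \<epsilon> b \<le> r" for r
      using e(2)[rule_format, of r] that by simp
  qed (use e(1) assms(2) in auto)
qed

lemma const_path_apply [simp]: "0 \<le> r \<Longrightarrow> r \<le> 1 \<Longrightarrow> const_path x r = x"
  by (simp add: const_path_def)

lemma map_path_apply [simp]: "0 \<le> r \<Longrightarrow> r \<le> 1 \<Longrightarrow> map_path f \<alpha> r = f (\<alpha> r)"
  by (simp add: map_path_def)

lemma rev_path_apply [simp]: "0 \<le> r \<Longrightarrow> r \<le> 1 \<Longrightarrow> rev_path \<alpha> r = \<alpha> (1 - r)"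
  by (simp add: rev_path_def)

lemma concat_path_apply: "0 \<le> r \<Longrightarrow> r \<le> 1 \<Longrightarrow>
    concat_path \<beta> \<alpha> r = (if r \<le> 1 / 2 then \<alpha> (2 * r) else \<beta> (2 * r - 1))"
  by (simp add: concat_path_def)

lemma concat_path_ends [simp]: "concat_path \<beta> \<alpha> 0 = \<alpha> 0" "concat_path \<beta> \<alpha> 1 = \<beta> 1"
  by (simp_all add: concat_path_def)

lemma const_path_sitting:
  assumes "charted M" "x \<in> topspace (mtop M)" shows "const_path x \<in> sitting_paths M"
proof (rule sitting_pathI[of _ _ 1])
  show "smooth_on real_line M {0..1} (const_path x)"
    by (rule smooth_on_cong[OF smooth_on_const[OF charted_real_line assms(1) _ assms(2)]]) auto
qed (auto simp: const_path_def)

lemma map_path_sitting: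
  assumes M: "charted M" and N: "charted N" and f: "smooth_map M N (topspace (mtop M)) f"
    and \<alpha>: "\<alpha> \<in> sitting_paths M"
  shows "map_path f \<alpha> \<in> sitting_paths N"
proof -
  obtain \<epsilon> where e: "\<epsilon> > 0" "\<And>r. 0 \<le> r \<Longrightarrow> r \<le> 1 \<Longrightarrow> r \<le> \<epsilon> \<Longrightarrow> \<alpha> r = \<alpha> 0"
    "\<And>r. 0 \<le> r \<Longrightarrow> r \<le> 1 \<Longrightarrow> 1 - \<epsilon> \<le> r \<Longrightarrow> \<alpha> r = \<alpha> 1" using sitting_pathE[OF \<alpha> zero_less_one] by metis
  show ?thesis
  proof (rule sitting_pathI[OF _ _ e(1)])
    have "smooth_on real_line N {0..1} (\<lambda>r. f (\<alpha> r))"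
      by (rule smooth_on_compose[OF charted_real_line M N sitting_path_smooth[OF \<alpha>] smooth_on_of_map[OF f order_refl]])
         (use sitting_path_mem[OF M \<alpha>] in auto)
    then show "smooth_on real_line N {0..1} (map_path f \<alpha>)" by (rule smooth_on_cong) simp
    show "map_path f \<alpha> r = map_path f \<alpha> 0" if "0 \<le> r" "r \<le> 1" "r \<le> \<epsilon>" for r
      using e(2)[OF that] that by simp
    show "map_path f \<alpha> r = map_path f \<alpha> 1" if "0 \<le> r" "r \<le> 1" "1 - \<epsilon> \<le> r" for r
      using e(3)[OF that] that by simp
  qed (simp add: map_path_def)
qed

text \<open>This reparametrises both halves of a concatenation and the reverse of a path.\<close>

lemma smooth_on_line_affine:
  assumes M: "charted M" and \<alpha>: "smooth_on real_line M {0..1} \<alpha>"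
    and T: "\<And>r. r \<in> T \<Longrightarrow> 0 \<le> b * r + c \<and> b * r + c \<le> 1"
  shows "smooth_on real_line M T (\<lambda>r. \<alpha> (b * r + c))"
proof (rule smooth_on_compose[OF charted_real_line charted_real_line M _ \<alpha>])
  have "smooth_map real_line real_line UNIV (\<lambda>r. b * r + c)"
    by (rule smooth_map_line_real) (intro smooth_fun_add smooth_fun_mult smooth_fun_const smooth_fun_open)
  then show "smooth_on real_line real_line T (\<lambda>r. b * r + c)" by (rule smooth_on_of_map) simp
qed (use T in auto)

lemma rev_path_sitting:
  assumes M: "charted M" and \<alpha>: "\<alpha> \<in> sitting_paths M"
  shows "rev_path \<alpha> \<in> sitting_paths M"
proof -
  obtain \<epsilon> where e: "\<epsilon> > 0" "\<And>r. 0 \<le> r \<Longrightarrow> r \<le> 1 \<Longrightarrow> r \<le> \<epsilon> \<Longrightarrow> \<alpha> r = \<alpha> 0"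
    "\<And>r. 0 \<le> r \<Longrightarrow> r \<le> 1 \<Longrightarrow> 1 - \<epsilon> \<le> r \<Longrightarrow> \<alpha> r = \<alpha> 1" using sitting_pathE[OF \<alpha> zero_less_one] by metis
  show ?thesis
  proof (rule sitting_pathI[OF _ _ e(1)])
    have "smooth_on real_line M {0..1} (\<lambda>r. \<alpha> (-1 * r + 1))"
      by (rule smooth_on_line_affine[OF M sitting_path_smooth[OF \<alpha>]]) auto
    then show "smooth_on real_line M {0..1} (rev_path \<alpha>)" by (rule smooth_on_cong) simp
    show "rev_path \<alpha> r = rev_path \<alpha> 0" if "0 \<le> r" "r \<le> 1" "r \<le> \<epsilon>" for r
      using that e(3)[of "1 - r"] by simp
    show "rev_path \<alpha> r = rev_path \<alpha> 1" if "0 \<le> r" "r \<le> 1" "1 - \<epsilon> \<le> r" for r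
      using that e(2)[of "1 - r"] by simp
  qed (auto simp: rev_path_def)
qed

lemma rev_rev_path: "\<alpha> \<in> sitting_paths M \<Longrightarrow> rev_path (rev_path \<alpha>) = \<alpha>"
  by (rule extensionalityI[of _ "{0..1}"]) (auto simp: sitting_paths_def rev_path_def)

text \<open>The concatenation is smooth at the junction because both paths are constant there.\<close>

lemma concat_path_sitting:
  assumes M: "charted M" and \<alpha>: "\<alpha> \<in> sitting_paths M" and \<beta>: "\<beta> \<in> sitting_paths M" and eq: "\<alpha> 1 = \<beta> 0"
  shows "concat_path \<beta> \<alpha> \<in> sitting_paths M"
proof -
  obtain \<epsilon> where e: "\<epsilon> > 0" "\<epsilon> \<le> 1/2" "\<And>r. 0 \<le> r \<Longrightarrow> r \<le> 1 \<Longrightarrow> r \<le> \<epsilon> \<Longrightarrow> \<alpha> r = \<alpha> 0"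
    "\<And>r. 0 \<le> r \<Longrightarrow> r \<le> 1 \<Longrightarrow> 1 - \<epsilon> \<le> r \<Longrightarrow> \<alpha> r = \<alpha> 1" using sitting_pathE[OF \<alpha> half_gt_zero[OF zero_less_one]] by metis
  obtain \<delta> where d: "\<delta> > 0" "\<delta> \<le> \<epsilon>" "\<And>r. 0 \<le> r \<Longrightarrow> r \<le> 1 \<Longrightarrow> r \<le> \<delta> \<Longrightarrow> \<beta> r = \<beta> 0"
    "\<And>r. 0 \<le> r \<Longrightarrow> r \<le> 1 \<Longrightarrow> 1 - \<delta> \<le> r \<Longrightarrow> \<beta> r = \<beta> 1" using sitting_pathE[OF \<beta> e(1)] by metis
  show ?thesis
  proof (rule sitting_pathI[of _ _ "\<delta> / 2"])
    show "smooth_on real_line M {0..1} (concat_path \<beta> \<alpha>)"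
    proof (rule smooth_on_local[OF charted_real_line])
      fix x :: real assume x: "x \<in> {0..1}"
      consider "x < 1/2" | "x > 1/2" | "x = 1/2" by linarith
      then show "\<exists>W. openin (mtop real_line) W \<and> x \<in> W \<and> smooth_on real_line M ({0..1} \<inter> W) (concat_path \<beta> \<alpha>)"
      proof cases
        case 1
        have "smooth_on real_line M ({0..1} \<inter> {..<1/2}) (\<lambda>r. \<alpha> (2 * r + 0))"
          by (rule smooth_on_line_affine[OF M sitting_path_smooth[OF \<alpha>]]) auto
        then have "smooth_on real_line M ({0..1} \<inter> {..<1/2}) (concat_path \<beta> \<alpha>)"
          by (rule smooth_on_cong) (auto simp: concat_path_apply)
        with 1 show ?thesis by (intro exI[of _ "{..<1/2}"]) auto
      next
        case 2
        have "smooth_on real_line M ({0..1} \<inter> {1/2<..}) (\<lambda>r. \<beta> (2 * r + -1))"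
          by (rule smooth_on_line_affine[OF M sitting_path_smooth[OF \<beta>]]) auto
        then have "smooth_on real_line M ({0..1} \<inter> {1/2<..}) (concat_path \<beta> \<alpha>)"
          by (rule smooth_on_cong) (auto simp: concat_path_apply)
        with 2 show ?thesis by (intro exI[of _ "{1/2<..}"]) auto
      next
        case 3
        let ?W = "{1/2 - \<delta>/2<..<1/2 + \<delta>/2}"
        have "smooth_on real_line M ({0..1} \<inter> ?W) (\<lambda>_. \<alpha> 1)"
          by (rule smooth_on_const[OF charted_real_line M _ sitting_path_mem[OF M \<alpha>]]) auto
        then have "smooth_on real_line M ({0..1} \<inter> ?W) (concat_path \<beta> \<alpha>)"
        proof (rule smooth_on_cong)
          fix r assume r: "r \<in> {0..1} \<inter> ?W"
          show "\<alpha> 1 = concat_path \<beta> \<alpha> r"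
            using r e(2) d(1,2) e(4)[of "2 * r"] d(3)[of "2 * r - 1"] eq by (auto simp: concat_path_apply)
        qed
        with 3 d(1) show ?thesis by (intro exI[of _ ?W]) auto
      qed
    qed
    show "concat_path \<beta> \<alpha> r = concat_path \<beta> \<alpha> 0" if "0 \<le> r" "r \<le> 1" "r \<le> \<delta> / 2" for r
      using that e(2) d(2) e(3)[of "2 * r"] by (simp add: concat_path_apply)
    show "concat_path \<beta> \<alpha> r = concat_path \<beta> \<alpha> 1" if "0 \<le> r" "r \<le> 1" "1 - \<delta> / 2 \<le> r" for r
      using that e(2) d(1,2) d(4)[of "2 * r - 1"] by (auto simp: concat_path_apply)
  qed (use d(1) in \<open>auto simp: concat_path_def\<close>)
qed

section \<open>Thin homotopies by reparametrisation\<close>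

text \<open>The conditions that a thin homotopy imposes on \<open>H\<close> itself; its values along the sides of the
  square are described separately by \<open>deforms\<close> below.\<close>

definition thin_square :: "'a manifold \<Rightarrow> (real \<times> real \<Rightarrow> 'a) \<Rightarrow> bool" where
  "thin_square M H \<longleftrightarrow> smooth_on plane M ({0..1} \<times> {0..1}) H \<and>
     (\<forall>x\<in>{0<..<1} \<times> {0<..<1}. differential_rank_le 1 plane M H x)"

text \<open>Smoothness on the closed square only provides local extensions. At interior points an extension
  coincides with \<open>H\<close> on a neighbourhood and therefore has the same differential.\<close>

lemma open_square_nbhd:
  assumes H: "smooth_on plane M ({0..1} \<times> {0..1}) H" and x: "x \<in> {0<..<1} \<times> {0<..<1}"
  obtains W g where "open W" "x \<in> W" "smooth_map plane M W g" "\<And>y. y \<in> W \<Longrightarrow> g y = H y"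
proof -
  have x': "x \<in> {0..1} \<times> {0..1}" using x by auto
  obtain W g where g: "x \<in> W" "smooth_map plane M W g" "\<And>y. y \<in> W \<Longrightarrow> y \<in> {0..1} \<times> {0..1} \<Longrightarrow> g y = H y"
    using smooth_onE[OF H x'] by metis
  have o: "open (W \<inter> {0<..<1} \<times> {0<..<1})"
    using smooth_map_open[OF g(2)] by (auto intro!: open_Int open_Times)
  then have "smooth_map plane M (W \<inter> {0<..<1} \<times> {0<..<1}) g"
    by (intro smooth_map_subset[OF charted_plane g(2)]) auto
  with o show ?thesis using x g by (intro that[of "W \<inter> {0<..<1} \<times> {0<..<1}" g]) auto
qed

text \<open>The map factors through the real line, so its differential has rank at most one.\<close>

lemma thin_square_path:
  assumes M: "charted M" and \<alpha>: "\<alpha> \<in> sitting_paths M"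
  shows "thin_square M (\<lambda>p. \<alpha> (snd p))"
  unfolding thin_square_def
proof (intro conjI ballI)
  have s: "smooth_map plane real_line W snd" if "open W" for W
    using that by (intro smooth_map_snd charted_real_line) simp
  show "smooth_on plane M ({0..1} \<times> {0..1}) (\<lambda>p. \<alpha> (snd p))"
    by (rule smooth_on_compose[OF charted_plane charted_real_line M
          smooth_on_of_map[OF s[OF open_UNIV]] sitting_path_smooth[OF \<alpha>]]) auto
  fix x :: "real \<times> real" assume x: "x \<in> {0<..<1} \<times> {0<..<1}"
  then have "snd x \<in> {0..1}" by auto
  then obtain W g where g: "snd x \<in> W" "smooth_map real_line M W g" "\<And>y. y \<in> W \<Longrightarrow> y \<in> {0..1} \<Longrightarrow> g y = \<alpha> y"
    using smooth_onE[OF sitting_path_smooth[OF \<alpha>]] by metis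
  have W: "open W" using smooth_map_open[OF g(2)] by simp
  have r: "differential_rank_le 1 plane M (g \<circ> snd) x"
    using differential_rank_le_mdim[of real_line M g]
    by (intro differential_rank_le_compose[OF charted_plane charted_real_line M s[OF open_UNIV] g(2)])
      (use g(1) in \<open>auto simp: mdim_real_line\<close>)
  show "differential_rank_le 1 plane M (\<lambda>p. \<alpha> (snd p)) x"
  proof (rule differential_rank_le_cong[OF charted_plane, of "UNIV \<times> (W \<inter> {0<..<1})", OF _ _ _ r])
    show "openin (mtop plane) (UNIV \<times> (W \<inter> {0<..<1}))" using W by (auto intro!: open_Times)
  qed (use x g in auto)
qed

text \<open>The rank of \<open>H\<close> is bounded on the open square only, whence the condition on the values of \<open>v\<close>.\<close>

lemma thin_square_compose:
  assumes M: "charted M" and H: "thin_square M H" and v: "smooth_map plane plane UNIV v"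
    and v1: "\<And>x. v x \<in> {0<..<1} \<times> {0<..<1}"
  shows "thin_square M (\<lambda>x. H (v x))"
  unfolding thin_square_def
proof (intro conjI ballI)
  have H1: "smooth_on plane M ({0..1} \<times> {0..1}) H" using H by (simp add: thin_square_def)
  show "smooth_on plane M ({0..1} \<times> {0..1}) (\<lambda>x. H (v x))"
  proof (rule smooth_on_compose[OF charted_plane charted_plane M smooth_on_of_map[OF v] H1])
    show "v x \<in> {0..1} \<times> {0..1}" for x using v1[of x] by (cases "v x") auto
  qed simp
  fix x :: "real \<times> real" assume "x \<in> {0<..<1} \<times> {0<..<1}"
  obtain W g where g: "open W" "v x \<in> W" "smooth_map plane M W g" "\<And>y. y \<in> W \<Longrightarrow> g y = H y"
    using open_square_nbhd[OF H1 v1[of x]] by metis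
  have "differential_rank_le 1 plane M g (v x)"
  proof (rule differential_rank_le_cong[OF charted_plane])
    show "differential_rank_le 1 plane M H (v x)" 
      by (rule bspec[OF conjunct2[OF H[unfolded thin_square_def]] v1[of x]])
    show "openin (mtop plane) W" using g(1) by simp
    show "H y = g y" if "y \<in> W" for y using g(4)[OF that] by simp
  qed (rule g(2))
  then have r: "differential_rank_le 1 plane M (g \<circ> v) x"
    by (intro differential_rank_le_compose[OF charted_plane charted_plane M v g(3)]) (use g(2) in auto)
  show "differential_rank_le 1 plane M (\<lambda>x. H (v x)) x"
  proof (rule differential_rank_le_cong[OF charted_plane, of "{y\<in>UNIV. v y \<in> W}", OF _ _ _ r])
    show "openin (mtop plane) {y\<in>UNIV. v y \<in> W}"
      by (rule smooth_map_vimage_open[OF charted_plane charted_plane v]) (simp add: g(1))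
  qed (use g in auto)
qed

lemma thin_homotopicI:
  assumes "\<alpha> \<in> sitting_paths M" "\<beta> \<in> sitting_paths M" "thin_square M H" "\<epsilon> > 0"
    "\<And>q r. 0 \<le> q \<Longrightarrow> q \<le> 1 \<Longrightarrow> 0 \<le> r \<Longrightarrow> r \<le> 1 \<Longrightarrow> q \<le> \<epsilon> \<Longrightarrow> H (q, r) = \<alpha> r"
    "\<And>q r. 0 \<le> q \<Longrightarrow> q \<le> 1 \<Longrightarrow> 0 \<le> r \<Longrightarrow> r \<le> 1 \<Longrightarrow> 1 - \<epsilon> \<le> q \<Longrightarrow> H (q, r) = \<beta> r"
    "\<And>q r. 0 \<le> q \<Longrightarrow> q \<le> 1 \<Longrightarrow> 0 \<le> r \<Longrightarrow> r \<le> 1 \<Longrightarrow> r \<le> \<epsilon> \<Longrightarrow> H (q, r) = \<alpha> 0"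
    "\<And>q r. 0 \<le> q \<Longrightarrow> q \<le> 1 \<Longrightarrow> 0 \<le> r \<Longrightarrow> r \<le> 1 \<Longrightarrow> 1 - \<epsilon> \<le> r \<Longrightarrow> H (q, r) = \<alpha> 1"
  shows "thin_homotopic M \<alpha> \<beta>"
  unfolding thin_homotopic_def
proof (intro conjI exI[of _ H] exI[of _ \<epsilon>])
  show "\<forall>q\<in>{0..1}. \<forall>r\<in>{0..1}.
           (q \<le> \<epsilon> \<longrightarrow> H (q, r) = \<alpha> r) \<and> (1 - \<epsilon> \<le> q \<longrightarrow> H (q, r) = \<beta> r) \<and>
           (r \<le> \<epsilon> \<longrightarrow> H (q, r) = \<alpha> 0) \<and> (1 - \<epsilon> \<le> r \<longrightarrow> H (q, r) = \<alpha> 1)"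
    by (intro ballI conjI impI assms(5-8)) simp_all
qed (use assms(1-4) in \<open>simp_all add: thin_square_def\<close>)

definition deforms :: "real \<Rightarrow> (real \<times> real \<Rightarrow> 'a) \<Rightarrow> (real \<Rightarrow> 'a) \<Rightarrow> (real \<Rightarrow> 'a) \<Rightarrow> bool" where
  "deforms \<epsilon> H \<alpha> \<beta> \<longleftrightarrow> (\<forall>q\<in>{0..1}. \<forall>r\<in>{0..1}.
           (q \<le> \<epsilon> \<longrightarrow> H (q, r) = \<alpha> r) \<and> (1 - \<epsilon> \<le> q \<longrightarrow> H (q, r) = \<beta> r) \<and>
           (r \<le> \<epsilon> \<longrightarrow> H (q, r) = \<alpha> 0) \<and> (1 - \<epsilon> \<le> r \<longrightarrow> H (q, r) = \<alpha> 1))"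

lemma deformsD:
  assumes "deforms \<epsilon> H \<alpha> \<beta>" "0 \<le> q" "q \<le> 1" "0 \<le> r" "r \<le> 1"
  shows "q \<le> \<epsilon> \<Longrightarrow> H (q, r) = \<alpha> r" "1 - \<epsilon> \<le> q \<Longrightarrow> H (q, r) = \<beta> r"
    "r \<le> \<epsilon> \<Longrightarrow> H (q, r) = \<alpha> 0" "1 - \<epsilon> \<le> r \<Longrightarrow> H (q, r) = \<alpha> 1"
proof -
  have *: "(q \<le> \<epsilon> \<longrightarrow> H (q, r) = \<alpha> r) \<and> (1 - \<epsilon> \<le> q \<longrightarrow> H (q, r) = \<beta> r) \<and>
           (r \<le> \<epsilon> \<longrightarrow> H (q, r) = \<alpha> 0) \<and> (1 - \<epsilon> \<le> r \<longrightarrow> H (q, r) = \<alpha> 1)"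
    using assms unfolding deforms_def by simp
  then show "q \<le> \<epsilon> \<Longrightarrow> H (q, r) = \<alpha> r" "1 - \<epsilon> \<le> q \<Longrightarrow> H (q, r) = \<beta> r"
    "r \<le> \<epsilon> \<Longrightarrow> H (q, r) = \<alpha> 0" "1 - \<epsilon> \<le> r \<Longrightarrow> H (q, r) = \<alpha> 1" by blast+
qed

lemma thin_homotopicE:
  assumes "thin_homotopic M \<alpha> \<beta>" "b > 0"
  obtains H \<epsilon> where "thin_square M H" "\<epsilon> > 0" "\<epsilon> \<le> b" "deforms \<epsilon> H \<alpha> \<beta>"
proof -
  from assms(1) obtain H \<epsilon> where H: "thin_square M H" "\<epsilon> > 0" "deforms \<epsilon> H \<alpha> \<beta>"
    unfolding thin_homotopic_def thin_square_def deforms_def by blast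
  have "deforms (min \<epsilon> b) H \<alpha> \<beta>"
    unfolding deforms_def
  proof (intro ballI)
    fix q r :: real assume "q \<in> {0..1}" "r \<in> {0..1}"
    then have "0 \<le> q" "q \<le> 1" "0 \<le> r" "r \<le> 1" by auto
    note * = deformsD[OF H(3) this]
    show "(q \<le> min \<epsilon> b \<longrightarrow> H (q, r) = \<alpha> r) \<and> (1 - min \<epsilon> b \<le> q \<longrightarrow> H (q, r) = \<beta> r) \<and>
           (r \<le> min \<epsilon> b \<longrightarrow> H (q, r) = \<alpha> 0) \<and> (1 - min \<epsilon> b \<le> r \<longrightarrow> H (q, r) = \<alpha> 1)"
      by (intro conjI impI *) simp_all
  qed
  with H show ?thesis using assms(2) by (intro that[of H "min \<epsilon> b"]) simp_all
qed

lemma thin_homotopic_ends: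
  assumes "thin_homotopic M \<alpha> \<beta>" shows "\<beta> 0 = \<alpha> 0" "\<beta> 1 = \<alpha> 1"
proof -
  obtain H \<epsilon> where H: "\<epsilon> > 0" "deforms \<epsilon> H \<alpha> \<beta>"
    using thin_homotopicE[OF assms zero_less_one] by blast
  show "\<beta> 0 = \<alpha> 0" using deformsD(2,3)[OF H(2), of 1 0] H(1) by simp
  show "\<beta> 1 = \<alpha> 1" using deformsD(2,4)[OF H(2), of 1 1] H(1) by simp
qed

lemma thin_homotopic_refl:
  assumes M: "charted M" and \<alpha>: "\<alpha> \<in> sitting_paths M" shows "thin_homotopic M \<alpha> \<alpha>"
proof -
  obtain \<epsilon> where e: "\<epsilon> > 0" "\<And>r. 0 \<le> r \<Longrightarrow> r \<le> 1 \<Longrightarrow> r \<le> \<epsilon> \<Longrightarrow> \<alpha> r = \<alpha> 0"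
    "\<And>r. 0 \<le> r \<Longrightarrow> r \<le> 1 \<Longrightarrow> 1 - \<epsilon> \<le> r \<Longrightarrow> \<alpha> r = \<alpha> 1" using sitting_pathE[OF \<alpha> zero_less_one] by metis
  show ?thesis
  proof (rule thin_homotopicI[OF \<alpha> \<alpha> thin_square_path[OF M \<alpha>] e(1)])
    fix q r :: real assume r: "0 \<le> r" "r \<le> 1"
    show "\<alpha> (snd (q, r)) = \<alpha> 0" if "r \<le> \<epsilon>" using e(2)[OF r that] by simp
    show "\<alpha> (snd (q, r)) = \<alpha> 1" if "1 - \<epsilon> \<le> r" using e(3)[OF r that] by simp
  qed simp_all
qed

lemma sitting_squeeze:
  assumes a: "0 < a" "a \<le> 1/4" and "2 * a \<le> \<epsilon>"
    and l: "\<forall>r. 0 \<le> r \<longrightarrow> r \<le> 1 \<longrightarrow> r \<le> \<epsilon> \<longrightarrow> \<alpha> r = \<alpha> (0::real)"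
    and g: "\<forall>r. 0 \<le> r \<longrightarrow> r \<le> 1 \<longrightarrow> 1 - \<epsilon> \<le> r \<longrightarrow> \<alpha> r = \<alpha> 1"
  shows "0 \<le> r \<Longrightarrow> r \<le> 1 \<Longrightarrow> \<alpha> (squeeze a r) = \<alpha> r"
    "r \<le> 2 * a \<Longrightarrow> \<alpha> (squeeze a r) = \<alpha> 0" "1 - 2 * a \<le> r \<Longrightarrow> \<alpha> (squeeze a r) = \<alpha> 1"
proof -
  note s = squeeze[OF a]
  show 1: "r \<le> 2 * a \<Longrightarrow> \<alpha> (squeeze a r) = \<alpha> 0"
    using s(1,2,4)[of r] assms(1-3) by (intro l[rule_format]) auto
  show 2: "1 - 2 * a \<le> r \<Longrightarrow> \<alpha> (squeeze a r) = \<alpha> 1"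
    using s(1,2,5)[of r] assms(1-3) by (intro g[rule_format]) auto
  show "\<alpha> (squeeze a r) = \<alpha> r" if "0 \<le> r" "r \<le> 1"
  proof -
    consider "r \<le> 2 * a" | "1 - 2 * a \<le> r" | "2 * a \<le> r" "r \<le> 1 - 2 * a" by linarith
    then show ?thesis
    proof cases
      case 1 with \<open>r \<le> 2 * a \<Longrightarrow> \<alpha> (squeeze a r) = \<alpha> 0\<close> l[rule_format, OF that] assms(3) show ?thesis by simp
    next
      case 2 with \<open>1 - 2 * a \<le> r \<Longrightarrow> \<alpha> (squeeze a r) = \<alpha> 1\<close> g[rule_format, OF that] assms(3) show ?thesis by simp
    next
      case 3 then show ?thesis by (simp add: s(3))
    qed
  qed
qed

text \<open>Up to truncation the path on the right is \<open>r \<mapsto> \<beta> (4r - 1)\<close>, since \<open>\<beta>\<close> occupies the interval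
  \<open>[1/4, 1/2]\<close>. The given homotopy is composed with an interpolation between \<open>r\<close> and \<open>4r - 1\<close>;
  near \<open>0\<close> neither exceeds \<open>r\<close> and near \<open>1\<close> neither is below it, so the sitting instants survive.\<close>

lemma thin_homotopic_pad:
  assumes M: "charted M" and h: "thin_homotopic M \<alpha> \<beta>"
  shows "thin_homotopic M \<alpha> (concat_path (const_path (\<beta> 1)) (concat_path \<beta> (const_path (\<beta> 0))))"
proof -
  obtain H \<epsilon> where H: "thin_square M H" "\<epsilon> > 0" "\<epsilon> \<le> 1/4" and d: "deforms \<epsilon> H \<alpha> \<beta>"
    using thin_homotopicE[OF h, of "1/4"] by auto
  note ends = thin_homotopic_ends[OF h]
  have sit: "\<alpha> \<in> sitting_paths M" "\<beta> \<in> sitting_paths M" using h by (auto simp: thin_homotopic_def)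
  have c: "const_path (\<beta> 0) \<in> sitting_paths M" "const_path (\<beta> 1) \<in> sitting_paths M"
    by (rule const_path_sitting[OF M sitting_path_mem[OF M sit(2)]]; simp)+
  define a where "a = \<epsilon> / 2"
  have a: "0 < a" "a \<le> 1/4" "2 * a \<le> \<epsilon>" using H(2,3) by (auto simp: a_def)
  note s = squeeze[OF a(1,2)]
  have al: "\<alpha> r = \<alpha> 0" if "0 \<le> r" "r \<le> 1" "r \<le> \<epsilon>" for r
    using deformsD(1,3)[OF d, of 0 r] that H(2) by simp
  have ar: "\<alpha> r = \<alpha> 1" if "0 \<le> r" "r \<le> 1" "1 - \<epsilon> \<le> r" for r
    using deformsD(1,4)[OF d, of 0 r] that H(2) by simp
  have bl: "\<beta> r = \<beta> 0" if "0 \<le> r" "r \<le> 1" "r \<le> \<epsilon>" for r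
    using deformsD(2,3)[OF d, of 1 r] that H(2) ends by simp
  have br: "\<beta> r = \<beta> 1" if "0 \<le> r" "r \<le> 1" "1 - \<epsilon> \<le> r" for r
    using deformsD(2,4)[OF d, of 1 r] that H(2) ends by simp
  have \<alpha>s: "\<alpha> (squeeze a r) = \<alpha> r" if "0 \<le> r" "r \<le> 1" for r
    by (rule sitting_squeeze(1)[OF a _ _ that]) (use al ar in blast)+
  have \<beta>s: "0 \<le> r \<Longrightarrow> r \<le> 1 \<Longrightarrow> \<beta> (squeeze a r) = \<beta> r"
    "r \<le> 2 * a \<Longrightarrow> \<beta> (squeeze a r) = \<beta> 0" "1 - 2 * a \<le> r \<Longrightarrow> \<beta> (squeeze a r) = \<beta> 1" for r
    by (rule sitting_squeeze[OF a, of \<beta>]; use bl br in blast)+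
  (* The interpolation between r, for q below 1/3, and 4r - 1, for q above 2/3. *)
  define t where "t q = smooth_step (3 * q - 1)" for q :: real
  define u where "u q r = r + t q * (3 * r - 1)" for q r :: real
  define v where "v p = (squeeze a (fst p), squeeze a (u (fst p) (snd p)))" for p :: "real \<times> real"
  have t: "0 \<le> t q" "t q \<le> 1" "q \<le> 1/3 \<Longrightarrow> t q = 0" "2/3 \<le> q \<Longrightarrow> t q = 1" for q
    by (auto simp: t_def smooth_step_bounds smooth_step_0 smooth_step_1)
  have v: "smooth_map plane plane UNIV v"
    unfolding v_def
  proof (intro smooth_map_pair charted_plane charted_real_line smooth_map_plane_real)
    fix n U g h assume gh: "smooth_fun n U g" "smooth_fun n U h"
    note o = smooth_fun_open[OF gh(1)]
    show "smooth_fun n U (\<lambda>z. squeeze a (fst (g z, h z)))" using smooth_fun_squeeze[OF gh(1)] by simp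
    have "smooth_fun n U (\<lambda>z. squeeze a (h z + smooth_step (3 * g z - 1) * (3 * h z - 1)))"
      by (intro smooth_fun_squeeze smooth_fun_add smooth_fun_mult smooth_fun_diff smooth_fun_step
          smooth_fun_const gh o)
    then show "smooth_fun n U (\<lambda>z. squeeze a (u (fst (g z, h z)) (snd (g z, h z))))"
      by (simp add: u_def t_def)
  qed
  have v1: "v p \<in> {0<..<1} \<times> {0<..<1}" for p
    using s(1,2)[of "fst p"] s(1,2)[of "u (fst p) (snd p)"] a by (auto simp: v_def)
  have sq: "0 \<le> squeeze a x" "squeeze a x \<le> 1" for x using s(1,2)[of x] a by auto
  have ul: "u q r \<le> 2 * a" if "r \<le> 2 * a" for q r
  proof -
    have "t q * (3 * r - 1) \<le> 0" using that a t(1)[of q] H(3)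
      by (intro mult_nonneg_nonpos) (auto simp: a_def)
    then show ?thesis using that by (simp add: u_def)
  qed
  have ug: "1 - 2 * a \<le> u q r" if "1 - 2 * a \<le> r" for q r
  proof -
    have "t q * (3 * r - 1) \<ge> 0" using that a t(1)[of q] H(3)
      by (intro mult_nonneg_nonneg) (auto simp: a_def)
    then show ?thesis using that by (simp add: u_def)
  qed
  show ?thesis
  proof (rule thin_homotopicI[OF sit(1) _ thin_square_compose[OF M H(1) v v1], of _ "2 * a"])
    show "concat_path (const_path (\<beta> 1)) (concat_path \<beta> (const_path (\<beta> 0))) \<in> sitting_paths M"
      by (intro concat_path_sitting M c sit) auto
    show "0 < 2 * a" using a by simp
    fix q r :: real assume q: "0 \<le> q" "q \<le> 1" and r: "0 \<le> r" "r \<le> 1"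
    show "H (v (q, r)) = \<alpha> r" if "q \<le> 2 * a"
    proof -
      have "H (v (q, r)) = \<alpha> (squeeze a (u q r))"
        unfolding v_def fst_conv snd_conv using s(4)[OF that] a(3) by (intro deformsD(1)[OF d] sq q r) auto
      also have "u q r = r" using that H(3) by (simp add: u_def t(3) a_def)
      finally show ?thesis using \<alpha>s[OF r] by simp
    qed
    show "H (v (q, r)) = concat_path (const_path (\<beta> 1)) (concat_path \<beta> (const_path (\<beta> 0))) r" if "1 - 2 * a \<le> q"
    proof -
      have "H (v (q, r)) = \<beta> (squeeze a (u q r))"
        unfolding v_def fst_conv snd_conv using s(5)[OF that] a(3) by (intro deformsD(2)[OF d] sq q r) auto
      also have u: "u q r = 4 * r - 1" using that H(3) by (simp add: u_def t(4) a_def)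
      finally have H': "H (v (q, r)) = \<beta> (squeeze a (4 * r - 1))" .
      consider "r \<le> 1/4" | "1/4 < r" "r \<le> 1/2" | "r > 1/2" by linarith
      then show ?thesis
      proof cases
        case 1
        then show ?thesis unfolding H' using r a \<beta>s(2)[of "4 * r - 1"] by (simp add: concat_path_apply)
      next
        case 2
        then show ?thesis unfolding H' using r \<beta>s(1)[of "4 * r - 1"] by (simp add: concat_path_apply)
      next
        case 3
        then show ?thesis unfolding H' using r a \<beta>s(3)[of "4 * r - 1"] by (simp add: concat_path_apply)
      qed
    qed
    show "H (v (q, r)) = \<alpha> 0" if "r \<le> 2 * a"
      unfolding v_def fst_conv snd_conv using s(4)[OF ul[OF that, of q]] a(3) by (intro deformsD(3)[OF d] sq q r) auto
    show "H (v (q, r)) = \<alpha> 1" if "1 - 2 * a \<le> r"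
      unfolding v_def fst_conv snd_conv using s(5)[OF ug[OF that, of q]] a(3) by (intro deformsD(4)[OF d] sq q r) auto
  qed
qed

text \<open>The path runs along \<open>\<alpha>\<close> with the parameter first rising and then falling. Because \<open>\<alpha>\<close> has
  sitting instants, the parameter can be taken to be a smooth function \<open>w\<close> which is constant around
  \<open>1/2\<close>, and contracting \<open>w\<close> to its least value contracts the path.\<close>

lemma thin_homotopic_cancel:
  assumes M: "charted M" and \<alpha>: "\<alpha> \<in> sitting_paths M"
  shows "thin_homotopic M (concat_path (rev_path \<alpha>) \<alpha>) (const_path (\<alpha> 0))"
proof -
  obtain \<epsilon> where e: "\<epsilon> > 0" "\<epsilon> \<le> 1/4" "\<And>r. 0 \<le> r \<Longrightarrow> r \<le> 1 \<Longrightarrow> r \<le> \<epsilon> \<Longrightarrow> \<alpha> r = \<alpha> 0"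
    "\<And>r. 0 \<le> r \<Longrightarrow> r \<le> 1 \<Longrightarrow> 1 - \<epsilon> \<le> r \<Longrightarrow> \<alpha> r = \<alpha> 1" using sitting_pathE[OF \<alpha>, of "1/4"] by (metis zero_less_divide_1_iff zero_less_numeral)
  define a where "a = \<epsilon> / 2"
  have a: "0 < a" "a \<le> 1/4" "2 * a \<le> \<epsilon>" using e(1,2) by (auto simp: a_def)
  note s = squeeze[OF a(1,2)]
  have \<alpha>s: "\<alpha> (squeeze a r) = \<alpha> r" if "0 \<le> r" "r \<le> 1" for r
    by (rule sitting_squeeze(1)[OF a _ _ that]) (use e(3,4) in blast)+
  define t where "t q = smooth_step (3 * q - 1)" for q :: real
  have t: "0 \<le> t q" "t q \<le> 1" "q \<le> 1/3 \<Longrightarrow> t q = 0" "2/3 \<le> q \<Longrightarrow> t q = 1" for q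
    by (auto simp: t_def smooth_step_bounds smooth_step_0 smooth_step_1)
  (* On either half one of the two terms equals 1 - a, which is subtracted again; the sum is smooth
     at 1/2 because it needs no case distinction. *)
  define w where "w r = squeeze a (2 * r) + squeeze a (2 - 2 * r) - (1 - a)" for r
  define u where "u q r = w r + t q * (a - w r)" for q r
  define v where "v p = (1/2 :: real, u (fst p) (snd p))" for p :: "real \<times> real"
  have w: "r \<le> 1/2 \<Longrightarrow> w r = squeeze a (2 * r)" "r \<ge> 1/2 \<Longrightarrow> w r = squeeze a (2 - 2 * r)" for r
    using s(7)[of "2 * r"] s(7)[of "2 - 2 * r"] a by (auto simp: w_def)
  have w1: "a \<le> w r" "w r \<le> 1 - a" for r
    using s(1,2) w[of r] by (cases "r \<le> 1/2"; simp)+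
  have u1: "a \<le> u q r" "u q r \<le> w r" for q r
  proof -
    have "t q * (w r - a) \<le> 1 * (w r - a)" using t(1,2)[of q] w1[of r] by (intro mult_right_mono) auto
    then show "a \<le> u q r" by (simp add: u_def algebra_simps)
    have "t q * (a - w r) \<le> 0" using t(1)[of q] w1[of r] by (intro mult_nonneg_nonpos) auto
    then show "u q r \<le> w r" by (simp add: u_def)
  qed
  have v: "smooth_map plane plane UNIV v"
    unfolding v_def
  proof (intro smooth_map_pair charted_plane charted_real_line smooth_map_plane_real)
    fix n U g h assume gh: "smooth_fun n U g" "smooth_fun n U h"
    note o = smooth_fun_open[OF gh(1)]
    show "smooth_fun n U (\<lambda>z. 1/2)" by (rule smooth_fun_const[OF o])
    have "smooth_fun n U (\<lambda>z. squeeze a (2 * h z) + squeeze a (2 - 2 * h z) - (1 - a))"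
      by (intro smooth_fun_squeeze smooth_fun_add smooth_fun_mult smooth_fun_diff smooth_fun_const gh o)
    then have "smooth_fun n U (\<lambda>z. w (h z))" by (simp add: w_def)
    then have "smooth_fun n U (\<lambda>z. w (h z) + smooth_step (3 * g z - 1) * (a - w (h z)))"
      by (intro smooth_fun_add smooth_fun_mult smooth_fun_diff smooth_fun_step smooth_fun_const gh o)
    then show "smooth_fun n U (\<lambda>z. u (fst (g z, h z)) (snd (g z, h z)))"
      by (simp add: u_def t_def)
  qed
  have v1: "v p \<in> {0<..<1} \<times> {0<..<1}" for p
    using u1[of "fst p" "snd p"] w1[of "snd p"] a by (auto simp: v_def)
  have small: "\<alpha> (u q r) = \<alpha> 0" if "w r \<le> 2 * a" for q r
    using u1[of q r] w1[of r] that a by (intro e(3)) auto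
  show ?thesis
  proof (rule thin_homotopicI[OF _ _ thin_square_compose[OF M thin_square_path[OF M \<alpha>] v v1], of _ _ a])
    show "concat_path (rev_path \<alpha>) \<alpha> \<in> sitting_paths M"
      by (intro concat_path_sitting M \<alpha> rev_path_sitting) simp
    show "const_path (\<alpha> 0) \<in> sitting_paths M"
      by (rule const_path_sitting[OF M sitting_path_mem[OF M \<alpha>]]) auto
    fix q r :: real assume q: "0 \<le> q" "q \<le> 1" and r: "0 \<le> r" "r \<le> 1"
    show "\<alpha> (snd (v (q, r))) = concat_path (rev_path \<alpha>) \<alpha> r" if "q \<le> a"
    proof -
      have "\<alpha> (snd (v (q, r))) = \<alpha> (w r)" using that a by (simp add: v_def u_def t(3))
      also have "\<dots> = concat_path (rev_path \<alpha>) \<alpha> r"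
        using r w[of r] \<alpha>s[of "2 * r"] \<alpha>s[of "2 - 2 * r"] by (simp add: concat_path_apply algebra_simps)
      finally show ?thesis .
    qed
    show "\<alpha> (snd (v (q, r))) = const_path (\<alpha> 0) r" if "1 - a \<le> q"
      using that a e(3)[of a] r by (simp add: v_def u_def t(4))
    show "\<alpha> (snd (v (q, r))) = concat_path (rev_path \<alpha>) \<alpha> 0" if "r \<le> a"
      using small[of r q] w(1)[of r] s(4)[of "2 * r"] that a by (simp add: v_def)
    show "\<alpha> (snd (v (q, r))) = concat_path (rev_path \<alpha>) \<alpha> 1" if "1 - a \<le> r"
      using small[of r q] w(2)[of r] s(4)[of "2 - 2 * r"] that a by (simp add: v_def)
  qed (rule a(1))
qed

section \<open>Lazy paths\<close>

text \<open>The set \<open>lazy_paths\<close> in recursive form, for inductions that peel off the first arrow and path.\<close>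

fun lazy_list :: "'o manifold \<Rightarrow> ('o, 'm) groupoid_structure \<Rightarrow> 'm list \<Rightarrow> (real \<Rightarrow> 'o) list \<Rightarrow> bool" where
  "lazy_list X0 G [g] [] \<longleftrightarrow> g \<in> mor G"
| "lazy_list X0 G (g # h # \<gamma>s) (\<alpha> # \<alpha>s) \<longleftrightarrow> g \<in> mor G \<and> \<alpha> \<in> sitting_paths X0 \<and>
     tgt G g = \<alpha> 0 \<and> src G h = \<alpha> 1 \<and> lazy_list X0 G (h # \<gamma>s) \<alpha>s"
| "lazy_list X0 G _ _ \<longleftrightarrow> False"

lemma lazy_list_length: "lazy_list X0 G \<gamma>s \<alpha>s \<Longrightarrow> length \<gamma>s = Suc (length \<alpha>s)"
  by (induction X0 G \<gamma>s \<alpha>s rule: lazy_list.induct) auto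

lemma all_less_Suc_split: "(\<forall>i<Suc n. P i) \<longleftrightarrow> P 0 \<and> (\<forall>i<n. P (Suc i))"
  by (metis less_Suc_eq_0_disj)

lemma lazy_paths_iff: "(\<gamma>s, \<alpha>s) \<in> lazy_paths X0 G \<longleftrightarrow> lazy_list X0 G \<gamma>s \<alpha>s"
proof (induction X0 G \<gamma>s \<alpha>s rule: lazy_list.induct)
  case (2 X0 G g h \<gamma>s \<alpha> \<alpha>s)
  then show ?case by (auto simp: lazy_paths_def all_less_Suc_split)
qed (auto simp: lazy_paths_def)

lemma lazy_list_append:
  "length \<gamma>s = length \<alpha>s \<Longrightarrow> lazy_list X0 G (\<gamma>s @ g # \<gamma>s') (\<alpha>s @ \<alpha>s') \<longleftrightarrow>
     lazy_list X0 G (\<gamma>s @ [g]) \<alpha>s \<and> lazy_list X0 G (g # \<gamma>s') \<alpha>s'"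
proof (induction \<gamma>s \<alpha>s rule: list_induct2)
  case Nil
  then show ?case by (cases \<gamma>s'; cases \<alpha>s') auto
next
  case (Cons x xs a as)
  then show ?case by (cases xs) auto
qed

lemma lazy_list_mor: "lazy_list X0 G \<gamma>s \<alpha>s \<Longrightarrow> set \<gamma>s \<subseteq> mor G"
  using lazy_paths_iff[of \<gamma>s \<alpha>s X0 G] by (simp add: lazy_paths_def)

lemma lazy_list_change_last:
  "lazy_list X0 G (\<gamma>s @ [g]) \<alpha>s \<Longrightarrow> g' \<in> mor G \<Longrightarrow> src G g' = src G g \<Longrightarrow> lazy_list X0 G (\<gamma>s @ [g']) \<alpha>s"
proof (induction \<gamma>s arbitrary: \<alpha>s)
  case Nil
  then show ?case by (cases \<alpha>s) auto
next
  case (Cons x xs)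
  then show ?case by (cases \<alpha>s; cases xs) auto
qed

lemma lazy_list_change_first:
  "lazy_list X0 G (g # \<gamma>s) \<alpha>s \<Longrightarrow> g' \<in> mor G \<Longrightarrow> tgt G g' = tgt G g \<Longrightarrow> lazy_list X0 G (g' # \<gamma>s) \<alpha>s"
  by (cases \<alpha>s; cases \<gamma>s) auto

lemma lazy_cmp_append [simp]:
  "lazy_cmp G (d # ds, \<beta>s) (\<gamma>s @ [g], \<alpha>s) = (\<gamma>s @ cmp G d g # ds, \<alpha>s @ \<beta>s)"
  by (simp add: lazy_cmp_def)

lemma lazy_src_Cons [simp]: "lazy_src G (g # \<gamma>s, \<alpha>s) = src G g"
  by (simp add: lazy_src_def)

lemma lazy_tgt_append [simp]: "lazy_tgt G (\<gamma>s @ [g], \<alpha>s) = tgt G g"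
  by (simp add: lazy_tgt_def)

context groupoid
begin

lemma composableI: "h \<in> mor G \<Longrightarrow> g \<in> mor G \<Longrightarrow> src G h = tgt G g \<Longrightarrow> (h, g) \<in> composable G"
  by (simp add: composable_def)

lemma cmp_facts:
  assumes "h \<in> mor G" "g \<in> mor G" "src G h = tgt G g"
  shows "cmp G h g \<in> mor G" "src G (cmp G h g) = src G g" "tgt G (cmp G h g) = tgt G h"
  using composableI[OF assms] cmp_mor src_cmp tgt_cmp by blast+

lemma assoc:
  "k \<in> mor G \<Longrightarrow> h \<in> mor G \<Longrightarrow> g \<in> mor G \<Longrightarrow> src G k = tgt G h \<Longrightarrow> src G h = tgt G g \<Longrightarrow>
     cmp G (cmp G k h) g = cmp G k (cmp G h g)"
  by (intro cmp_assoc composableI)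

lemma ivs_ivs:
  assumes g: "g \<in> mor G" shows "ivs G (ivs G g) = g"
proof -
  let ?i = "ivs G g"
  have i: "?i \<in> mor G" "src G ?i = tgt G g" "tgt G ?i = src G g"
    using g by (simp_all add: ivs_mor src_ivs tgt_ivs)
  have j: "ivs G ?i \<in> mor G" "src G (ivs G ?i) = src G g" "tgt G (ivs G ?i) = tgt G g"
    using i by (simp_all add: ivs_mor src_ivs tgt_ivs)
  have "ivs G ?i = cmp G (ivs G ?i) (unt G (src G g))" using cmp_unt_right[OF j(1)] j(2) by simp
  also have "\<dots> = cmp G (ivs G ?i) (cmp G ?i g)" using cmp_ivs_left[OF g] by simp
  also have "\<dots> = cmp G (cmp G (ivs G ?i) ?i) g" using assoc[OF j(1) i(1) g] i j by simp
  also have "\<dots> = g" using cmp_ivs_left[OF i(1)] i cmp_unt_left[OF g] by simp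
  finally show ?thesis .
qed

abbreviation lazy_cat (infixr "\<odot>" 70) where
  "\<Delta> \<odot> \<Gamma> \<equiv> lazy_cmp G \<Delta> \<Gamma>"

lemma lazy_splitE_last:
  assumes "\<Gamma> \<in> lazy_paths X0 G"
  obtains \<gamma>s g \<alpha>s where "\<Gamma> = (\<gamma>s @ [g], \<alpha>s)" "lazy_list X0 G (\<gamma>s @ [g]) \<alpha>s" "length \<gamma>s = length \<alpha>s" "g \<in> mor G"
proof -
  obtain \<gamma>s' \<alpha>s where \<Gamma>: "\<Gamma> = (\<gamma>s', \<alpha>s)" by (cases \<Gamma>)
  then have l: "lazy_list X0 G \<gamma>s' \<alpha>s" using assms by (simp add: lazy_paths_iff)
  then have "\<gamma>s' \<noteq> []" using lazy_list_length by fastforce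
  then obtain \<gamma>s g where \<gamma>s': "\<gamma>s' = \<gamma>s @ [g]" by (metis rev_exhaust)
  show ?thesis using that[of \<gamma>s g \<alpha>s] \<Gamma> l lazy_list_length[OF l] lazy_list_mor[OF l] \<gamma>s' by simp
qed

lemma lazy_splitE_first:
  assumes "\<Gamma> \<in> lazy_paths X0 G"
  obtains \<gamma>s g \<alpha>s where "\<Gamma> = (g # \<gamma>s, \<alpha>s)" "lazy_list X0 G (g # \<gamma>s) \<alpha>s" "length \<gamma>s = length \<alpha>s" "g \<in> mor G"
proof -
  obtain \<gamma>s' \<alpha>s where \<Gamma>: "\<Gamma> = (\<gamma>s', \<alpha>s)" by (cases \<Gamma>)
  then have l: "lazy_list X0 G \<gamma>s' \<alpha>s" using assms by (simp add: lazy_paths_iff)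
  then obtain \<gamma>s g where \<gamma>s': "\<gamma>s' = g # \<gamma>s" using lazy_list_length by (cases \<gamma>s') fastforce+
  show ?thesis using that[of g \<gamma>s \<alpha>s] \<Gamma> l lazy_list_length[OF l] lazy_list_mor[OF l] \<gamma>s' by simp
qed

lemma lazy_cmp_facts:
  assumes \<Delta>: "\<Delta> \<in> lazy_paths X0 G" and \<Gamma>: "\<Gamma> \<in> lazy_paths X0 G" and c: "lazy_src G \<Delta> = lazy_tgt G \<Gamma>"
  shows "\<Delta> \<odot> \<Gamma> \<in> lazy_paths X0 G" "lazy_src G (\<Delta> \<odot> \<Gamma>) = lazy_src G \<Gamma>" "lazy_tgt G (\<Delta> \<odot> \<Gamma>) = lazy_tgt G \<Delta>"
proof -
  obtain \<gamma>s g \<alpha>s where g: "\<Gamma> = (\<gamma>s @ [g], \<alpha>s)" "lazy_list X0 G (\<gamma>s @ [g]) \<alpha>s" "length \<gamma>s = length \<alpha>s" "g \<in> mor G"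
    by (rule lazy_splitE_last[OF \<Gamma>])
  obtain ds d \<beta>s where d: "\<Delta> = (d # ds, \<beta>s)" "lazy_list X0 G (d # ds) \<beta>s" "length ds = length \<beta>s" "d \<in> mor G"
    by (rule lazy_splitE_first[OF \<Delta>])
  have "src G d = tgt G g" using c g(1) d(1) by simp
  note f = cmp_facts[OF d(4) g(4) this]
  show "\<Delta> \<odot> \<Gamma> \<in> lazy_paths X0 G"
    using lazy_list_change_last[OF g(2) f(1,2)] lazy_list_change_first[OF d(2) f(1,3)]
    by (simp add: g(1) d(1) lazy_paths_iff lazy_list_append[OF g(3)])
  show "lazy_src G (\<Delta> \<odot> \<Gamma>) = lazy_src G \<Gamma>"
    using f(2) by (cases \<gamma>s) (simp_all add: g(1) d(1) lazy_src_def lazy_cmp_def)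
  show "lazy_tgt G (\<Delta> \<odot> \<Gamma>) = lazy_tgt G \<Delta>"
    using f(3) by (simp add: g(1) d(1) lazy_tgt_def)
qed

lemma lazy_cmp_assoc:
  assumes "\<Omega> \<in> lazy_paths X0 G" "\<Delta> \<in> lazy_paths X0 G" "\<Gamma> \<in> lazy_paths X0 G"
    "lazy_src G \<Omega> = lazy_tgt G \<Delta>" "lazy_src G \<Delta> = lazy_tgt G \<Gamma>"
  shows "(\<Omega> \<odot> \<Delta>) \<odot> \<Gamma> = \<Omega> \<odot> (\<Delta> \<odot> \<Gamma>)"
proof -
  obtain \<gamma>s g \<alpha>s where g: "\<Gamma> = (\<gamma>s @ [g], \<alpha>s)" "g \<in> mor G"
    by (rule lazy_splitE_last[OF assms(3)]) blast
  obtain ds d \<beta>s where d: "\<Delta> = (d # ds, \<beta>s)" "d \<in> mor G"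
    by (rule lazy_splitE_first[OF assms(2)]) blast
  obtain ws w \<omega>s where w: "\<Omega> = (w # ws, \<omega>s)" "w \<in> mor G"
    by (rule lazy_splitE_first[OF assms(1)]) blast
  show ?thesis
  proof (cases ds rule: rev_cases)
    case Nil
    then have "src G d = tgt G g" "src G w = tgt G d"
      using assms(4,5) lazy_tgt_append[of G "[]" d \<beta>s] by (simp_all add: g(1) d(1) w(1))
    then show ?thesis using Nil assoc[OF w(2) d(2) g(2)] lazy_cmp_append[of G w ws \<omega>s "[]" d \<beta>s]
      by (simp add: g(1) d(1) w(1))
  next
    case (snoc es e)
    have "\<Delta> \<odot> \<Gamma> = ((\<gamma>s @ cmp G d g # es) @ [e], \<alpha>s @ \<beta>s)" by (simp add: g(1) d(1) snoc)
    moreover have "\<Omega> \<odot> \<Delta> = (d # es @ cmp G w e # ws, \<beta>s @ \<omega>s)"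
      using lazy_cmp_append[of G w ws \<omega>s "d # es" e \<beta>s] by (simp add: d(1) w(1) snoc)
    moreover have "\<Omega> \<odot> ((\<gamma>s @ cmp G d g # es) @ [e], \<alpha>s @ \<beta>s) = ((\<gamma>s @ cmp G d g # es) @ cmp G w e # ws, (\<alpha>s @ \<beta>s) @ \<omega>s)"
      unfolding w(1) by (rule lazy_cmp_append)
    ultimately show ?thesis by (simp add: g(1))
  qed
qed

lemma lazy_cmp_order0_left:
  assumes "\<Gamma> \<in> lazy_paths X0 G" shows "([unt G (lazy_tgt G \<Gamma>)], []) \<odot> \<Gamma> = \<Gamma>"
proof -
  obtain \<gamma>s g \<alpha>s where g: "\<Gamma> = (\<gamma>s @ [g], \<alpha>s)" "g \<in> mor G"
    by (rule lazy_splitE_last[OF assms]) blast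
  then show ?thesis by (simp add: cmp_unt_left)
qed

lemma lazy_cmp_order0_right:
  assumes "\<Gamma> \<in> lazy_paths X0 G" shows "\<Gamma> \<odot> ([unt G (lazy_src G \<Gamma>)], []) = \<Gamma>"
proof -
  obtain \<gamma>s g \<alpha>s where g: "\<Gamma> = (g # \<gamma>s, \<alpha>s)" "g \<in> mor G"
    by (rule lazy_splitE_first[OF assms]) blast
  then show ?thesis using lazy_cmp_append[of G g \<gamma>s \<alpha>s "[]" _ "[]"] by (simp add: cmp_unt_right)
qed

end

section \<open>Moves that are compatible with composition\<close>

text \<open>A thin deformation whose arrows stay fixed and which moves a single path, but without the
  concatenation with constant paths that thin deformations involve.\<close>

inductive thin_replacement :: "'o manifold \<Rightarrow> ('o, 'm) lazy \<Rightarrow> ('o, 'm) lazy \<Rightarrow> bool" for X0 where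
  "thin_homotopic X0 \<alpha> \<beta> \<Longrightarrow> thin_replacement X0 (\<gamma>s, \<alpha>s @ [\<alpha>] @ \<alpha>s') (\<gamma>s, \<alpha>s @ [\<beta>] @ \<alpha>s')"

definition local_move ::
  "'o manifold \<Rightarrow> 'm manifold \<Rightarrow> ('o, 'm) groupoid_structure \<Rightarrow> ('o, 'm) lazy \<Rightarrow> ('o, 'm) lazy \<Rightarrow> bool" where
  "local_move X0 X1 G \<Gamma> \<Gamma>' \<longleftrightarrow> \<Gamma> \<in> lazy_paths X0 G \<and> \<Gamma>' \<in> lazy_paths X0 G \<and>
     (elementary_equiv X1 G \<Gamma> \<Gamma>' \<or> thin_replacement X0 \<Gamma> \<Gamma>')"

lemma lazy_list_middle:
  assumes "lazy_list X0 G (\<gamma>s @ [g, h] @ \<gamma>s') (\<alpha>s @ [\<alpha>] @ \<alpha>s')" "length \<alpha>s = length \<gamma>s"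
  shows "g \<in> mor G" "h \<in> mor G" "\<alpha> \<in> sitting_paths X0" "tgt G g = \<alpha> 0" "src G h = \<alpha> 1"
    "length \<gamma>s' = length \<alpha>s'"
proof -
  have l: "lazy_list X0 G (g # h # \<gamma>s') (\<alpha> # \<alpha>s')"
    using assms lazy_list_append[of \<gamma>s \<alpha>s X0 G g "h # \<gamma>s'" "\<alpha> # \<alpha>s'"] by simp
  then show "g \<in> mor G" "\<alpha> \<in> sitting_paths X0" "tgt G g = \<alpha> 0" "src G h = \<alpha> 1" by simp_all
  from l have "lazy_list X0 G (h # \<gamma>s') \<alpha>s'" by simp
  from lazy_list_mor[OF this] lazy_list_length[OF this]
  show "h \<in> mor G" "length \<gamma>s' = length \<alpha>s'" by simp_all
qed

context lie_groupoid
begin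

lemma charted_X0: "charted X0" and charted_X1: "charted X1"
  by (rule base.charted_axioms, rule arrows.charted_axioms)

lemma src_smooth: "smooth_map X1 X0 (topspace (mtop X1)) (src G)"
  using src_submersion by (simp add: submersion_def)

lemma tgt_smooth: "smooth_map X1 X0 (topspace (mtop X1)) (tgt G)"
  using tgt_submersion by (simp add: submersion_def)

lemma arrow_path_mor: "\<zeta> \<in> sitting_paths X1 \<Longrightarrow> 0 \<le> r \<Longrightarrow> r \<le> 1 \<Longrightarrow> \<zeta> r \<in> mor G"
  using sitting_path_mem[OF charted_X1] mor_eq by blast

lemma src_path: "\<zeta> \<in> sitting_paths X1 \<Longrightarrow> map_path (src G) \<zeta> \<in> sitting_paths X0"
  by (rule map_path_sitting[OF charted_X1 charted_X0 src_smooth])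

lemma tgt_path: "\<zeta> \<in> sitting_paths X1 \<Longrightarrow> map_path (tgt G) \<zeta> \<in> sitting_paths X0"
  by (rule map_path_sitting[OF charted_X1 charted_X0 tgt_smooth])

lemma path_obj: "\<alpha> \<in> sitting_paths X0 \<Longrightarrow> 0 \<le> r \<Longrightarrow> r \<le> 1 \<Longrightarrow> \<alpha> r \<in> obj G"
  using sitting_path_mem[OF charted_X0] obj_eq by blast

lemma const_path_ends: "is_const_path \<alpha> \<Longrightarrow> \<alpha> 0 = \<alpha> 1"
  by (auto simp: is_const_path_def)

text \<open>An elementary equivalence happens between the end arrows, so composing with a further lazy
  path at either end changes at most one of the two arrows next to it; associativity then shows
  that the same kind of move relates the composites.\<close>

lemma elementary_equiv_cmp_left:
  assumes e: "elementary_equiv X1 G \<Gamma> \<Gamma>'" and P: "\<Gamma> \<in> lazy_paths X0 G" and \<Delta>: "\<Delta> \<in> lazy_paths X0 G"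
    and c: "lazy_src G \<Delta> = lazy_tgt G \<Gamma>"
  shows "elementary_equiv X1 G (\<Delta> \<odot> \<Gamma>) (\<Delta> \<odot> \<Gamma>')"
proof -
  obtain ds d \<beta>s where D: "\<Delta> = (d # ds, \<beta>s)" and d: "d \<in> mor G"
    by (rule lazy_splitE_first[OF \<Delta>]) blast
  from e show ?thesis
  proof cases
    case (drop_constant \<alpha>s \<gamma>s \<alpha> g h \<gamma>s' \<alpha>s')
    note m = lazy_list_middle[OF P[unfolded drop_constant(1) lazy_paths_iff] drop_constant(3)]
    show ?thesis
    proof (cases \<gamma>s' rule: rev_cases)
      case Nil
      have "src G d = tgt G h" using c Nil by (simp add: D drop_constant(1) lazy_tgt_def)
      then have "cmp G (cmp G d h) g = cmp G d (cmp G h g)"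
        using m const_path_ends[OF drop_constant(4)] by (intro assoc d) auto
      then show ?thesis
        using elementary_equiv.drop_constant[OF drop_constant(3,4), of X1 G g "cmp G d h" ds "\<beta>s"] Nil m(6)
          lazy_cmp_append[of G d ds \<beta>s "\<gamma>s @ [g]" h "\<alpha>s @ [\<alpha>]"]
        by (simp add: D drop_constant(1,2))
    next
      case (snoc ys y)
      then show ?thesis
        using elementary_equiv.drop_constant[OF drop_constant(3,4), of X1 G g h "ys @ cmp G d y # ds" "\<alpha>s' @ \<beta>s"]
          lazy_cmp_append[of G d ds \<beta>s "\<gamma>s @ [g, h] @ ys" y "\<alpha>s @ [\<alpha>] @ \<alpha>s'"]
          lazy_cmp_append[of G d ds \<beta>s "\<gamma>s @ [cmp G h g] @ ys" y "\<alpha>s @ \<alpha>s'"]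
        by (simp add: D drop_constant(1,2))
    qed
  next
    case (drop_identity \<gamma>s \<alpha>s x \<gamma>s' \<alpha> \<beta> \<alpha>s')
    have "length \<gamma>s' = Suc (length \<alpha>s')"
      using lazy_list_length[OF P[unfolded drop_identity(1) lazy_paths_iff]] drop_identity(3) by simp
    then obtain ys y where y: "\<gamma>s' = ys @ [y]" by (cases \<gamma>s' rule: rev_cases) auto
    then show ?thesis
      using elementary_equiv.drop_identity[OF drop_identity(3,4), of X1 "ys @ cmp G d y # ds" \<alpha> \<beta> "\<alpha>s' @ \<beta>s"]
        lazy_cmp_append[of G d ds \<beta>s "\<gamma>s @ [unt G x] @ ys" y "\<alpha>s @ [\<alpha>, \<beta>] @ \<alpha>s'"]
        lazy_cmp_append[of G d ds \<beta>s "\<gamma>s @ ys" y "\<alpha>s @ [concat_path \<beta> \<alpha>] @ \<alpha>s'"]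
      by (simp add: D drop_identity(1,2))
  next
    case (transport \<alpha>s \<gamma>s \<zeta> \<alpha> g h \<gamma>s' \<alpha>s')
    note m = lazy_list_middle[OF P[unfolded transport(1) lazy_paths_iff] transport(3)]
    have z: "\<zeta> 1 \<in> mor G" using arrow_path_mor[OF transport(4)] by simp
    have z1: "src G (\<zeta> 1) = \<alpha> 1" using transport(5) by auto
    show ?thesis
    proof (cases \<gamma>s' rule: rev_cases)
      case Nil
      have "src G d = tgt G h" using c Nil by (simp add: D transport(1) lazy_tgt_def)
      then have "cmp G (cmp G d h) (ivs G (\<zeta> 1)) = cmp G d (cmp G h (ivs G (\<zeta> 1)))"
        using m z z1 by (intro assoc d) (auto simp: ivs_mor tgt_ivs)
      then show ?thesis
        using elementary_equiv.transport[OF transport(3-5), of g "cmp G d h" ds "\<beta>s"] Nil m(6)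
          lazy_cmp_append[of G d ds \<beta>s "\<gamma>s @ [g]" h "\<alpha>s @ [\<alpha>]"]
          lazy_cmp_append[of G d ds \<beta>s "\<gamma>s @ [cmp G (\<zeta> 0) g]" "cmp G h (ivs G (\<zeta> 1))" "\<alpha>s @ [map_path (tgt G) \<zeta>]"]
        by (simp add: D transport(1,2))
    next
      case (snoc ys y)
      then show ?thesis
        using elementary_equiv.transport[OF transport(3-5), of g h "ys @ cmp G d y # ds" "\<alpha>s' @ \<beta>s"]
          lazy_cmp_append[of G d ds \<beta>s "\<gamma>s @ [g, h] @ ys" y "\<alpha>s @ [\<alpha>] @ \<alpha>s'"]
          lazy_cmp_append[of G d ds \<beta>s "\<gamma>s @ [cmp G (\<zeta> 0) g, cmp G h (ivs G (\<zeta> 1))] @ ys" y "\<alpha>s @ [map_path (tgt G) \<zeta>] @ \<alpha>s'"]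
        by (simp add: D transport(1,2))
    qed
  qed
qed

lemma elementary_equiv_cmp_right:
  assumes e: "elementary_equiv X1 G \<Gamma> \<Gamma>'" and P: "\<Gamma> \<in> lazy_paths X0 G" and \<Delta>: "\<Delta> \<in> lazy_paths X0 G"
    and c: "lazy_src G \<Gamma> = lazy_tgt G \<Delta>"
  shows "elementary_equiv X1 G (\<Gamma> \<odot> \<Delta>) (\<Gamma>' \<odot> \<Delta>)"
proof -
  obtain ds d \<beta>s where D: "\<Delta> = (ds @ [d], \<beta>s)" and l: "length ds = length \<beta>s" and d: "d \<in> mor G"
    by (rule lazy_splitE_last[OF \<Delta>]) blast
  from e show ?thesis
  proof cases
    case (drop_constant \<alpha>s \<gamma>s \<alpha> g h \<gamma>s' \<alpha>s')
    note m = lazy_list_middle[OF P[unfolded drop_constant(1) lazy_paths_iff] drop_constant(3)]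
    show ?thesis
    proof (cases \<gamma>s)
      case Nil
      have "src G g = tgt G d" using c Nil by (simp add: D drop_constant(1))
      then have "cmp G (cmp G h g) d = cmp G h (cmp G g d)"
        using m const_path_ends[OF drop_constant(4)] by (intro assoc d) auto
      then show ?thesis
        using elementary_equiv.drop_constant[of \<beta>s ds, OF _ drop_constant(4), of X1 G "cmp G g d" h \<gamma>s' "\<alpha>s'"] Nil l
          drop_constant(3)
        by (simp add: D drop_constant(1,2))
    next
      case (Cons y ys)
      then show ?thesis
        using elementary_equiv.drop_constant[of "\<beta>s @ \<alpha>s" "ds @ cmp G y d # ys", OF _ drop_constant(4), of X1 G g h \<gamma>s' \<alpha>s'] l
          drop_constant(3)
        by (simp add: D drop_constant(1,2))
    qed
  next
    case (drop_identity \<gamma>s \<alpha>s x \<gamma>s' \<alpha> \<beta> \<alpha>s')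
    then obtain y ys where y: "\<gamma>s = y # ys" by (cases \<gamma>s) auto
    then show ?thesis
      using elementary_equiv.drop_identity[of "ds @ cmp G y d # ys" "\<beta>s @ \<alpha>s", OF _ drop_identity(4), of X1 \<gamma>s' \<alpha> \<beta> "\<alpha>s'"] l
        drop_identity(3)
      by (simp add: D drop_identity(1,2))
  next
    case (transport \<alpha>s \<gamma>s \<zeta> \<alpha> g h \<gamma>s' \<alpha>s')
    note m = lazy_list_middle[OF P[unfolded transport(1) lazy_paths_iff] transport(3)]
    have z: "\<zeta> 0 \<in> mor G" using arrow_path_mor[OF transport(4)] by simp
    have z0: "src G (\<zeta> 0) = \<alpha> 0" using transport(5) by auto
    show ?thesis
    proof (cases \<gamma>s)
      case Nil
      have "src G g = tgt G d" using c Nil by (simp add: D transport(1))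
      then have "cmp G (cmp G (\<zeta> 0) g) d = cmp G (\<zeta> 0) (cmp G g d)"
        using m z z0 by (intro assoc d) auto
      then show ?thesis
        using elementary_equiv.transport[of \<beta>s ds, OF _ transport(4,5), of "cmp G g d" h \<gamma>s' "\<alpha>s'"] Nil l transport(3)
        by (simp add: D transport(1,2))
    next
      case (Cons y ys)
      then show ?thesis
        using elementary_equiv.transport[of "\<beta>s @ \<alpha>s" "ds @ cmp G y d # ys", OF _ transport(4,5), of g h \<gamma>s' \<alpha>s'] l transport(3)
        by (simp add: D transport(1,2))
    qed
  qed
qed

lemma thin_replacement_cmp_left:
  assumes e: "thin_replacement X0 \<Gamma> \<Gamma>'" and P: "\<Gamma> \<in> lazy_paths X0 G" and \<Delta>: "\<Delta> \<in> lazy_paths X0 G"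
  shows "thin_replacement X0 (\<Delta> \<odot> \<Gamma>) (\<Delta> \<odot> \<Gamma>')"
proof -
  obtain ds d \<beta>s where D: "\<Delta> = (d # ds, \<beta>s)" by (rule lazy_splitE_first[OF \<Delta>])
  obtain xs x as where X: "\<Gamma> = (xs @ [x], as)" by (rule lazy_splitE_last[OF P])
  from e show ?thesis
  proof cases
    case (1 \<alpha> \<beta> \<gamma>s \<alpha>s \<alpha>s')
    then show ?thesis
      using thin_replacement.intros[OF 1(3), of "xs @ cmp G d x # ds" \<alpha>s "\<alpha>s' @ \<beta>s"] X D by auto
  qed
qed

lemma thin_replacement_cmp_right:
  assumes e: "thin_replacement X0 \<Gamma> \<Gamma>'" and P: "\<Gamma> \<in> lazy_paths X0 G" and \<Delta>: "\<Delta> \<in> lazy_paths X0 G"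
  shows "thin_replacement X0 (\<Gamma> \<odot> \<Delta>) (\<Gamma>' \<odot> \<Delta>)"
proof -
  obtain ds d \<beta>s where D: "\<Delta> = (ds @ [d], \<beta>s)" by (rule lazy_splitE_last[OF \<Delta>])
  obtain xs x as where X: "\<Gamma> = (x # xs, as)" by (rule lazy_splitE_first[OF P])
  from e show ?thesis
  proof cases
    case (1 \<alpha> \<beta> \<gamma>s \<alpha>s \<alpha>s')
    then show ?thesis
      using thin_replacement.intros[OF 1(3), of "ds @ cmp G x d # xs" "\<beta>s @ \<alpha>s" \<alpha>s'] X D by auto
  qed
qed

lemma elementary_equiv_ends:
  assumes e: "elementary_equiv X1 G \<Gamma> \<Gamma>'" and P: "\<Gamma> \<in> lazy_paths X0 G"
  shows "lazy_src G \<Gamma>' = lazy_src G \<Gamma> \<and> lazy_tgt G \<Gamma>' = lazy_tgt G \<Gamma>"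
  using e
proof cases
  case (drop_constant \<alpha>s \<gamma>s \<alpha> g h \<gamma>s' \<alpha>s')
  note m = lazy_list_middle[OF P[unfolded drop_constant(1) lazy_paths_iff] drop_constant(3)]
  have "src G (cmp G h g) = src G g" "tgt G (cmp G h g) = tgt G h"
    using m const_path_ends[OF drop_constant(4)] by (simp_all add: cmp_facts)
  then show ?thesis by (cases \<gamma>s; cases \<gamma>s' rule: rev_cases) (simp_all add: drop_constant(1,2) lazy_src_def lazy_tgt_def)
next
  case (drop_identity \<gamma>s \<alpha>s x \<gamma>s' \<alpha> \<beta> \<alpha>s')
  have "length \<gamma>s' = Suc (length \<alpha>s')"
    using lazy_list_length[OF P[unfolded drop_identity(1) lazy_paths_iff]] drop_identity(3) by simp
  then obtain ys y where y: "\<gamma>s' = ys @ [y]" by (cases \<gamma>s' rule: rev_cases) auto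
  obtain z zs where z: "\<gamma>s = z # zs" using drop_identity(3) by (cases \<gamma>s) auto
  show ?thesis by (simp add: drop_identity(1,2) lazy_src_def lazy_tgt_def y z)
next
  case (transport \<alpha>s \<gamma>s \<zeta> \<alpha> g h \<gamma>s' \<alpha>s')
  note m = lazy_list_middle[OF P[unfolded transport(1) lazy_paths_iff] transport(3)]
  have z: "\<zeta> 0 \<in> mor G" "\<zeta> 1 \<in> mor G" using arrow_path_mor[OF transport(4)] by simp_all
  have z0: "src G (\<zeta> 0) = \<alpha> 0" "src G (\<zeta> 1) = \<alpha> 1" using transport(5) by auto
  have "src G (cmp G (\<zeta> 0) g) = src G g" "tgt G (cmp G h (ivs G (\<zeta> 1))) = tgt G h"
    using m z z0 by (simp_all add: cmp_facts ivs_mor tgt_ivs)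
  then show ?thesis by (cases \<gamma>s; cases \<gamma>s' rule: rev_cases) (simp_all add: transport(1,2) lazy_src_def lazy_tgt_def)
qed

lemma local_move_ends:
  assumes "local_move X0 X1 G \<Gamma> \<Gamma>'"
  shows "lazy_src G \<Gamma>' = lazy_src G \<Gamma> \<and> lazy_tgt G \<Gamma>' = lazy_tgt G \<Gamma>"
proof -
  have "lazy_src G \<Gamma>' = lazy_src G \<Gamma> \<and> lazy_tgt G \<Gamma>' = lazy_tgt G \<Gamma>" if "thin_replacement X0 \<Gamma> \<Gamma>'"
    using that by cases (simp add: lazy_src_def lazy_tgt_def)
  then show ?thesis using assms elementary_equiv_ends unfolding local_move_def by blast
qed

lemma local_move_cmp_left:
  assumes "local_move X0 X1 G \<Gamma> \<Gamma>'" "\<Delta> \<in> lazy_paths X0 G" "lazy_src G \<Delta> = lazy_tgt G \<Gamma>"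
  shows "local_move X0 X1 G (\<Delta> \<odot> \<Gamma>) (\<Delta> \<odot> \<Gamma>')"
  using assms local_move_ends[OF assms(1)] unfolding local_move_def
  by (auto intro: lazy_cmp_facts elementary_equiv_cmp_left thin_replacement_cmp_left)

lemma local_move_cmp_right:
  assumes "local_move X0 X1 G \<Gamma> \<Gamma>'" "\<Delta> \<in> lazy_paths X0 G" "lazy_src G \<Gamma> = lazy_tgt G \<Delta>"
  shows "local_move X0 X1 G (\<Gamma> \<odot> \<Delta>) (\<Gamma>' \<odot> \<Delta>)"
  using assms local_move_ends[OF assms(1)] unfolding local_move_def
  by (auto intro: lazy_cmp_facts elementary_equiv_cmp_right thin_replacement_cmp_right)

end

section \<open>Calculus of lazy paths up to local moves\<close>

context lie_groupoid
begin

abbreviation lazy_eqv (infix "\<simeq>" 50) where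
  "\<Gamma> \<simeq> \<Gamma>' \<equiv> equivclp (local_move X0 X1 G) \<Gamma> \<Gamma>'"

abbreviation lazies ("\<P>") where
  "\<P> \<equiv> lazy_paths X0 G"

lemma eqv_facts:
  assumes "\<Gamma> \<simeq> \<Gamma>'" "\<Gamma> \<in> \<P>"
  shows "\<Gamma>' \<in> \<P>" "lazy_src G \<Gamma>' = lazy_src G \<Gamma>" "lazy_tgt G \<Gamma>' = lazy_tgt G \<Gamma>"
proof -
  from assms have "\<Gamma>' \<in> \<P> \<and> lazy_src G \<Gamma>' = lazy_src G \<Gamma> \<and> lazy_tgt G \<Gamma>' = lazy_tgt G \<Gamma>"
  proof (induction rule: equivclp_induct)
    case (step y z)
    then show ?case using local_move_ends[of y z] local_move_ends[of z y] unfolding local_move_def by metis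
  qed simp
  then show "\<Gamma>' \<in> \<P>" "lazy_src G \<Gamma>' = lazy_src G \<Gamma>" "lazy_tgt G \<Gamma>' = lazy_tgt G \<Gamma>" by blast+
qed

lemma eqv_cmp_left:
  assumes "\<Gamma> \<simeq> \<Gamma>'" and \<Gamma>: "\<Gamma> \<in> \<P>" and \<Delta>: "\<Delta> \<in> \<P>" and c: "lazy_src G \<Delta> = lazy_tgt G \<Gamma>"
  shows "\<Delta> \<odot> \<Gamma> \<simeq> \<Delta> \<odot> \<Gamma>'"
  using assms(1)
proof (induction rule: equivclp_induct)
  case (step y z)
  have y: "y \<in> \<P>" "lazy_tgt G y = lazy_tgt G \<Gamma>" using eqv_facts[OF step(1) \<Gamma>] by simp_all
  have z: "z \<in> \<P>" "lazy_tgt G z = lazy_tgt G \<Gamma>"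
    using eqv_facts[OF equivclp_into_equivclp[OF step(1,2)] \<Gamma>] by simp_all
  have "\<Delta> \<odot> y \<simeq> \<Delta> \<odot> z"
    using step(2) local_move_cmp_left[OF _ \<Delta>] y z c by (metis r_into_equivclp converse_r_into_equivclp)
  with step.IH show ?case by (rule equivclp_trans)
qed simp

lemma eqv_cmp_right:
  assumes "\<Gamma> \<simeq> \<Gamma>'" and \<Gamma>: "\<Gamma> \<in> \<P>" and \<Delta>: "\<Delta> \<in> \<P>" and c: "lazy_src G \<Gamma> = lazy_tgt G \<Delta>"
  shows "\<Gamma> \<odot> \<Delta> \<simeq> \<Gamma>' \<odot> \<Delta>"
  using assms(1)
proof (induction rule: equivclp_induct)
  case (step y z)
  have y: "y \<in> \<P>" "lazy_src G y = lazy_src G \<Gamma>" using eqv_facts[OF step(1) \<Gamma>] by simp_all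
  have z: "z \<in> \<P>" "lazy_src G z = lazy_src G \<Gamma>"
    using eqv_facts[OF equivclp_into_equivclp[OF step(1,2)] \<Gamma>] by simp_all
  have "y \<odot> \<Delta> \<simeq> z \<odot> \<Delta>"
    using step(2) local_move_cmp_right[OF _ \<Delta>] y z c by (metis r_into_equivclp converse_r_into_equivclp)
  with step.IH show ?case by (rule equivclp_trans)
qed simp

lemma eqv_cmp:
  assumes g: "\<Gamma> \<simeq> \<Gamma>'" and d: "\<Delta> \<simeq> \<Delta>'" and \<Gamma>: "\<Gamma> \<in> \<P>" and \<Delta>: "\<Delta> \<in> \<P>"
    and c: "lazy_src G \<Delta> = lazy_tgt G \<Gamma>"
  shows "\<Delta> \<odot> \<Gamma> \<simeq> \<Delta>' \<odot> \<Gamma>'"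
proof -
  note \<Gamma>' = eqv_facts[OF g \<Gamma>]
  have "\<Delta> \<odot> \<Gamma> \<simeq> \<Delta> \<odot> \<Gamma>'" by (rule eqv_cmp_left[OF g \<Gamma> \<Delta> c])
  also have "\<dots> \<simeq> \<Delta>' \<odot> \<Gamma>'" by (rule eqv_cmp_right[OF d \<Delta> \<Gamma>'(1)]) (simp add: c \<Gamma>'(3))
  finally show ?thesis .
qed

text \<open>Arrows and paths as lazy paths; together they generate all lazy paths under composition.\<close>

definition lazy_arrow :: "'m \<Rightarrow> ('o, 'm) lazy" where
  "lazy_arrow g = ([g], [])"

definition lazy_path :: "(real \<Rightarrow> 'o) \<Rightarrow> ('o, 'm) lazy" where
  "lazy_path \<alpha> = ([unt G (\<alpha> 0), unt G (\<alpha> 1)], [\<alpha>])"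

lemma lazy_arrow_facts [simp]:
  "g \<in> mor G \<Longrightarrow> lazy_arrow g \<in> \<P>" "lazy_src G (lazy_arrow g) = src G g" "lazy_tgt G (lazy_arrow g) = tgt G g"
  by (simp_all add: lazy_arrow_def lazy_paths_iff lazy_tgt_def)

lemma lazy_path_facts [simp]:
  assumes "\<alpha> \<in> sitting_paths X0"
  shows "lazy_path \<alpha> \<in> \<P>" "lazy_src G (lazy_path \<alpha>) = \<alpha> 0" "lazy_tgt G (lazy_path \<alpha>) = \<alpha> 1"
proof -
  have "\<alpha> 0 \<in> obj G" "\<alpha> 1 \<in> obj G" using path_obj[OF assms] by simp_all
  then show "lazy_path \<alpha> \<in> \<P>" "lazy_src G (lazy_path \<alpha>) = \<alpha> 0" "lazy_tgt G (lazy_path \<alpha>) = \<alpha> 1"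
    using assms by (simp_all add: lazy_path_def lazy_paths_iff lazy_tgt_def unt_mor src_unt tgt_unt)
qed

lemma lazy_arrow_cmp: "lazy_arrow h \<odot> lazy_arrow g = lazy_arrow (cmp G h g)"
  using lazy_cmp_append[of G h "[]" "[]" "[]" g "[]"] by (simp add: lazy_arrow_def)

lemma cmp_unt: "\<Gamma> \<in> \<P> \<Longrightarrow> lazy_src G \<Gamma> = x \<Longrightarrow> \<Gamma> \<odot> lazy_arrow (unt G x) = \<Gamma>"
  "\<Gamma> \<in> \<P> \<Longrightarrow> lazy_tgt G \<Gamma> = x \<Longrightarrow> lazy_arrow (unt G x) \<odot> \<Gamma> = \<Gamma>"
  unfolding lazy_arrow_def using lazy_cmp_order0_left lazy_cmp_order0_right by blast+

lemma lazy_Cons_decompose: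
  assumes "lazy_list X0 G (g # h # \<gamma>s) (\<alpha> # \<alpha>s)"
  shows "(g # h # \<gamma>s, \<alpha> # \<alpha>s) = (h # \<gamma>s, \<alpha>s) \<odot> lazy_path \<alpha> \<odot> lazy_arrow g"
proof -
  have m: "g \<in> mor G" "h \<in> mor G" "tgt G g = \<alpha> 0" "src G h = \<alpha> 1"
    using assms lazy_list_mor[OF assms] by simp_all
  have "lazy_path \<alpha> \<odot> lazy_arrow g = ([g] @ [unt G (\<alpha> 1)], [\<alpha>])"
    using lazy_cmp_append[of G "unt G (\<alpha> 0)" "[unt G (\<alpha> 1)]" "[\<alpha>]" "[]" g "[]"] m cmp_unt_left[OF m(1)]
    by (simp add: lazy_path_def lazy_arrow_def)
  moreover have "(h # \<gamma>s, \<alpha>s) \<odot> ([g] @ [unt G (\<alpha> 1)], [\<alpha>]) = ([g] @ cmp G h (unt G (\<alpha> 1)) # \<gamma>s, [\<alpha>] @ \<alpha>s)"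
    by (rule lazy_cmp_append)
  ultimately show ?thesis using cmp_unt_right[OF m(2)] m(4) by simp
qed

lemma local_moveI: "\<Gamma> \<in> \<P> \<Longrightarrow> \<Gamma>' \<in> \<P> \<Longrightarrow> elementary_equiv X1 G \<Gamma> \<Gamma>' \<Longrightarrow> \<Gamma> \<simeq> \<Gamma>'"
  by (rule r_into_equivclp) (simp add: local_move_def)

lemma eqv_const:
  assumes "x \<in> obj G" shows "lazy_path (const_path x) \<simeq> lazy_arrow (unt G x)"
proof (rule local_moveI)
  have c: "const_path x \<in> sitting_paths X0"
    using const_path_sitting[OF charted_X0] assms obj_eq by simp
  then show "lazy_path (const_path x) \<in> \<P>" by simp
  show "lazy_arrow (unt G x) \<in> \<P>" using assms by (simp add: unt_mor)
  have "cmp G (unt G x) (unt G x) = unt G x"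
    using cmp_unt_left[OF unt_mor[OF assms]] tgt_unt[OF assms] by simp
  then show "elementary_equiv X1 G (lazy_path (const_path x)) (lazy_arrow (unt G x))"
    using elementary_equiv.drop_constant[of "[]" "[]" "const_path x" X1 G "unt G x" "unt G x" "[]" "[]"]
    by (auto simp: lazy_path_def lazy_arrow_def is_const_path_def)
qed

lemma eqv_concat:
  assumes a: "\<alpha> \<in> sitting_paths X0" and b: "\<beta> \<in> sitting_paths X0" and ab: "\<alpha> 1 = \<beta> 0"
  shows "lazy_path \<beta> \<odot> lazy_path \<alpha> \<simeq> lazy_path (concat_path \<beta> \<alpha>)"
proof (rule local_moveI)
  show "lazy_path \<beta> \<odot> lazy_path \<alpha> \<in> \<P>" by (rule lazy_cmp_facts(1)) (simp_all add: a b ab)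
  show "lazy_path (concat_path \<beta> \<alpha>) \<in> \<P>" by (simp add: concat_path_sitting[OF charted_X0 a b ab])
  have o: "\<beta> 0 \<in> obj G" using path_obj[OF b] by simp
  have "cmp G (unt G (\<beta> 0)) (unt G (\<beta> 0)) = unt G (\<beta> 0)"
    using cmp_unt_left[OF unt_mor[OF o]] tgt_unt[OF o] by simp
  then have "lazy_path \<beta> \<odot> lazy_path \<alpha> = ([unt G (\<alpha> 0)] @ [unt G (\<beta> 0)] @ [unt G (\<beta> 1)], [] @ [\<alpha>, \<beta>] @ [])"
    using lazy_cmp_append[of G "unt G (\<beta> 0)" "[unt G (\<beta> 1)]" "[\<beta>]" "[unt G (\<alpha> 0)]" "unt G (\<alpha> 1)" "[\<alpha>]"]
    by (simp add: lazy_path_def ab)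
  moreover have "lazy_path (concat_path \<beta> \<alpha>) = ([unt G (\<alpha> 0)] @ [unt G (\<beta> 1)], [] @ [concat_path \<beta> \<alpha>] @ [])"
    by (simp add: lazy_path_def)
  ultimately show "elementary_equiv X1 G (lazy_path \<beta> \<odot> lazy_path \<alpha>) (lazy_path (concat_path \<beta> \<alpha>))"
    using elementary_equiv.drop_identity[of "[unt G (\<alpha> 0)]" "[]" "\<beta> 0" G X1 "[unt G (\<beta> 1)]" \<alpha> \<beta> "[]"] o by simp
qed

lemma eqv_transport:
  assumes z: "\<zeta> \<in> sitting_paths X1"
  shows "lazy_path (map_path (tgt G) \<zeta>) \<odot> lazy_arrow (\<zeta> 0) \<simeq> lazy_arrow (\<zeta> 1) \<odot> lazy_path (map_path (src G) \<zeta>)"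
proof (rule equivclp_sym, rule local_moveI)
  have m: "\<zeta> 0 \<in> mor G" "\<zeta> 1 \<in> mor G" using arrow_path_mor[OF z] by simp_all
  note st = src_path[OF z] tgt_path[OF z]
  show "lazy_path (map_path (tgt G) \<zeta>) \<odot> lazy_arrow (\<zeta> 0) \<in> \<P>" by (rule lazy_cmp_facts(1)) (simp_all add: m st)
  show "lazy_arrow (\<zeta> 1) \<odot> lazy_path (map_path (src G) \<zeta>) \<in> \<P>" by (rule lazy_cmp_facts(1)) (simp_all add: m st)
  have "lazy_path (map_path (tgt G) \<zeta>) \<odot> lazy_arrow (\<zeta> 0) = ([\<zeta> 0, unt G (tgt G (\<zeta> 1))], [map_path (tgt G) \<zeta>])"
    using lazy_cmp_append[of G "unt G (tgt G (\<zeta> 0))" "[unt G (tgt G (\<zeta> 1))]" "[map_path (tgt G) \<zeta>]" "[]" "\<zeta> 0" "[]"]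
      cmp_unt_left[OF m(1)] by (simp add: lazy_path_def lazy_arrow_def)
  moreover have "lazy_arrow (\<zeta> 1) \<odot> lazy_path (map_path (src G) \<zeta>) = ([unt G (src G (\<zeta> 0)), \<zeta> 1], [map_path (src G) \<zeta>])"
    using lazy_cmp_append[of G "\<zeta> 1" "[]" "[]" "[unt G (src G (\<zeta> 0))]" "unt G (src G (\<zeta> 1))" "[map_path (src G) \<zeta>]"]
      cmp_unt_right[OF m(2)] by (simp add: lazy_path_def lazy_arrow_def)
  ultimately show "elementary_equiv X1 G (lazy_arrow (\<zeta> 1) \<odot> lazy_path (map_path (src G) \<zeta>)) (lazy_path (map_path (tgt G) \<zeta>) \<odot> lazy_arrow (\<zeta> 0))"
    using elementary_equiv.transport[of "[]" "[]" \<zeta> X1 G "map_path (src G) \<zeta>" "unt G (src G (\<zeta> 0))" "\<zeta> 1" "[]" "[]"]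
      z cmp_unt_right[OF m(1)] cmp_ivs_right[OF m(2)] by simp
qed

lemma eqv_thin:
  assumes "thin_homotopic X0 \<alpha> \<beta>" shows "lazy_path \<alpha> \<simeq> lazy_path \<beta>"
proof (rule r_into_equivclp)
  have "\<alpha> \<in> sitting_paths X0" "\<beta> \<in> sitting_paths X0" using assms by (simp_all add: thin_homotopic_def)
  then show "local_move X0 X1 G (lazy_path \<alpha>) (lazy_path \<beta>)"
    using thin_replacement.intros[OF assms, of "[unt G (\<alpha> 0), unt G (\<alpha> 1)]" "[]" "[]"] thin_homotopic_ends[OF assms]
    by (simp add: local_move_def) (simp add: lazy_path_def)
qed

lemma eqv_rev_path:
  assumes a: "\<alpha> \<in> sitting_paths X0"
  shows "lazy_path (rev_path \<alpha>) \<odot> lazy_path \<alpha> \<simeq> lazy_arrow (unt G (\<alpha> 0))"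
proof -
  have "lazy_path (rev_path \<alpha>) \<odot> lazy_path \<alpha> \<simeq> lazy_path (concat_path (rev_path \<alpha>) \<alpha>)"
    by (rule eqv_concat[OF a rev_path_sitting[OF charted_X0 a]]) simp
  also have "\<dots> \<simeq> lazy_path (const_path (\<alpha> 0))" by (rule eqv_thin[OF thin_homotopic_cancel[OF charted_X0 a]])
  also have "\<dots> \<simeq> lazy_arrow (unt G (\<alpha> 0))" using path_obj[OF a] by (intro eqv_const) simp
  finally show ?thesis .
qed

lemma eqv_path_rev:
  assumes a: "\<alpha> \<in> sitting_paths X0"
  shows "lazy_path \<alpha> \<odot> lazy_path (rev_path \<alpha>) \<simeq> lazy_arrow (unt G (\<alpha> 1))"
  using eqv_rev_path[OF rev_path_sitting[OF charted_X0 a]] rev_rev_path[OF a] by simp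

section \<open>Thin deformations as composites of local moves\<close>

text \<open>The composite \<open>\<tau>' \<cdot> \<Gamma> \<cdot> \<alpha> \<cdot> g\<close> is rewritten from left to right. The square to the left turns
  \<open>\<tau>' \<cdot> \<Gamma>\<close> into \<open>\<Gamma>' \<cdot> \<sigma>'\<close>; the thin homotopy replaces \<open>\<alpha>\<close> by the reverse of \<open>\<sigma>'\<close>, \<open>\<alpha>'\<close> and
  \<open>\<tau>\<close>; then \<open>\<sigma>'\<close> cancels against its reverse, and the square to the right turns \<open>\<tau> \<cdot> g\<close> into
  \<open>g' \<cdot> \<sigma>\<close>.\<close>

lemma eqv_square_step:
  assumes P: "\<Gamma> \<in> \<P>" "\<Gamma>' \<in> \<P>" and m: "g \<in> mor G" "g' \<in> mor G"
    and sit: "\<alpha> \<in> sitting_paths X0" "\<alpha>' \<in> sitting_paths X0" "\<tau> \<in> sitting_paths X0" "\<tau>' \<in> sitting_paths X0"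
      "\<sigma> \<in> sitting_paths X0" "\<sigma>' \<in> sitting_paths X0"
    and ends: "lazy_src G \<Gamma> = \<alpha> 1" "lazy_tgt G \<Gamma> = \<tau>' 0" "lazy_src G \<Gamma>' = \<alpha>' 1" "tgt G g = \<alpha> 0"
      "tgt G g' = \<alpha>' 0" "\<tau> 0 = \<alpha> 0" "\<tau> 1 = \<alpha>' 0" "\<sigma>' 0 = \<alpha> 1" "\<sigma>' 1 = \<alpha>' 1" "\<sigma> 0 = src G g" "\<sigma> 1 = src G g'"
    and IH: "lazy_path \<tau>' \<odot> \<Gamma> \<simeq> \<Gamma>' \<odot> lazy_path \<sigma>'"
    and thin: "thin_homotopic X0 \<alpha> (concat_path (rev_path \<sigma>') (concat_path \<alpha>' \<tau>))"
    and tr: "lazy_path \<tau> \<odot> lazy_arrow g \<simeq> lazy_arrow g' \<odot> lazy_path \<sigma>"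
  shows "lazy_path \<tau>' \<odot> \<Gamma> \<odot> lazy_path \<alpha> \<odot> lazy_arrow g \<simeq> (\<Gamma>' \<odot> lazy_path \<alpha>' \<odot> lazy_arrow g') \<odot> lazy_path \<sigma>"
proof -
  have r: "rev_path \<sigma>' \<in> sitting_paths X0" by (rule rev_path_sitting[OF charted_X0 sit(6)])
  have c: "concat_path \<alpha>' \<tau> \<in> sitting_paths X0"
    by (rule concat_path_sitting[OF charted_X0 sit(3,2) ends(7)])
  have "\<alpha>' 1 \<in> obj G" using path_obj[OF sit(2)] by simp
  note u = unt_mor[OF this] tgt_unt[OF this] src_unt[OF this]
  note F = P m sit ends r c u lazy_cmp_facts[where ?X0.0 = X0] lazy_cmp_assoc[where ?X0.0 = X0]
  have "lazy_path (rev_path \<sigma>') \<odot> lazy_path \<alpha>' \<odot> lazy_path \<tau> \<simeq> lazy_path (rev_path \<sigma>') \<odot> lazy_path (concat_path \<alpha>' \<tau>)"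
    by (rule eqv_cmp_left[OF eqv_concat[OF sit(3,2) ends(7)]]) (simp_all add: F)
  also have "\<dots> \<simeq> lazy_path (concat_path (rev_path \<sigma>') (concat_path \<alpha>' \<tau>))"
    using ends by (intro eqv_concat[OF c r]) simp
  also have "\<dots> \<simeq> lazy_path \<alpha>" by (rule equivclp_sym[OF eqv_thin[OF thin]])
  finally have pa: "lazy_path \<alpha> \<simeq> lazy_path (rev_path \<sigma>') \<odot> lazy_path \<alpha>' \<odot> lazy_path \<tau>"
    by (rule equivclp_sym)
  have "lazy_path \<tau>' \<odot> \<Gamma> \<odot> lazy_path \<alpha> \<odot> lazy_arrow g = (lazy_path \<tau>' \<odot> \<Gamma>) \<odot> lazy_path \<alpha> \<odot> lazy_arrow g"
    by (simp add: F)
  also have "\<dots> \<simeq> (\<Gamma>' \<odot> lazy_path \<sigma>') \<odot> lazy_path \<alpha> \<odot> lazy_arrow g"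
    by (rule eqv_cmp_right[OF IH]) (simp_all add: F)
  also have "\<dots> \<simeq> (\<Gamma>' \<odot> lazy_path \<sigma>') \<odot> (lazy_path (rev_path \<sigma>') \<odot> lazy_path \<alpha>' \<odot> lazy_path \<tau>) \<odot> lazy_arrow g"
    by (rule eqv_cmp_left[OF eqv_cmp_right[OF pa]]) (simp_all add: F)
  also have "\<dots> = \<Gamma>' \<odot> (lazy_path \<sigma>' \<odot> lazy_path (rev_path \<sigma>')) \<odot> lazy_path \<alpha>' \<odot> lazy_path \<tau> \<odot> lazy_arrow g"
    by (simp add: F)
  also have "\<dots> \<simeq> \<Gamma>' \<odot> lazy_arrow (unt G (\<alpha>' 1)) \<odot> lazy_path \<alpha>' \<odot> lazy_path \<tau> \<odot> lazy_arrow g"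
    using eqv_path_rev[OF sit(6)] by (intro eqv_cmp_left eqv_cmp_right) (simp_all add: F)
  also have "\<dots> = \<Gamma>' \<odot> lazy_path \<alpha>' \<odot> lazy_path \<tau> \<odot> lazy_arrow g"
    by (subst cmp_unt(2)) (simp_all add: F)
  also have "\<dots> \<simeq> \<Gamma>' \<odot> lazy_path \<alpha>' \<odot> lazy_arrow g' \<odot> lazy_path \<sigma>"
    by (intro eqv_cmp_left[OF eqv_cmp_left[OF tr]]) (simp_all add: F)
  also have "\<dots> = (\<Gamma>' \<odot> lazy_path \<alpha>' \<odot> lazy_arrow g') \<odot> lazy_path \<sigma>"
    by (simp add: F)
  finally show ?thesis .
qed

text \<open>For a thin deformation the outer paths are constant. The induction needs the statement for
  arbitrary ones, since the part of a deformation that remains after its first step begins with a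
  path \<open>s \<circ> \<zeta>\<^sub>1\<close> that need not be constant.\<close>

lemma eqv_square:
  assumes "lazy_list X0 G \<gamma>s \<alpha>s" "lazy_list X0 G \<gamma>s' \<alpha>s'" "length \<alpha>s' = length \<alpha>s"
    and "\<And>i. i \<le> length \<alpha>s \<Longrightarrow> \<zeta> i \<in> sitting_paths X1 \<and> \<zeta> i 0 = \<gamma>s ! i \<and> \<zeta> i 1 = \<gamma>s' ! i"
    and "\<And>i. i < length \<alpha>s \<Longrightarrow> thin_homotopic X0 (\<alpha>s ! i)
          (concat_path (rev_path (map_path (src G) (\<zeta> (Suc i))))
             (concat_path (\<alpha>s' ! i) (map_path (tgt G) (\<zeta> i))))"
  shows "lazy_path (map_path (tgt G) (\<zeta> (length \<alpha>s))) \<odot> (\<gamma>s, \<alpha>s) \<simeq> (\<gamma>s', \<alpha>s') \<odot> lazy_path (map_path (src G) (\<zeta> 0))"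
  using assms
proof (induction \<alpha>s arbitrary: \<gamma>s \<gamma>s' \<alpha>s' \<zeta>)
  case Nil
  obtain g where g: "\<gamma>s = [g]" using lazy_list_length[OF Nil.prems(1)] by (cases \<gamma>s) auto
  have "\<alpha>s' = []" using Nil.prems by simp
  moreover obtain g' where g': "\<gamma>s' = [g']" using lazy_list_length[OF Nil.prems(2)] Nil.prems(3) by (cases \<gamma>s') auto
  moreover have "\<zeta> 0 \<in> sitting_paths X1" "\<zeta> 0 0 = g" "\<zeta> 0 1 = g'" using Nil.prems(4)[of 0] g g' by simp_all
  ultimately show ?case using eqv_transport[of "\<zeta> 0"] g by (simp add: lazy_arrow_def)
next
  case (Cons \<alpha> \<alpha>s)
  obtain \<alpha>' \<beta>s where A: "\<alpha>s' = \<alpha>' # \<beta>s" using Cons.prems(3) by (cases \<alpha>s') auto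
  obtain g h \<gamma>1 where \<gamma>: "\<gamma>s = g # h # \<gamma>1"
    using lazy_list_length[OF Cons.prems(1)] by (cases \<gamma>s rule: remdups_adj.cases) auto
  obtain g' h' \<gamma>1' where \<gamma>': "\<gamma>s' = g' # h' # \<gamma>1'"
    using lazy_list_length[OF Cons.prems(2)] Cons.prems(3) by (cases \<gamma>s' rule: remdups_adj.cases) auto
  let ?n = "length \<alpha>s"
  let ?T = "\<lambda>i. map_path (tgt G) (\<zeta> i)"
  let ?S = "\<lambda>i. map_path (src G) (\<zeta> i)"
  have l: "lazy_list X0 G (g # h # \<gamma>1) (\<alpha> # \<alpha>s)" "lazy_list X0 G (g' # h' # \<gamma>1') (\<alpha>' # \<beta>s)"
    using Cons.prems(1,2) by (simp_all add: \<gamma> \<gamma>' A)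
  have l1: "lazy_list X0 G (h # \<gamma>1) \<alpha>s" "lazy_list X0 G (h' # \<gamma>1') \<beta>s" using l by simp_all
  have \<zeta>: "\<zeta> i \<in> sitting_paths X1" "\<zeta> i 0 = \<gamma>s ! i" "\<zeta> i 1 = \<gamma>s' ! i" if "i \<le> Suc ?n" for i
    using Cons.prems(4)[of i] that by simp_all
  have S: "?S i \<in> sitting_paths X0" "?T i \<in> sitting_paths X0" if "i \<le> Suc ?n" for i
    by (rule src_path[OF \<zeta>(1)[OF that]]) (rule tgt_path[OF \<zeta>(1)[OF that]])
  have tgt1: "lazy_tgt G (h # \<gamma>1, \<alpha>s) = ?T (Suc ?n) 0"
  proof -
    have "last (h # \<gamma>1) = (h # \<gamma>1) ! ?n" using lazy_list_length[OF l1(1)] by (subst last_conv_nth) auto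
    then show ?thesis using \<zeta>(2)[of "Suc ?n"] by (simp add: lazy_tgt_def \<gamma>)
  qed
  have "lazy_path (?T (Suc ?n)) \<odot> (h # \<gamma>1, \<alpha>s) \<odot> lazy_path \<alpha> \<odot> lazy_arrow g
     \<simeq> ((h' # \<gamma>1', \<beta>s) \<odot> lazy_path \<alpha>' \<odot> lazy_arrow g') \<odot> lazy_path (?S 0)"
  proof (rule eqv_square_step)
    show "lazy_path (?T (Suc ?n)) \<odot> (h # \<gamma>1, \<alpha>s) \<simeq> (h' # \<gamma>1', \<beta>s) \<odot> lazy_path (?S (Suc 0))"
    proof (rule Cons.IH[OF l1, of "\<lambda>i. \<zeta> (Suc i)"])
      show "length \<beta>s = length \<alpha>s" using Cons.prems(3) A by simp
      show "\<zeta> (Suc i) \<in> sitting_paths X1 \<and> \<zeta> (Suc i) 0 = (h # \<gamma>1) ! i \<and> \<zeta> (Suc i) 1 = (h' # \<gamma>1') ! i"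
        if "i \<le> length \<alpha>s" for i using \<zeta>[of "Suc i"] that by (simp add: \<gamma> \<gamma>')
      show "thin_homotopic X0 (\<alpha>s ! i) (concat_path (rev_path (map_path (src G) (\<zeta> (Suc (Suc i)))))
             (concat_path (\<beta>s ! i) (map_path (tgt G) (\<zeta> (Suc i)))))" if "i < length \<alpha>s" for i
        using Cons.prems(5)[of "Suc i"] that by (simp add: A)
    qed
    show "thin_homotopic X0 \<alpha> (concat_path (rev_path (?S (Suc 0))) (concat_path \<alpha>' (?T 0)))"
      using Cons.prems(5)[of 0] by (simp add: A)
    show "lazy_path (?T 0) \<odot> lazy_arrow g \<simeq> lazy_arrow g' \<odot> lazy_path (?S 0)"
      using eqv_transport[OF \<zeta>(1)[of 0]] \<zeta>[of 0] by (simp add: \<gamma> \<gamma>')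
  qed (use l l1 S tgt1 \<zeta>(2,3)[of 0] \<zeta>(2,3)[of "Suc 0"] in \<open>simp_all add: lazy_paths_iff \<gamma> \<gamma>'\<close>)
  then show ?case
    using lazy_Cons_decompose[OF l(1)] lazy_Cons_decompose[OF l(2)] by (simp add: \<gamma> \<gamma>' A)
qed

lemma thin_deformation_eqv:
  assumes "\<Gamma> \<in> \<P>" "\<Gamma>' \<in> \<P>" "thin_deformation X0 X1 G \<Gamma> \<Gamma>'"
  shows "\<Gamma> \<simeq> \<Gamma>'"
proof -
  obtain \<gamma>s \<alpha>s \<gamma>s' \<alpha>s' where \<Gamma>: "\<Gamma> = (\<gamma>s, \<alpha>s)" "\<Gamma>' = (\<gamma>s', \<alpha>s')" by (metis surj_pair)
  obtain \<zeta> where len: "length \<alpha>s' = length \<alpha>s"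
    and \<zeta>: "\<forall>i\<le>length \<alpha>s. \<zeta> i \<in> sitting_paths X1 \<and> \<zeta> i 0 = \<gamma>s ! i \<and> \<zeta> i 1 = \<gamma>s' ! i"
    and thin: "\<forall>i<length \<alpha>s. thin_homotopic X0 (\<alpha>s ! i)
          (concat_path (rev_path (map_path (src G) (\<zeta> (Suc i))))
             (concat_path (\<alpha>s' ! i) (map_path (tgt G) (\<zeta> i))))"
    and c: "is_const_path (map_path (src G) (\<zeta> 0))" "is_const_path (map_path (tgt G) (\<zeta> (length \<alpha>s)))"
    using assms(3) unfolding \<Gamma> thin_deformation_def by auto
  have l: "lazy_list X0 G \<gamma>s \<alpha>s" "lazy_list X0 G \<gamma>s' \<alpha>s'" using assms(1,2) by (simp_all add: \<Gamma> lazy_paths_iff)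
  have const: "lazy_path \<alpha> \<simeq> lazy_arrow (unt G (\<alpha> 0))" if "is_const_path \<alpha>" "\<alpha> \<in> sitting_paths X0" for \<alpha>
  proof -
    obtain x where x: "\<alpha> = const_path x" using \<open>is_const_path \<alpha>\<close> by (auto simp: is_const_path_def)
    then show ?thesis using eqv_const[of x] path_obj[OF that(2), of 0] by simp
  qed
  let ?\<tau> = "map_path (tgt G) (\<zeta> (length \<alpha>s))" and ?\<sigma> = "map_path (src G) (\<zeta> 0)"
  have \<tau>: "?\<tau> \<in> sitting_paths X0" using \<zeta> by (intro tgt_path) simp
  have \<sigma>: "?\<sigma> \<in> sitting_paths X0" using \<zeta> by (intro src_path) simp
  have ne: "\<gamma>s \<noteq> []" "\<gamma>s' \<noteq> []" using lazy_list_length[OF l(1)] lazy_list_length[OF l(2)] by auto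
  have t: "lazy_tgt G \<Gamma> = ?\<tau> 0"
    using \<zeta> lazy_list_length[OF l(1)] ne by (simp add: lazy_tgt_def \<Gamma> last_conv_nth)
  have s: "lazy_src G \<Gamma>' = ?\<sigma> 1"
    using \<zeta> ne by (simp add: lazy_src_def \<Gamma> hd_conv_nth)
  have s': "?\<sigma> 0 = ?\<sigma> 1" by (rule const_path_ends[OF c(1)])
  have "\<Gamma> = lazy_arrow (unt G (?\<tau> 0)) \<odot> \<Gamma>" by (rule cmp_unt(2)[OF assms(1) t, symmetric])
  also have "\<dots> \<simeq> lazy_path ?\<tau> \<odot> \<Gamma>"
    by (rule equivclp_sym, rule eqv_cmp_right[OF const[OF c(2) \<tau>] _ assms(1)]) (simp_all add: \<tau> t)
  also have "\<dots> \<simeq> \<Gamma>' \<odot> lazy_path ?\<sigma>"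
    unfolding \<Gamma> by (rule eqv_square[OF l len]) (use \<zeta> thin in auto)
  also have "\<dots> \<simeq> \<Gamma>' \<odot> lazy_arrow (unt G (?\<sigma> 0))"
    using s s' by (intro eqv_cmp_left[OF const[OF c(1) \<sigma>] _ assms(2)]) (simp_all add: \<sigma>)
  also have "\<dots> = \<Gamma>'" by (rule cmp_unt(1)[OF assms(2)]) (simp only: s s')
  finally show ?thesis .
qed

text \<open>The arrows are deformed along constant paths. The paths left alone by the replacement, too, have
  to be compared with their concatenations with constants.\<close>

lemma thin_replacement_deformation:
  assumes "\<Gamma> \<in> \<P>" "\<Gamma>' \<in> \<P>" "thin_replacement X0 \<Gamma> \<Gamma>'"
  shows "thin_deformation X0 X1 G \<Gamma> \<Gamma>'"
  using assms(3)
proof cases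
  case (1 \<alpha> \<beta> \<gamma>s \<alpha>s \<alpha>s')
  let ?l = "\<alpha>s @ [\<alpha>] @ \<alpha>s'" and ?l' = "\<alpha>s @ [\<beta>] @ \<alpha>s'"
  have P: "(\<gamma>s, ?l) \<in> \<P>" "(\<gamma>s, ?l') \<in> \<P>" using assms 1 by simp_all
  let ?\<zeta> = "\<lambda>i. const_path (\<gamma>s ! i)"
  have mem: "\<gamma>s ! i \<in> mor G" if "i \<le> length ?l" for i
    using P(1) that unfolding lazy_paths_def by (auto intro!: nth_mem[THEN subsetD[rotated]])
  have const: "map_path f (const_path y) = const_path (f y)" for f :: "'m \<Rightarrow> 'o" and y
    by (auto simp: map_path_def const_path_def fun_eq_iff)
  have rconst: "rev_path (const_path y) = const_path y" for y :: 'o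
    by (auto simp: rev_path_def const_path_def fun_eq_iff)
  have "thin_homotopic X0 (?l ! i)
     (concat_path (const_path (src G (\<gamma>s ! Suc i))) (concat_path (?l' ! i) (const_path (tgt G (\<gamma>s ! i)))))"
    if i: "i < length ?l" for i
  proof -
    have "thin_homotopic X0 (?l ! i) (?l' ! i)"
    proof (cases "i = length \<alpha>s")
      case True
      then show ?thesis using 1(3) by simp
    next
      case False
      then have "?l ! i = ?l' ! i" by (simp add: nth_append nth_Cons')
      moreover have "?l ! i \<in> sitting_paths X0"
        using P(1) nth_mem[OF i] unfolding lazy_paths_def by auto
      ultimately show ?thesis using thin_homotopic_refl[OF charted_X0] by simp
    qed
    moreover have "(?l' ! i) 0 = tgt G (\<gamma>s ! i)" "(?l' ! i) 1 = src G (\<gamma>s ! Suc i)"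
      using P(2) i unfolding lazy_paths_def by auto
    ultimately show ?thesis using thin_homotopic_pad[OF charted_X0, of "?l ! i" "?l' ! i"] by simp
  qed
  moreover have "?\<zeta> i \<in> sitting_paths X1" if "i \<le> length ?l" for i
    using mem[OF that] mor_eq by (intro const_path_sitting[OF charted_X1]) simp
  ultimately have "thin_deformation X0 X1 G (\<gamma>s, ?l) (\<gamma>s, ?l')"
    unfolding thin_deformation_def prod.case
    by (intro conjI exI[of _ ?\<zeta>] allI impI) (simp_all add: const rconst is_const_path_def, blast+)
  then show ?thesis using 1 by simp
qed

lemma equivclp_le:
  assumes "\<And>x y. r x y \<Longrightarrow> equivclp s x y" "equivclp r x y" shows "equivclp s x y"
  using assms(2)
proof (induction rule: equivclp_induct)
  case (step y z)
  then have "equivclp s y z" using assms(1) equivclp_sym by metis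
  with step.IH show ?case by (rule equivclp_trans)
qed simp

lemma lazy_thin_homotopy_iff:
  "(\<Gamma>, \<Gamma>') \<in> lazy_thin_homotopy X0 X1 G \<longleftrightarrow> \<Gamma> \<in> \<P> \<and> \<Gamma>' \<in> \<P> \<and> \<Gamma> \<simeq> \<Gamma>'"
proof -
  have 1: "\<Gamma> \<simeq> \<Gamma>'" if "lazy_move X0 X1 G \<Gamma> \<Gamma>'" for \<Gamma> \<Gamma>'
    using that thin_deformation_eqv local_moveI unfolding lazy_move_def by blast
  have 2: "equivclp (lazy_move X0 X1 G) \<Gamma> \<Gamma>'" if "local_move X0 X1 G \<Gamma> \<Gamma>'" for \<Gamma> \<Gamma>'
    using that thin_replacement_deformation unfolding local_move_def lazy_move_def by blast
  have "equivclp (lazy_move X0 X1 G) \<Gamma> \<Gamma>' \<longleftrightarrow> \<Gamma> \<simeq> \<Gamma>'"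
    using equivclp_le[of "lazy_move X0 X1 G" "local_move X0 X1 G"] equivclp_le[of "local_move X0 X1 G" "lazy_move X0 X1 G"] 1 2
    by blast
  then show ?thesis by (simp add: lazy_thin_homotopy_def)
qed

end

section \<open>The thin fundamental groupoid\<close>

lemma UN_eq_const: "x \<in> A \<Longrightarrow> (\<And>y. y \<in> A \<Longrightarrow> f y = B) \<Longrightarrow> (\<Union>y\<in>A. f y) = B"
  by auto

context lie_groupoid
begin

lemma lazy_unt_eq: "lazy_unt G x = lazy_path (const_path x)"
  by (simp add: lazy_unt_def lazy_path_def)

lemma const_path_obj: "x \<in> obj G \<Longrightarrow> const_path x \<in> sitting_paths X0"
  using const_path_sitting[OF charted_X0] obj_eq by simp

lemmas cat_facts = lazy_cmp_facts[where ?X0.0 = X0]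
lemmas cat_assoc = lazy_cmp_assoc[where ?X0.0 = X0]

lemma lazy_src_obj: "\<Gamma> \<in> \<P> \<Longrightarrow> lazy_src G \<Gamma> \<in> obj G"
  by (erule lazy_splitE_first) (simp add: src_obj)

lemma lazy_tgt_obj: "\<Gamma> \<in> \<P> \<Longrightarrow> lazy_tgt G \<Gamma> \<in> obj G"
  by (erule lazy_splitE_last) (simp add: tgt_obj)

lemma lazy_ivs_Cons:
  assumes "lazy_list X0 G (g # h # \<gamma>s) (\<alpha> # \<alpha>s)"
  shows "lazy_ivs G (g # h # \<gamma>s, \<alpha> # \<alpha>s) =
    lazy_arrow (ivs G g) \<odot> lazy_path (rev_path \<alpha>) \<odot> lazy_ivs G (h # \<gamma>s, \<alpha>s)"
proof -
  have m: "g \<in> mor G" "h \<in> mor G" "tgt G g = \<alpha> 0" "src G h = \<alpha> 1"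
    using assms lazy_list_mor[OF assms] by simp_all
  let ?xs = "rev (map (ivs G) \<gamma>s)" and ?as = "rev (map rev_path \<alpha>s)"
  have 1: "lazy_ivs G (h # \<gamma>s, \<alpha>s) = (?xs @ [ivs G h], ?as)" by (simp add: lazy_ivs_def)
  have "cmp G (unt G (\<alpha> 1)) (ivs G h) = ivs G h"
    using cmp_unt_left[OF ivs_mor[OF m(2)]] tgt_ivs[OF m(2)] m(4) by simp
  then have 2: "lazy_path (rev_path \<alpha>) \<odot> lazy_ivs G (h # \<gamma>s, \<alpha>s) = ((?xs @ [ivs G h]) @ [unt G (\<alpha> 0)], ?as @ [rev_path \<alpha>])"
    unfolding 1 lazy_path_def by simp
  have "cmp G (ivs G g) (unt G (\<alpha> 0)) = ivs G g"
    using cmp_unt_right[OF ivs_mor[OF m(1)]] src_ivs[OF m(1)] m(3) by simp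
  then show ?thesis unfolding 2 lazy_arrow_def lazy_cmp_append by (simp add: lazy_ivs_def)
qed

lemma eqv_ivs_step:
  assumes P: "\<Gamma> \<in> \<P>" "\<Gamma>' \<in> \<P>" and m: "g \<in> mor G" and sit: "\<alpha> \<in> sitting_paths X0"
    and ends: "lazy_src G \<Gamma> = \<alpha> 1" "tgt G g = \<alpha> 0" "lazy_src G \<Gamma>' = lazy_tgt G \<Gamma>" "lazy_tgt G \<Gamma>' = \<alpha> 1"
    and IH: "\<Gamma>' \<odot> \<Gamma> \<simeq> lazy_arrow (unt G (\<alpha> 1))"
  shows "(lazy_arrow (ivs G g) \<odot> lazy_path (rev_path \<alpha>) \<odot> \<Gamma>') \<odot> \<Gamma> \<odot> lazy_path \<alpha> \<odot> lazy_arrow g \<simeq> lazy_arrow (unt G (src G g))"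
proof -
  have r: "rev_path \<alpha> \<in> sitting_paths X0" by (rule rev_path_sitting[OF charted_X0 sit])
  have i: "ivs G g \<in> mor G" "src G (ivs G g) = \<alpha> 0" "tgt G (ivs G g) = src G g"
    using m ends by (simp_all add: ivs_mor src_ivs tgt_ivs)
  have o: "\<alpha> 0 \<in> obj G" "\<alpha> 1 \<in> obj G" using path_obj[OF sit] by simp_all
  note F = P m sit ends r i cat_facts cat_assoc unt_mor[OF o(1)] unt_mor[OF o(2)]
    src_unt[OF o(1)] src_unt[OF o(2)] tgt_unt[OF o(1)] tgt_unt[OF o(2)]
  have "(lazy_arrow (ivs G g) \<odot> lazy_path (rev_path \<alpha>) \<odot> \<Gamma>') \<odot> \<Gamma> \<odot> lazy_path \<alpha> \<odot> lazy_arrow g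
     = lazy_arrow (ivs G g) \<odot> lazy_path (rev_path \<alpha>) \<odot> (\<Gamma>' \<odot> \<Gamma>) \<odot> lazy_path \<alpha> \<odot> lazy_arrow g"
    by (simp add: F)
  also have "\<dots> \<simeq> lazy_arrow (ivs G g) \<odot> lazy_path (rev_path \<alpha>) \<odot> lazy_arrow (unt G (\<alpha> 1)) \<odot> lazy_path \<alpha> \<odot> lazy_arrow g"
    by (intro eqv_cmp_left eqv_cmp_right IH) (simp_all add: F)
  also have "\<dots> = lazy_arrow (ivs G g) \<odot> (lazy_path (rev_path \<alpha>) \<odot> lazy_path \<alpha>) \<odot> lazy_arrow g"
    by (subst cmp_unt(2)) (simp_all add: F)
  also have "\<dots> \<simeq> lazy_arrow (ivs G g) \<odot> lazy_arrow (unt G (\<alpha> 0)) \<odot> lazy_arrow g"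
    by (intro eqv_cmp_left eqv_cmp_right eqv_rev_path) (simp_all add: F)
  also have "\<dots> = lazy_arrow (ivs G g) \<odot> lazy_arrow g"
    by (subst cmp_unt(2)) (simp_all add: F)
  also have "\<dots> = lazy_arrow (unt G (src G g))" by (simp add: lazy_arrow_cmp cmp_ivs_left[OF m])
  finally show ?thesis .
qed

text \<open>Cancellation starts in the middle of \<open>\<Gamma>\<^sup>-\<^sup>1 \<cdot> \<Gamma>\<close>, so the induction is over the part of \<open>\<Gamma>\<close> after
  its first arrow and path, and each step cancels what encloses it.\<close>

lemma lazy_ivs_facts:
  assumes "\<Gamma> \<in> \<P>"
  shows "lazy_ivs G \<Gamma> \<in> \<P>" "lazy_src G (lazy_ivs G \<Gamma>) = lazy_tgt G \<Gamma>" "lazy_tgt G (lazy_ivs G \<Gamma>) = lazy_src G \<Gamma>"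
    "lazy_ivs G \<Gamma> \<odot> \<Gamma> \<simeq> lazy_arrow (unt G (lazy_src G \<Gamma>))"
proof -
  have "lazy_ivs G (\<gamma>s, \<alpha>s) \<in> \<P> \<and> lazy_src G (lazy_ivs G (\<gamma>s, \<alpha>s)) = lazy_tgt G (\<gamma>s, \<alpha>s) \<and>
      lazy_tgt G (lazy_ivs G (\<gamma>s, \<alpha>s)) = lazy_src G (\<gamma>s, \<alpha>s) \<and>
      lazy_ivs G (\<gamma>s, \<alpha>s) \<odot> (\<gamma>s, \<alpha>s) \<simeq> lazy_arrow (unt G (lazy_src G (\<gamma>s, \<alpha>s)))"
    if "lazy_list X0 G \<gamma>s \<alpha>s" for \<gamma>s \<alpha>s
    using that
  proof (induction \<alpha>s arbitrary: \<gamma>s)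
    case Nil
    obtain g where g: "\<gamma>s = [g]" using lazy_list_length[OF Nil.prems] by (cases \<gamma>s) auto
    then have m: "g \<in> mor G" using Nil.prems by simp
    have "(\<gamma>s, []) = lazy_arrow g" "lazy_ivs G (\<gamma>s, []) = lazy_arrow (ivs G g)"
      by (simp_all add: g lazy_arrow_def lazy_ivs_def)
    then show ?case using m by (simp add: lazy_arrow_cmp cmp_ivs_left ivs_mor src_ivs tgt_ivs)
  next
    case (Cons \<alpha> \<alpha>s)
    obtain g h \<gamma>1 where \<gamma>: "\<gamma>s = g # h # \<gamma>1"
      using lazy_list_length[OF Cons.prems] by (cases \<gamma>s rule: remdups_adj.cases) auto
    have l: "lazy_list X0 G (g # h # \<gamma>1) (\<alpha> # \<alpha>s)" using Cons.prems \<gamma> by simp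
    then have l1: "lazy_list X0 G (h # \<gamma>1) \<alpha>s" and m: "g \<in> mor G" and sit: "\<alpha> \<in> sitting_paths X0"
      and e: "tgt G g = \<alpha> 0" "src G h = \<alpha> 1" by simp_all
    note IH = Cons.IH[OF l1]
    define \<Gamma> where "\<Gamma> = (h # \<gamma>1, \<alpha>s)"
    have \<Gamma>: "\<Gamma> \<in> \<P>" "lazy_src G \<Gamma> = \<alpha> 1" using l1 e by (simp_all add: \<Gamma>_def lazy_paths_iff)
    note IH = IH[folded \<Gamma>_def]
    note r = rev_path_sitting[OF charted_X0 sit]
    have d: "(\<gamma>s, \<alpha> # \<alpha>s) = \<Gamma> \<odot> lazy_path \<alpha> \<odot> lazy_arrow g"
      unfolding \<gamma> \<Gamma>_def by (rule lazy_Cons_decompose[OF l])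
    have i: "lazy_ivs G (\<gamma>s, \<alpha> # \<alpha>s) = lazy_arrow (ivs G g) \<odot> lazy_path (rev_path \<alpha>) \<odot> lazy_ivs G \<Gamma>"
      unfolding \<gamma> \<Gamma>_def by (rule lazy_ivs_Cons[OF l])
    note F = \<Gamma> IH m sit e r cat_facts ivs_mor src_ivs tgt_ivs
    have "(lazy_arrow (ivs G g) \<odot> lazy_path (rev_path \<alpha>) \<odot> lazy_ivs G \<Gamma>) \<odot> \<Gamma> \<odot> lazy_path \<alpha> \<odot> lazy_arrow g
       \<simeq> lazy_arrow (unt G (src G g))"
      using IH by (intro eqv_ivs_step) (simp_all add: \<Gamma> m sit e)
    then show ?case unfolding i unfolding d by (simp add: F)
  qed
  from this[of "fst \<Gamma>" "snd \<Gamma>"] assms lazy_paths_iff[of "fst \<Gamma>" "snd \<Gamma>" X0 G]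
  show "lazy_ivs G \<Gamma> \<in> \<P>" "lazy_src G (lazy_ivs G \<Gamma>) = lazy_tgt G \<Gamma>" "lazy_tgt G (lazy_ivs G \<Gamma>) = lazy_src G \<Gamma>"
    "lazy_ivs G \<Gamma> \<odot> \<Gamma> \<simeq> lazy_arrow (unt G (lazy_src G \<Gamma>))" by simp_all
qed

lemma lazy_ivs_ivs: 
  assumes "\<Gamma> \<in> \<P>" shows "lazy_ivs G (lazy_ivs G \<Gamma>) = \<Gamma>"
proof -
  obtain \<gamma>s \<alpha>s where \<Gamma>: "\<Gamma> = (\<gamma>s, \<alpha>s)" by (cases \<Gamma>)
  have "set \<gamma>s \<subseteq> mor G" "set \<alpha>s \<subseteq> sitting_paths X0" using assms by (simp_all add: \<Gamma> lazy_paths_def)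
  then have "map (ivs G \<circ> ivs G) \<gamma>s = \<gamma>s" "map (rev_path \<circ> rev_path) \<alpha>s = \<alpha>s"
    by (auto intro!: map_idI simp: ivs_ivs rev_rev_path)
  then show ?thesis by (simp add: \<Gamma> lazy_ivs_def rev_map)
qed

lemma eqv_cmp_ivs:
  assumes "\<Gamma> \<in> \<P>" shows "\<Gamma> \<odot> lazy_ivs G \<Gamma> \<simeq> lazy_arrow (unt G (lazy_tgt G \<Gamma>))"
  using lazy_ivs_facts[OF lazy_ivs_facts(1)[OF assms]] lazy_ivs_facts(2)[OF assms] lazy_ivs_ivs[OF assms] by simp

text \<open>
  Inverses in a category are unique, so there is no need to follow the moves through the reversal
  of lazy paths.\<close>

lemma eqv_ivs:
  assumes e: "\<Gamma> \<simeq> \<Gamma>'" and \<Gamma>: "\<Gamma> \<in> \<P>"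
  shows "lazy_ivs G \<Gamma> \<simeq> lazy_ivs G \<Gamma>'"
proof -
  note \<Gamma>' = eqv_facts[OF e \<Gamma>] and i = lazy_ivs_facts[OF \<Gamma>]
  note i' = lazy_ivs_facts[OF \<Gamma>'(1), unfolded \<Gamma>'(2,3)]
  have o: "lazy_src G \<Gamma> \<in> obj G" "lazy_tgt G \<Gamma> \<in> obj G" by (rule lazy_src_obj[OF \<Gamma>], rule lazy_tgt_obj[OF \<Gamma>])
  note F = \<Gamma> \<Gamma>' i(1-3) i'(1-3) cat_facts cat_assoc unt_mor[OF o(1)] unt_mor[OF o(2)]
    src_unt[OF o(1)] src_unt[OF o(2)] tgt_unt[OF o(1)] tgt_unt[OF o(2)]
  have "lazy_ivs G \<Gamma> = lazy_ivs G \<Gamma> \<odot> lazy_arrow (unt G (lazy_tgt G \<Gamma>))"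
    by (rule cmp_unt(1)[symmetric]) (simp_all add: F)
  also have "\<dots> \<simeq> lazy_ivs G \<Gamma> \<odot> (\<Gamma>' \<odot> lazy_ivs G \<Gamma>')"
    using equivclp_sym[OF eqv_cmp_ivs[OF \<Gamma>'(1)]] by (intro eqv_cmp_left) (simp_all add: F)
  also have "\<dots> \<simeq> lazy_ivs G \<Gamma> \<odot> (\<Gamma> \<odot> lazy_ivs G \<Gamma>')"
    using equivclp_sym[OF e] by (intro eqv_cmp_left eqv_cmp_right) (simp_all add: F)
  also have "\<dots> = (lazy_ivs G \<Gamma> \<odot> \<Gamma>) \<odot> lazy_ivs G \<Gamma>'" by (simp add: F)
  also have "\<dots> \<simeq> lazy_arrow (unt G (lazy_src G \<Gamma>)) \<odot> lazy_ivs G \<Gamma>'"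
    using i(4) by (intro eqv_cmp_right) (simp_all add: F)
  also have "\<dots> = lazy_ivs G \<Gamma>'" by (rule cmp_unt(2)) (simp_all add: F)
  finally show ?thesis .
qed

definition lazy_class :: "('o, 'm) lazy \<Rightarrow> ('o, 'm) lazy set" where
  "lazy_class \<Gamma> = lazy_thin_homotopy X0 X1 G `` {\<Gamma>}"

lemma lazy_class_mem: "\<Gamma> \<in> \<P> \<Longrightarrow> \<Gamma>' \<in> lazy_class \<Gamma> \<longleftrightarrow> \<Gamma> \<simeq> \<Gamma>'"
  using eqv_facts(1)[of \<Gamma> \<Gamma>'] unfolding lazy_class_def Image_singleton_iff lazy_thin_homotopy_iff by blast

lemma lazy_class_eq:
  assumes e: "\<Gamma> \<simeq> \<Gamma>'" and \<Gamma>: "\<Gamma> \<in> \<P>" shows "lazy_class \<Gamma> = lazy_class \<Gamma>'"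
proof (intro set_eqI)
  show "\<Delta> \<in> lazy_class \<Gamma> \<longleftrightarrow> \<Delta> \<in> lazy_class \<Gamma>'" for \<Delta>
    using equivclp_trans[OF e, of \<Delta>] equivclp_trans[OF equivclp_sym[OF e], of \<Delta>]
    unfolding lazy_class_mem[OF \<Gamma>] lazy_class_mem[OF eqv_facts(1)[OF e \<Gamma>]] by blast
qed

abbreviation thin where "thin \<equiv> thin_groupoid X0 X1 G"

lemma thin_obj: "obj thin = obj G"
  by (simp add: thin_groupoid_def Let_def)

lemma thin_mor: "mor thin = lazy_class ` \<P>"
  by (auto simp: thin_groupoid_def Let_def quotient_def lazy_class_def)

lemma thin_src: assumes "\<Gamma> \<in> \<P>" shows "src thin (lazy_class \<Gamma>) = lazy_src G \<Gamma>"
proof -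
  have "lazy_src G ` lazy_class \<Gamma> = {lazy_src G \<Gamma>}"
  proof (intro equalityI image_subsetI)
    fix \<Delta> assume "\<Delta> \<in> lazy_class \<Gamma>"
    then have "\<Gamma> \<simeq> \<Delta>" by (simp only: lazy_class_mem[OF assms])
    from eqv_facts(2)[OF this assms] show "lazy_src G \<Delta> \<in> {lazy_src G \<Gamma>}" by simp
  next
    have "\<Gamma> \<in> lazy_class \<Gamma>" by (simp add: lazy_class_mem assms)
    from imageI[OF this, of "lazy_src G"] show "{lazy_src G \<Gamma>} \<subseteq> lazy_src G ` lazy_class \<Gamma>" by simp
  qed
  then show ?thesis by (simp add: thin_groupoid_def Let_def)
qed

lemma thin_tgt: assumes "\<Gamma> \<in> \<P>" shows "tgt thin (lazy_class \<Gamma>) = lazy_tgt G \<Gamma>"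
proof -
  have "lazy_tgt G ` lazy_class \<Gamma> = {lazy_tgt G \<Gamma>}"
  proof (intro equalityI image_subsetI)
    fix \<Delta> assume "\<Delta> \<in> lazy_class \<Gamma>"
    then have "\<Gamma> \<simeq> \<Delta>" by (simp only: lazy_class_mem[OF assms])
    from eqv_facts(3)[OF this assms] show "lazy_tgt G \<Delta> \<in> {lazy_tgt G \<Gamma>}" by simp
  next
    have "\<Gamma> \<in> lazy_class \<Gamma>" by (simp add: lazy_class_mem assms)
    from imageI[OF this, of "lazy_tgt G"] show "{lazy_tgt G \<Gamma>} \<subseteq> lazy_tgt G ` lazy_class \<Gamma>" by simp
  qed
  then show ?thesis by (simp add: thin_groupoid_def Let_def)
qed

lemma thin_unt: "unt thin x = lazy_class (lazy_unt G x)"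
  by (simp add: thin_groupoid_def Let_def lazy_class_def)

lemma thin_cmp:
  assumes \<Delta>: "\<Delta> \<in> \<P>" and \<Gamma>: "\<Gamma> \<in> \<P>" and c: "lazy_src G \<Delta> = lazy_tgt G \<Gamma>"
  shows "cmp thin (lazy_class \<Delta>) (lazy_class \<Gamma>) = lazy_class (\<Delta> \<odot> \<Gamma>)"
proof -
  have "cmp thin (lazy_class \<Delta>) (lazy_class \<Gamma>) = (\<Union>\<Delta>'\<in>lazy_class \<Delta>. \<Union>\<Gamma>'\<in>lazy_class \<Gamma>. lazy_class (\<Delta>' \<odot> \<Gamma>'))"
    by (simp add: thin_groupoid_def Let_def lazy_class_def)
  also have "\<dots> = lazy_class (\<Delta> \<odot> \<Gamma>)"
  proof (intro UN_eq_const)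
    show "\<Delta> \<in> lazy_class \<Delta>" "\<Gamma> \<in> lazy_class \<Gamma>" by (simp_all add: lazy_class_mem \<Delta> \<Gamma>)
    fix \<Delta>' \<Gamma>' assume "\<Delta>' \<in> lazy_class \<Delta>" "\<Gamma>' \<in> lazy_class \<Gamma>"
    then have "\<Delta> \<simeq> \<Delta>'" "\<Gamma> \<simeq> \<Gamma>'" by (simp_all only: lazy_class_mem[OF \<Delta>] lazy_class_mem[OF \<Gamma>])
    then show "lazy_class (\<Delta>' \<odot> \<Gamma>') = lazy_class (\<Delta> \<odot> \<Gamma>)"
      by (intro lazy_class_eq[symmetric] eqv_cmp cat_facts \<Delta> \<Gamma> c)
  qed
  finally show ?thesis .
qed

lemma thin_ivs:
  assumes \<Gamma>: "\<Gamma> \<in> \<P>" shows "ivs thin (lazy_class \<Gamma>) = lazy_class (lazy_ivs G \<Gamma>)"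
proof -
  have "ivs thin (lazy_class \<Gamma>) = (\<Union>\<Gamma>'\<in>lazy_class \<Gamma>. lazy_class (lazy_ivs G \<Gamma>'))"
    by (simp add: thin_groupoid_def Let_def lazy_class_def)
  also have "\<dots> = lazy_class (lazy_ivs G \<Gamma>)"
  proof (intro UN_eq_const)
    show "\<Gamma> \<in> lazy_class \<Gamma>" by (simp add: lazy_class_mem \<Gamma>)
    fix \<Gamma>' assume "\<Gamma>' \<in> lazy_class \<Gamma>"
    then have "\<Gamma> \<simeq> \<Gamma>'" by (simp only: lazy_class_mem[OF \<Gamma>])
    then show "lazy_class (lazy_ivs G \<Gamma>') = lazy_class (lazy_ivs G \<Gamma>)"
      by (intro lazy_class_eq[symmetric] eqv_ivs lazy_ivs_facts \<Gamma>)
  qed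
  finally show ?thesis .
qed

lemma thin_unt_arrow: "x \<in> obj G \<Longrightarrow> unt thin x = lazy_class (lazy_arrow (unt G x))"
  unfolding thin_unt lazy_unt_eq by (intro lazy_class_eq eqv_const) (simp_all add: const_path_obj)

lemma groupoid_thin: "groupoid thin"
proof
  have c: "\<exists>\<Delta> \<Gamma>. h = lazy_class \<Delta> \<and> g = lazy_class \<Gamma> \<and> \<Delta> \<in> \<P> \<and> \<Gamma> \<in> \<P> \<and> lazy_src G \<Delta> = lazy_tgt G \<Gamma>"
    if "(h, g) \<in> composable thin" for h g
  proof -
    have "h \<in> lazy_class ` \<P>" "g \<in> lazy_class ` \<P>" "src thin h = tgt thin g"
      using that by (simp_all add: composable_def thin_mor)
    then obtain \<Delta> \<Gamma> where "h = lazy_class \<Delta>" "g = lazy_class \<Gamma>" "\<Delta> \<in> \<P>" "\<Gamma> \<in> \<P>" by (elim imageE)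
    moreover from this \<open>src thin h = tgt thin g\<close> have "lazy_src G \<Delta> = lazy_tgt G \<Gamma>"
      by (simp add: thin_src thin_tgt)
    ultimately show ?thesis by (intro exI[of _ \<Delta>] exI[of _ \<Gamma>]) simp
  qed
  show "src thin g \<in> obj thin" "tgt thin g \<in> obj thin" if "g \<in> mor thin" for g
    using that by (auto simp: thin_mor thin_obj thin_src thin_tgt lazy_src_obj lazy_tgt_obj)
  show "unt thin x \<in> mor thin" "src thin (unt thin x) = x" "tgt thin (unt thin x) = x" if "x \<in> obj thin" for x
    using that const_path_obj[of x]
    by (auto simp: thin_mor thin_obj thin_src thin_tgt thin_unt lazy_unt_eq)
  show "cmp thin h g \<in> mor thin" "src thin (cmp thin h g) = src thin g" "tgt thin (cmp thin h g) = tgt thin h"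
    if "(h, g) \<in> composable thin" for h g
    using c[OF that] cat_facts by (auto simp: thin_mor thin_cmp thin_src thin_tgt)
  show "cmp thin (cmp thin k h) g = cmp thin k (cmp thin h g)"
    if kh: "(k, h) \<in> composable thin" and hg: "(h, g) \<in> composable thin" for k h g
  proof -
    obtain \<Delta> \<Gamma> where 1: "h = lazy_class \<Delta>" "g = lazy_class \<Gamma>" "\<Delta> \<in> \<P>" "\<Gamma> \<in> \<P>" "lazy_src G \<Delta> = lazy_tgt G \<Gamma>"
      using c[OF hg] by blast
    obtain \<Omega> where 2: "k = lazy_class \<Omega>" "\<Omega> \<in> \<P>" using kh by (auto simp: composable_def thin_mor)
    have "lazy_src G \<Omega> = lazy_tgt G \<Delta>" using kh 1 2 by (simp add: composable_def thin_src thin_tgt)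
    with 1 2 show ?thesis by (simp add: thin_cmp cat_facts cat_assoc)
  qed
  fix g assume "g \<in> mor thin"
  then obtain \<Gamma> where \<Gamma>: "g = lazy_class \<Gamma>" "\<Gamma> \<in> \<P>" by (auto simp: thin_mor)
  note o = lazy_src_obj[OF \<Gamma>(2)] lazy_tgt_obj[OF \<Gamma>(2)] and i = lazy_ivs_facts[OF \<Gamma>(2)]
  note u = unt_mor[OF o(1)] unt_mor[OF o(2)] src_unt[OF o(1)] src_unt[OF o(2)] tgt_unt[OF o(1)] tgt_unt[OF o(2)]
  show "cmp thin g (unt thin (src thin g)) = g"
    using \<Gamma> o u by (simp add: thin_src thin_unt_arrow thin_cmp cmp_unt)
  show "cmp thin (unt thin (tgt thin g)) g = g"
    using \<Gamma> o u by (simp add: thin_tgt thin_unt_arrow thin_cmp cmp_unt)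
  show "ivs thin g \<in> mor thin" "src thin (ivs thin g) = tgt thin g" "tgt thin (ivs thin g) = src thin g"
    using \<Gamma> i by (simp_all add: thin_mor thin_ivs thin_src thin_tgt)
  show "cmp thin (ivs thin g) g = unt thin (src thin g)"
    using \<Gamma> i o by (simp add: thin_ivs thin_cmp thin_src thin_unt_arrow)
      (intro lazy_class_eq i(4) cat_facts; simp)
  show "cmp thin g (ivs thin g) = unt thin (tgt thin g)"
    using \<Gamma> i o by (simp add: thin_ivs thin_cmp thin_tgt thin_unt_arrow)
      (intro lazy_class_eq eqv_cmp_ivs cat_facts; simp)
qed

end

section \<open>Constructions of diffeological spaces\<close>

lemma plot_subset:
  assumes "diffeological_space D" "p \<in> plots D n U" "openin (Euclidean_space n) V" "V \<subseteq> U"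
  shows "p \<in> plots D n V"
proof -
  interpret diffeological_space D by fact
  have "p \<circ> (\<lambda>x. x) \<in> plots D n V"
    by (rule plot_smooth[OF assms(2) smooth_euclid_id[OF assms(3)]]) (use assms(4) in blast)
  then show ?thesis by (simp add: comp_def)
qed

lemma smooth_map_Rn:
  assumes f: "smooth_euclid n m U f" shows "smooth_map (Rn n) (Rn m) U f"
proof (rule smooth_mapI)
  have U: "openin (Euclidean_space n) U" "f ` U \<subseteq> Eucl m" using f by (simp_all add: smooth_euclid_iff)
  then show o: "openin (mtop (Rn n)) U" by (simp add: Rn_def)
  fix x assume x: "x \<in> U"
  have "smooth_euclid n m U (f \<circ> inv_into (Eucl n) (\<lambda>x. x))"
  proof (rule smooth_euclid_cong[OF _ f])
    fix z assume "z \<in> U"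
    then have "z \<in> Eucl n" using openin_Eucl_subset[OF U(1)] by blast
    then have "inv_into (Eucl n) (\<lambda>x. x) z = z" by (intro inv_into_f_eq) auto
    then show "f z = (f \<circ> inv_into (Eucl n) (\<lambda>x. x)) z" by simp
  qed
  then show "\<exists>W \<phi> V \<psi> B. (W, \<phi>) \<in> atlas (Rn n) \<and> (V, \<psi>) \<in> atlas (Rn m) \<and>
       openin (mtop (Rn n)) B \<and> x \<in> B \<and> B \<subseteq> W \<inter> U \<and> f ` B \<subseteq> V \<and>
       smooth_euclid (mdim (Rn n)) (mdim (Rn m)) (\<phi> ` B) (\<psi> \<circ> f \<circ> inv_into W \<phi>)"
    using x U o openin_Eucl_subset[OF U(1)]
    by (intro exI[of _ "Eucl n"] exI[of _ "\<lambda>x. x"] exI[of _ "Eucl m"] exI[of _ "\<lambda>x. x"] exI[of _ U])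
      (simp add: Rn_def comp_def)
qed

lemma openin_Rn [simp]: "openin (mtop (Rn n)) U \<longleftrightarrow> openin (Euclidean_space n) U"
  by (simp add: Rn_def)

lemma manifold_plots: "p \<in> plots (manifold_diffeology M) n U \<longleftrightarrow> smooth_map (Rn n) M U p"
  by (simp add: manifold_diffeology_def)

lemma diffeological_space_manifold:
  assumes M: "charted M" shows "diffeological_space (manifold_diffeology M)"
proof
  show "openin (Euclidean_space n) U" if "p \<in> plots (manifold_diffeology M) n U" for p n U
    using smooth_map_open[of "Rn n" M U p] that by (simp add: manifold_plots)
  show "p ` U \<subseteq> dcarrier (manifold_diffeology M)" if "p \<in> plots (manifold_diffeology M) n U" for p n U
    using smooth_map_range[OF M] that by (simp add: manifold_diffeology_def)
  show "q \<in> plots (manifold_diffeology M) n U"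
    if "p \<in> plots (manifold_diffeology M) n U" "\<And>x. x \<in> U \<Longrightarrow> q x = p x" for p q n U
    using that unfolding manifold_plots by (intro smooth_map_cong[OF charted_Rn _ that(1)[unfolded manifold_plots]]) simp
  show "(\<lambda>_. c) \<in> plots (manifold_diffeology M) n U"
    if "openin (Euclidean_space n) U" "c \<in> dcarrier (manifold_diffeology M)" for n U c
    unfolding manifold_plots using that by (intro smooth_map_const charted_Rn M) (simp_all add: manifold_diffeology_def)
  show "p \<in> plots (manifold_diffeology M) n U"
    if "openin (Euclidean_space n) U"
      "\<And>x. x \<in> U \<Longrightarrow> \<exists>V\<subseteq>U. x \<in> V \<and> p \<in> plots (manifold_diffeology M) n V" for n U p
    unfolding manifold_plots by (rule smooth_map_local) (use that(2)[unfolded manifold_plots] in blast)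
  show "p \<circ> f \<in> plots (manifold_diffeology M) m V"
    if "p \<in> plots (manifold_diffeology M) n U" "smooth_euclid m n V f" "f ` V \<subseteq> U" for p n U m V f
    unfolding manifold_plots
    by (rule smooth_map_compose[OF charted_Rn charted_Rn M smooth_map_Rn[OF that(2)] _ that(3)])
      (use that(1) in \<open>simp add: manifold_plots\<close>)
qed

abbreviation cylinder :: "nat \<Rightarrow> ((nat \<Rightarrow> real) \<times> real) manifold" where
  "cylinder n \<equiv> prod_manifold (Rn n) real_line"

lemma charted_cylinder: "charted (cylinder n)"
  by (intro charted_prod charted_Rn charted_real_line)

lemma openin_cylinder: "openin (Euclidean_space n) U \<Longrightarrow> openin (mtop (cylinder n)) (U \<times> UNIV)"
  by (simp add: mtop_prod openin_prod_Times_iff Rn_def)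

lemma path_plots: "p \<in> plots (path_diffeology M) n U \<longleftrightarrow> openin (Euclidean_space n) U \<and>
    p ` U \<subseteq> sitting_paths M \<and> smooth_on (cylinder n) M (U \<times> {0..1}) (\<lambda>(r, a). p r a)"
  by (simp add: path_diffeology_def)

lemma smooth_on_cylinder_fst:
  "openin (Euclidean_space n) U \<Longrightarrow> smooth_on (cylinder n) (Rn n) (U \<times> {0..1}) fst"
  by (rule smooth_on_of_map[OF smooth_map_fst[OF charted_Rn charted_real_line openin_cylinder]]) auto

lemma smooth_on_cylinder_snd:
  "openin (Euclidean_space n) U \<Longrightarrow> smooth_on (cylinder n) real_line (U \<times> {0..1}) snd"
  by (rule smooth_on_of_map[OF smooth_map_snd[OF charted_Rn charted_real_line openin_cylinder]]) auto

lemma diffeological_space_path: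
  assumes M: "charted M" shows "diffeological_space (path_diffeology M)"
proof
  show "openin (Euclidean_space n) U" if "p \<in> plots (path_diffeology M) n U" for p n U
    using that by (simp add: path_plots)
  show "p ` U \<subseteq> dcarrier (path_diffeology M)" if "p \<in> plots (path_diffeology M) n U" for p n U
    using that by (simp add: path_plots) (simp add: path_diffeology_def)
  show "q \<in> plots (path_diffeology M) n U"
    if p: "p \<in> plots (path_diffeology M) n U" and eq: "\<And>x. x \<in> U \<Longrightarrow> q x = p x" for p q n U
    unfolding path_plots
  proof (intro conjI)
    show "smooth_on (cylinder n) M (U \<times> {0..1}) (\<lambda>(r, a). q r a)"
      by (rule smooth_on_cong[of _ _ _ "\<lambda>(r, a). p r a"]) (use p eq in \<open>auto simp: path_plots\<close>)
    show "q ` U \<subseteq> sitting_paths M" using p eq by (simp add: path_plots image_subset_iff)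
  qed (use p in \<open>simp add: path_plots\<close>)
  show "(\<lambda>_. c) \<in> plots (path_diffeology M) n U"
    if U: "openin (Euclidean_space n) U" and c: "c \<in> dcarrier (path_diffeology M)" for n U c
    unfolding path_plots
  proof (intro conjI U)
    have c': "c \<in> sitting_paths M" using c by (simp add: path_diffeology_def)
    then show "(\<lambda>_. c) ` U \<subseteq> sitting_paths M" by blast
    have "smooth_on (cylinder n) M (U \<times> {0..1}) (\<lambda>x. c (snd x))"
      by (rule smooth_on_compose[OF charted_cylinder charted_real_line M smooth_on_cylinder_snd[OF U] sitting_path_smooth[OF c']])
        auto
    then show "smooth_on (cylinder n) M (U \<times> {0..1}) (\<lambda>(r, a). c a)" by (simp add: case_prod_beta')
  qed
  show "p \<in> plots (path_diffeology M) n U"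
    if U: "openin (Euclidean_space n) U"
      and ex: "\<And>x. x \<in> U \<Longrightarrow> \<exists>V\<subseteq>U. x \<in> V \<and> p \<in> plots (path_diffeology M) n V" for n U p
    unfolding path_plots
  proof (intro conjI U)
    show "p ` U \<subseteq> sitting_paths M" using ex unfolding path_plots by blast
    show "smooth_on (cylinder n) M (U \<times> {0..1}) (\<lambda>(r, a). p r a)"
    proof (rule smooth_on_local[OF charted_cylinder])
      fix x assume x: "x \<in> U \<times> {0..1::real}"
      then obtain V where V: "V \<subseteq> U" "fst x \<in> V" "p \<in> plots (path_diffeology M) n V" using ex[of "fst x"] by auto
      have "U \<times> {0..1} \<inter> V \<times> UNIV = V \<times> {0..1::real}" using V(1) by auto
      with V x show "\<exists>W. openin (mtop (cylinder n)) W \<and> x \<in> W \<and>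
          smooth_on (cylinder n) M (U \<times> {0..1} \<inter> W) (\<lambda>(r, a). p r a)"
        by (intro exI[of _ "V \<times> UNIV"]) (auto simp: path_plots intro: openin_cylinder)
    qed
  qed
  show "p \<circ> f \<in> plots (path_diffeology M) m V"
    if p: "p \<in> plots (path_diffeology M) n U" and f: "smooth_euclid m n V f" and fV: "f ` V \<subseteq> U" for p n U m V f
    unfolding path_plots
  proof (intro conjI)
    show V: "openin (Euclidean_space m) V" using f by (simp add: smooth_euclid_iff)
    show "(p \<circ> f) ` V \<subseteq> sitting_paths M" using p fV by (auto simp: path_plots)
    have "smooth_on (cylinder m) (Rn n) (V \<times> {0..1}) (\<lambda>x. f (fst x))"
      by (rule smooth_on_compose[OF charted_cylinder charted_Rn charted_Rn smooth_on_cylinder_fst[OF V]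
            smooth_on_of_map[OF smooth_map_Rn[OF f] order_refl]]) auto
    then have "smooth_on (cylinder m) (cylinder n) (V \<times> {0..1}) (\<lambda>x. (f (fst x), snd x))"
      by (rule smooth_on_pair[OF charted_cylinder charted_Rn charted_real_line _ smooth_on_cylinder_snd[OF V]])
    moreover have "smooth_on (cylinder n) M (U \<times> {0..1}) (\<lambda>(r, a). p r a)" using p by (simp add: path_plots)
    ultimately have "smooth_on (cylinder m) M (V \<times> {0..1}) (\<lambda>x. (\<lambda>(r, a). p r a) (f (fst x), snd x))"
      by (rule smooth_on_compose[OF charted_cylinder charted_cylinder M]) (use fV in auto)
    then show "smooth_on (cylinder m) M (V \<times> {0..1}) (\<lambda>(r, a). (p \<circ> f) r a)"
      by (simp add: case_prod_beta')
  qed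
qed

lemma subset_plots: "p \<in> plots (subset_diffeology D S) n U \<longleftrightarrow> p \<in> plots D n U \<and> p ` U \<subseteq> S"
  by (simp add: subset_diffeology_def)

lemma diffeological_space_subset:
  assumes "diffeological_space D" shows "diffeological_space (subset_diffeology D S)"
proof -
  interpret diffeological_space D by fact
  show ?thesis
  proof
    show "openin (Euclidean_space n) U" if "p \<in> plots (subset_diffeology D S) n U" for p n U
      using that plot_domain[of p n U] by (simp add: subset_plots)
    show "p ` U \<subseteq> dcarrier (subset_diffeology D S)" if "p \<in> plots (subset_diffeology D S) n U" for p n U
      using that plot_range[of p n U] by (simp add: subset_plots) (simp add: subset_diffeology_def)
    show "q \<in> plots (subset_diffeology D S) n U"
      if "p \<in> plots (subset_diffeology D S) n U" "\<And>x. x \<in> U \<Longrightarrow> q x = p x" for p q n U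
      using that plot_cong[of p n U q] by (simp add: subset_plots image_subset_iff)
    show "(\<lambda>_. c) \<in> plots (subset_diffeology D S) n U"
      if "openin (Euclidean_space n) U" "c \<in> dcarrier (subset_diffeology D S)" for n U c
    proof -
      have "c \<in> dcarrier D" "c \<in> S" using that(2) by (simp_all add: subset_diffeology_def)
      then show ?thesis using plot_const[OF that(1)] by (simp add: subset_plots image_subset_iff)
    qed
    show "p \<in> plots (subset_diffeology D S) n U"
      if U: "openin (Euclidean_space n) U"
        and ex: "\<And>x. x \<in> U \<Longrightarrow> \<exists>V\<subseteq>U. x \<in> V \<and> p \<in> plots (subset_diffeology D S) n V" for n U p
    proof -
      have "p \<in> plots D n U"
      proof (rule plot_local[OF U])
        fix x assume "x \<in> U"
        from ex[OF this] show "\<exists>V\<subseteq>U. x \<in> V \<and> p \<in> plots D n V" unfolding subset_plots by metis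
      qed
      moreover have "p x \<in> S" if "x \<in> U" for x
        using ex[OF that] unfolding subset_plots by (metis image_subset_iff)
      ultimately show ?thesis by (simp add: subset_plots image_subset_iff)
    qed
    show "p \<circ> f \<in> plots (subset_diffeology D S) m V"
      if "p \<in> plots (subset_diffeology D S) n U" "smooth_euclid m n V f" "f ` V \<subseteq> U" for p n U m V f
      using that plot_smooth[of p n U m V f] by (simp add: subset_plots image_subset_iff)
  qed
qed

lemma prod_plots: "p \<in> plots (prod_diffeology D E) n U \<longleftrightarrow> fst \<circ> p \<in> plots D n U \<and> snd \<circ> p \<in> plots E n U"
  by (simp add: prod_diffeology_def)

lemma diffeological_space_prod:
  assumes "diffeological_space D" "diffeological_space E" shows "diffeological_space (prod_diffeology D E)"
proof -
  interpret D: diffeological_space D by fact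
  interpret E: diffeological_space E by fact
  show ?thesis
  proof
    show "openin (Euclidean_space n) U" if "p \<in> plots (prod_diffeology D E) n U" for p n U
      using that D.plot_domain[of "fst \<circ> p" n U] by (simp add: prod_plots)
    show "p ` U \<subseteq> dcarrier (prod_diffeology D E)" if "p \<in> plots (prod_diffeology D E) n U" for p n U
    proof
      fix y assume "y \<in> p ` U"
      then obtain x where x: "x \<in> U" "y = p x" by blast
      have "(fst \<circ> p) x \<in> dcarrier D" "(snd \<circ> p) x \<in> dcarrier E"
        using that D.plot_range[of "fst \<circ> p" n U] E.plot_range[of "snd \<circ> p" n U] x(1)
        by (auto simp: prod_diffeology_def)
      then show "y \<in> dcarrier (prod_diffeology D E)" by (simp add: prod_diffeology_def x(2) mem_Times_iff)
    qed
    show "q \<in> plots (prod_diffeology D E) n U"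
      if "p \<in> plots (prod_diffeology D E) n U" "\<And>x. x \<in> U \<Longrightarrow> q x = p x" for p q n U
      using that D.plot_cong[of "fst \<circ> p" n U "fst \<circ> q"] E.plot_cong[of "snd \<circ> p" n U "snd \<circ> q"]
      by (simp add: prod_diffeology_def)
    show "(\<lambda>_. c) \<in> plots (prod_diffeology D E) n U"
      if "openin (Euclidean_space n) U" "c \<in> dcarrier (prod_diffeology D E)" for n U c
      using that D.plot_const[of n U "fst c"] E.plot_const[of n U "snd c"]
      by (simp add: prod_diffeology_def comp_def mem_Times_iff)
    show "p \<in> plots (prod_diffeology D E) n U"
      if "openin (Euclidean_space n) U"
        "\<And>x. x \<in> U \<Longrightarrow> \<exists>V\<subseteq>U. x \<in> V \<and> p \<in> plots (prod_diffeology D E) n V" for n U p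
    proof -
      have "fst \<circ> p \<in> plots D n U"
      proof (rule D.plot_local[OF that(1)])
        fix x assume "x \<in> U"
        from that(2)[OF this] show "\<exists>V\<subseteq>U. x \<in> V \<and> fst \<circ> p \<in> plots D n V" by (auto simp: prod_diffeology_def)
      qed
      moreover have "snd \<circ> p \<in> plots E n U"
      proof (rule E.plot_local[OF that(1)])
        fix x assume "x \<in> U"
        from that(2)[OF this] show "\<exists>V\<subseteq>U. x \<in> V \<and> snd \<circ> p \<in> plots E n V" by (auto simp: prod_diffeology_def)
      qed
      ultimately show ?thesis by (simp add: prod_diffeology_def)
    qed
    show "p \<circ> f \<in> plots (prod_diffeology D E) m V"
      if "p \<in> plots (prod_diffeology D E) n U" "smooth_euclid m n V f" "f ` V \<subseteq> U" for p n U m V f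
      using that D.plot_smooth[of "fst \<circ> p" n U m V f] E.plot_smooth[of "snd \<circ> p" n U m V f]
      by (simp add: prod_diffeology_def comp_assoc)
  qed
qed

lemma power_plots: "p \<in> plots (power_diffeology k D) n U \<longleftrightarrow> openin (Euclidean_space n) U \<and>
    (\<forall>x\<in>U. length (p x) = k) \<and> (\<forall>i<k. (\<lambda>x. p x ! i) \<in> plots D n U)"
  by (simp add: power_diffeology_def)

lemma diffeological_space_power:
  assumes "diffeological_space D" shows "diffeological_space (power_diffeology k D)"
proof -
  interpret diffeological_space D by fact
  show ?thesis
  proof
    show "openin (Euclidean_space n) U" if "p \<in> plots (power_diffeology k D) n U" for p n U
      using that by (simp add: power_plots)
    show "p ` U \<subseteq> dcarrier (power_diffeology k D)" if "p \<in> plots (power_diffeology k D) n U" for p n U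
    proof
      fix y assume "y \<in> p ` U"
      then obtain x where x: "x \<in> U" "y = p x" by blast
      have len: "length (p x) = k" using that x(1) by (simp add: power_plots)
      have "p x ! i \<in> dcarrier D" if "i < k" for i
      proof -
        have "(\<lambda>x. p x ! i) \<in> plots D n U" using \<open>p \<in> _\<close> that by (simp add: power_plots)
        from plot_range[OF this] x(1) show ?thesis by blast
      qed
      with len show "y \<in> dcarrier (power_diffeology k D)" by (auto simp: power_diffeology_def x(2) in_set_conv_nth)
    qed
    show "q \<in> plots (power_diffeology k D) n U"
      if p: "p \<in> plots (power_diffeology k D) n U" and eq: "\<And>x. x \<in> U \<Longrightarrow> q x = p x" for p q n U
      unfolding power_plots
    proof (intro conjI allI impI)
      show "(\<lambda>x. q x ! i) \<in> plots D n U" if "i < k" for i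
        by (rule plot_cong[of "\<lambda>x. p x ! i"]) (use p eq that in \<open>simp_all add: power_plots\<close>)
    qed (use p eq in \<open>simp_all add: power_plots\<close>)
    show "(\<lambda>_. c) \<in> plots (power_diffeology k D) n U"
      if "openin (Euclidean_space n) U" "c \<in> dcarrier (power_diffeology k D)" for n U c
      using that unfolding power_plots
      by (intro conjI allI impI plot_const) (auto simp: power_diffeology_def)
    show "p \<in> plots (power_diffeology k D) n U"
      if U: "openin (Euclidean_space n) U"
        and ex: "\<And>x. x \<in> U \<Longrightarrow> \<exists>V\<subseteq>U. x \<in> V \<and> p \<in> plots (power_diffeology k D) n V" for n U p
      unfolding power_plots
    proof (intro conjI allI impI U ballI)
      show "length (p x) = k" if "x \<in> U" for x using ex[OF that] by (auto simp: power_plots)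
      show "(\<lambda>x. p x ! i) \<in> plots D n U" if "i < k" for i
      proof (rule plot_local[OF U])
        fix x assume "x \<in> U"
        from ex[OF this] that show "\<exists>V\<subseteq>U. x \<in> V \<and> (\<lambda>x. p x ! i) \<in> plots D n V" by (auto simp: power_plots)
      qed
    qed
    show "p \<circ> f \<in> plots (power_diffeology k D) m V"
      if p: "p \<in> plots (power_diffeology k D) n U" and f: "smooth_euclid m n V f" and fV: "f ` V \<subseteq> U" for p n U m V f
      unfolding power_plots
    proof (intro conjI allI impI ballI)
      show "openin (Euclidean_space m) V" using f by (simp add: smooth_euclid_iff)
      show "length ((p \<circ> f) x) = k" if "x \<in> V" for x using p fV that by (auto simp: power_plots)
      show "(\<lambda>x. (p \<circ> f) x ! i) \<in> plots D m V" if "i < k" for i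
        using plot_smooth[of "\<lambda>x. p x ! i" n U m V f] p f fV that by (simp add: power_plots comp_def)
    qed
  qed
qed

lemma sum_plots: "p \<in> plots (sum_diffeology D) n U \<longleftrightarrow> openin (Euclidean_space n) U \<and>
    (\<forall>x\<in>U. \<exists>V\<subseteq>U. x \<in> V \<and> (\<exists>i. p \<in> plots (D i) n V))"
  by (simp add: sum_diffeology_def)

lemma diffeological_space_sum:
  assumes D: "\<And>i. diffeological_space (D i)" shows "diffeological_space (sum_diffeology D)"
proof
  note plot_domain = diffeological_space.plot_domain[OF D] and plot_range = diffeological_space.plot_range[OF D]
    and plot_cong = diffeological_space.plot_cong[OF D] and plot_const = diffeological_space.plot_const[OF D]
    and plot_smooth = diffeological_space.plot_smooth[OF D]
  show "openin (Euclidean_space n) U" if "p \<in> plots (sum_diffeology D) n U" for p n U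
    using that by (simp add: sum_plots)
  show "p ` U \<subseteq> dcarrier (sum_diffeology D)" if p: "p \<in> plots (sum_diffeology D) n U" for p n U
  proof
    fix y assume "y \<in> p ` U"
    then obtain x where x: "x \<in> U" "y = p x" by blast
    obtain V i where V: "x \<in> V" "p \<in> plots (D i) n V" using p x(1) unfolding sum_plots by metis
    have "p x \<in> dcarrier (D i)" using subsetD[OF plot_range[OF V(2)] imageI[OF V(1)]] .
    then show "y \<in> dcarrier (sum_diffeology D)" using x(2) by (auto simp: sum_diffeology_def)
  qed
  show "q \<in> plots (sum_diffeology D) n U"
    if p: "p \<in> plots (sum_diffeology D) n U" and eq: "\<And>x. x \<in> U \<Longrightarrow> q x = p x" for p q n U
    unfolding sum_plots
  proof (intro conjI ballI)
    show "openin (Euclidean_space n) U" using p by (simp add: sum_plots)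
    fix x assume "x \<in> U"
    then obtain V i where V: "V \<subseteq> U" "x \<in> V" "p \<in> plots (D i) n V" using p unfolding sum_plots by metis
    have "q \<in> plots (D i) n V" by (rule plot_cong[OF V(3)]) (use V(1) eq in blast)
    with V(1,2) show "\<exists>V\<subseteq>U. x \<in> V \<and> (\<exists>i. q \<in> plots (D i) n V)" by metis
  qed
  show "(\<lambda>_. c) \<in> plots (sum_diffeology D) n U"
    if U: "openin (Euclidean_space n) U" and c: "c \<in> dcarrier (sum_diffeology D)" for n U c
  proof -
    obtain i where "c \<in> dcarrier (D i)" using c by (auto simp: sum_diffeology_def)
    from plot_const[OF U this] show ?thesis unfolding sum_plots using U by (metis order_refl)
  qed
  show "p \<in> plots (sum_diffeology D) n U"
    if U: "openin (Euclidean_space n) U"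
      and ex: "\<And>x. x \<in> U \<Longrightarrow> \<exists>V\<subseteq>U. x \<in> V \<and> p \<in> plots (sum_diffeology D) n V" for n U p
    unfolding sum_plots
  proof (intro conjI ballI U)
    fix x assume "x \<in> U"
    from ex[OF this] show "\<exists>V\<subseteq>U. x \<in> V \<and> (\<exists>i. p \<in> plots (D i) n V)" unfolding sum_plots by (meson order_trans)
  qed
  show "p \<circ> f \<in> plots (sum_diffeology D) m V"
    if p: "p \<in> plots (sum_diffeology D) n U" and f: "smooth_euclid m n V f" and fV: "f ` V \<subseteq> U" for p n U m V f
    unfolding sum_plots
  proof (intro conjI ballI)
    show "openin (Euclidean_space m) V" using f by (simp add: smooth_euclid_iff)
    fix x assume x: "x \<in> V"
    then have "f x \<in> U" using fV by blast
    then obtain W i where W: "f x \<in> W" "p \<in> plots (D i) n W" using p unfolding sum_plots by metis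
    let ?V = "{y\<in>V. f y \<in> W}"
    have "smooth_euclid m n ?V f"
      by (rule smooth_euclid_subset[OF f smooth_euclid_vimage_open[OF f plot_domain[OF W(2)]]]) blast
    from plot_smooth[OF W(2) this] have "p \<circ> f \<in> plots (D i) m ?V" by (simp add: image_subset_iff)
    then show "\<exists>W\<subseteq>V. x \<in> W \<and> (\<exists>i. p \<circ> f \<in> plots (D i) m W)"
      using x W(1) by (intro exI[of _ ?V] conjI exI[of _ i]) simp_all
  qed
qed

lemma quotient_plots: "p \<in> plots (quotient_diffeology D R) n U \<longleftrightarrow> openin (Euclidean_space n) U \<and>
    (\<forall>x\<in>U. \<exists>V\<subseteq>U. x \<in> V \<and> (\<exists>q\<in>plots D n V. \<forall>y\<in>V. p y = R `` {q y}))"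
  by (simp add: quotient_diffeology_def)

lemma diffeological_space_quotient:
  assumes "diffeological_space D" shows "diffeological_space (quotient_diffeology D R)"
proof -
  interpret diffeological_space D by fact
  show ?thesis
  proof
    show "openin (Euclidean_space n) U" if "p \<in> plots (quotient_diffeology D R) n U" for p n U
      using that by (simp add: quotient_plots)
    show "p ` U \<subseteq> dcarrier (quotient_diffeology D R)" if p: "p \<in> plots (quotient_diffeology D R) n U" for p n U
    proof
      fix y assume "y \<in> p ` U"
      then obtain x where x: "x \<in> U" "y = p x" by blast
      then obtain V q where q: "x \<in> V" "q \<in> plots D n V" "p x = R `` {q x}" using p unfolding quotient_plots by metis
      have "q x \<in> dcarrier D" using subsetD[OF plot_range[OF q(2)] imageI[OF q(1)]] .
      then show "y \<in> dcarrier (quotient_diffeology D R)" using x(2) q(3) by (simp add: quotient_diffeology_def quotientI)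
    qed
    show "q \<in> plots (quotient_diffeology D R) n U"
      if p: "p \<in> plots (quotient_diffeology D R) n U" and eq: "\<And>x. x \<in> U \<Longrightarrow> q x = p x" for p q n U
      unfolding quotient_plots
    proof (intro conjI ballI)
      show "openin (Euclidean_space n) U" using p by (simp add: quotient_plots)
      fix x assume "x \<in> U"
      then obtain V q' where V: "V \<subseteq> U" "x \<in> V" "q' \<in> plots D n V" "\<forall>y\<in>V. p y = R `` {q' y}"
        using p unfolding quotient_plots by metis
      then have "\<forall>y\<in>V. q y = R `` {q' y}" using eq by (metis subsetD)
      with V(1-3) show "\<exists>V\<subseteq>U. x \<in> V \<and> (\<exists>q'\<in>plots D n V. \<forall>y\<in>V. q y = R `` {q' y})"
        by (intro exI[of _ V] conjI bexI[of _ q'])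
    qed
    show "(\<lambda>_. c) \<in> plots (quotient_diffeology D R) n U"
      if U: "openin (Euclidean_space n) U" and c: "c \<in> dcarrier (quotient_diffeology D R)" for n U c
    proof -
      obtain a where a: "a \<in> dcarrier D" "c = R `` {a}" using c by (auto simp: quotient_diffeology_def elim: quotientE)
      from plot_const[OF U a(1)] show ?thesis unfolding quotient_plots using U a(2)
        by (intro conjI ballI exI[of _ U] bexI[of _ "\<lambda>_. a"]) simp_all
    qed
    show "p \<in> plots (quotient_diffeology D R) n U"
      if U: "openin (Euclidean_space n) U"
        and ex: "\<And>x. x \<in> U \<Longrightarrow> \<exists>V\<subseteq>U. x \<in> V \<and> p \<in> plots (quotient_diffeology D R) n V" for n U p
      unfolding quotient_plots
    proof (intro conjI ballI U)
      fix x assume "x \<in> U"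
      from ex[OF this] show "\<exists>V\<subseteq>U. x \<in> V \<and> (\<exists>q\<in>plots D n V. \<forall>y\<in>V. p y = R `` {q y})"
        unfolding quotient_plots by (meson order_trans)
    qed
    show "p \<circ> f \<in> plots (quotient_diffeology D R) m V"
      if p: "p \<in> plots (quotient_diffeology D R) n U" and f: "smooth_euclid m n V f" and fV: "f ` V \<subseteq> U" for p n U m V f
      unfolding quotient_plots
    proof (intro conjI ballI)
      show "openin (Euclidean_space m) V" using f by (simp add: smooth_euclid_iff)
      fix x assume x: "x \<in> V"
      then have "f x \<in> U" using fV by blast
      then obtain W q where W: "f x \<in> W" "q \<in> plots D n W" "\<forall>y\<in>W. p y = R `` {q y}"
        using p unfolding quotient_plots by metis
      let ?V = "{y\<in>V. f y \<in> W}"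
      have "smooth_euclid m n ?V f"
        by (rule smooth_euclid_subset[OF f smooth_euclid_vimage_open[OF f plot_domain[OF W(2)]]]) blast
      from plot_smooth[OF W(2) this] have "q \<circ> f \<in> plots D m ?V" by (simp add: image_subset_iff)
      then show "\<exists>W\<subseteq>V. x \<in> W \<and> (\<exists>q\<in>plots D m W. \<forall>y\<in>W. (p \<circ> f) y = R `` {q y})"
        using x W(1,3) by (intro exI[of _ ?V] conjI bexI[of _ "q \<circ> f"]) auto
    qed
  qed
qed

section \<open>Smoothness of the structure maps\<close>

context lie_groupoid
begin

abbreviation (input) lazy_order where "lazy_order \<equiv> lazy_order_diffeology X0 X1 G"
abbreviation (input) thin_arrows where "thin_arrows \<equiv> thin_arrow_diffeology X0 X1 G"

lemma diffeological_space_lazy_order: "diffeological_space (lazy_order k)"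
  unfolding lazy_order_diffeology_def
  by (intro diffeological_space_subset diffeological_space_prod diffeological_space_power
      diffeological_space_manifold diffeological_space_path charted_X0 charted_X1)

lemma diffeological_space_lazy: "diffeological_space (lazy_diffeology X0 X1 G)"
  unfolding lazy_diffeology_def by (intro diffeological_space_sum diffeological_space_lazy_order)

lemma diffeological_space_thin_arrows: "diffeological_space thin_arrows"
  unfolding thin_arrow_diffeology_def by (intro diffeological_space_quotient diffeological_space_lazy)

lemma lazy_order_plots:
  "q \<in> plots (lazy_order k) n V \<longleftrightarrow> openin (Euclidean_space n) V \<and>
     (\<forall>x\<in>V. q x \<in> \<P> \<and> length (snd (q x)) = k) \<and>
     (\<forall>i\<le>k. smooth_map (Rn n) X1 V (\<lambda>x. fst (q x) ! i)) \<and>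
     (\<forall>i<k. (\<lambda>x. snd (q x) ! i) \<in> plots (path_diffeology X0) n V)"
proof -
  have len: "length (fst (q x)) = Suc (length (snd (q x)))" if "q x \<in> \<P>" for x
    using that lazy_list_length[of X0 G "fst (q x)" "snd (q x)"] lazy_paths_iff[of "fst (q x)" "snd (q x)" X0 G] by simp
  have iff: "q \<in> plots (lazy_order k) n V \<longleftrightarrow> ((openin (Euclidean_space n) V \<and> (\<forall>x\<in>V. length (fst (q x)) = Suc k) \<and>
       (\<forall>i<Suc k. smooth_map (Rn n) X1 V (\<lambda>x. fst (q x) ! i))) \<and>
      (openin (Euclidean_space n) V \<and> (\<forall>x\<in>V. length (snd (q x)) = k) \<and>
       (\<forall>i<k. (\<lambda>x. snd (q x) ! i) \<in> plots (path_diffeology X0) n V))) \<and>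
      (\<forall>x\<in>V. q x \<in> \<P> \<and> length (snd (q x)) = k)"
    by (simp only: lazy_order_diffeology_def subset_plots prod_plots power_plots manifold_plots
        image_subset_iff mem_Collect_eq comp_def)
  show ?thesis
  proof
    assume "q \<in> plots (lazy_order k) n V"
    then show "openin (Euclidean_space n) V \<and> (\<forall>x\<in>V. q x \<in> \<P> \<and> length (snd (q x)) = k) \<and>
     (\<forall>i\<le>k. smooth_map (Rn n) X1 V (\<lambda>x. fst (q x) ! i)) \<and>
     (\<forall>i<k. (\<lambda>x. snd (q x) ! i) \<in> plots (path_diffeology X0) n V)"
      unfolding iff less_Suc_eq_le by (elim conjE) (intro conjI; assumption)
  next
    assume r: "openin (Euclidean_space n) V \<and> (\<forall>x\<in>V. q x \<in> \<P> \<and> length (snd (q x)) = k) \<and>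
     (\<forall>i\<le>k. smooth_map (Rn n) X1 V (\<lambda>x. fst (q x) ! i)) \<and>
     (\<forall>i<k. (\<lambda>x. snd (q x) ! i) \<in> plots (path_diffeology X0) n V)"
    then have "\<forall>x\<in>V. length (fst (q x)) = Suc k" "\<forall>x\<in>V. length (snd (q x)) = k" using len by auto
    with r show "q \<in> plots (lazy_order k) n V"
      unfolding iff less_Suc_eq_le by (elim conjE) (intro conjI; assumption)
  qed
qed

text \<open>Lifting to lazy paths and passing to a summand of the sum are both local, so they can be done on
  the same neighbourhood.\<close>

lemma thin_arrows_plotE:
  assumes "p \<in> plots thin_arrows n U" "x \<in> U"
  obtains V k q where "V \<subseteq> U" "x \<in> V" "q \<in> plots (lazy_order k) n V" "\<forall>y\<in>V. p y = lazy_class (q y)"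
proof -
  obtain V q where V: "V \<subseteq> U" "x \<in> V" "q \<in> plots (lazy_diffeology X0 X1 G) n V" "\<forall>y\<in>V. p y = lazy_class (q y)"
    using assms unfolding thin_arrow_diffeology_def quotient_plots lazy_class_def by metis
  then obtain W k where W: "W \<subseteq> V" "x \<in> W" "q \<in> plots (lazy_order k) n W"
    unfolding lazy_diffeology_def sum_plots by metis
  have "\<forall>y\<in>W. p y = lazy_class (q y)" using W(1) V(4) by blast
  with W V(1) show ?thesis using that[of W q k] by simp
qed

lemma thin_arrows_plotI:
  assumes q: "q \<in> plots (lazy_order k) n V" shows "(\<lambda>x. lazy_class (q x)) \<in> plots thin_arrows n V"
proof -
  have V: "openin (Euclidean_space n) V" using q by (simp add: lazy_order_plots)
  have "q \<in> plots (lazy_diffeology X0 X1 G) n V"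
    unfolding lazy_diffeology_def sum_plots using V q by (metis order_refl)
  then show ?thesis
    unfolding thin_arrow_diffeology_def quotient_plots lazy_class_def using V by (metis order_refl)
qed

lemma lazy_carrier: "dcarrier (lazy_diffeology X0 X1 G) = \<P>"
proof -
  have 1: "\<Gamma> \<in> dcarrier (lazy_order (length (snd \<Gamma>)))" if "\<Gamma> \<in> \<P>" for \<Gamma>
  proof -
    obtain \<gamma>s \<alpha>s where \<Gamma>: "\<Gamma> = (\<gamma>s, \<alpha>s)" by (cases \<Gamma>)
    then show ?thesis using that mor_eq
      by (simp add: lazy_order_diffeology_def subset_diffeology_def prod_diffeology_def power_diffeology_def
          manifold_diffeology_def path_diffeology_def lazy_paths_def)
  qed
  have 2: "\<Gamma> \<in> \<P>" if "\<Gamma> \<in> dcarrier (lazy_order k)" for \<Gamma> k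
    using that by (simp add: lazy_order_diffeology_def subset_diffeology_def)
  have "dcarrier (lazy_diffeology X0 X1 G) = (\<Union>k. dcarrier (lazy_order k))"
    by (simp add: lazy_diffeology_def sum_diffeology_def)
  with 1 2 show ?thesis by blast
qed

lemma thin_arrows_carrier: "dcarrier thin_arrows = mor thin"
  by (simp add: thin_arrow_diffeology_def quotient_diffeology_def thin_groupoid_def Let_def lazy_carrier)

text \<open>
  Being a plot is a local property, so it can be checked on local lifts of a plot of classes, and
  these may be taken to have a fixed order.\<close>

lemma diffeological_map_from_thin:
  assumes E: "diffeological_space E"
    and carrier: "\<And>c. c \<in> mor thin \<Longrightarrow> f c \<in> dcarrier E"
    and lift: "\<And>k n V q. q \<in> plots (lazy_order k) n V \<Longrightarrow> (\<lambda>x. f (lazy_class (q x))) \<in> plots E n V"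
  shows "diffeological_map thin_arrows E f"
  unfolding diffeological_map_def
proof (intro conjI allI ballI)
  interpret E: diffeological_space E by fact
  show "f ` dcarrier thin_arrows \<subseteq> dcarrier E" using carrier thin_arrows_carrier by (simp add: image_subset_iff)
  fix n U p assume p: "p \<in> plots thin_arrows n U"
  show "f \<circ> p \<in> plots E n U"
  proof (rule E.plot_local)
    show "openin (Euclidean_space n) U" by (rule diffeological_space.plot_domain[OF diffeological_space_thin_arrows p])
    fix x assume "x \<in> U"
    then obtain V k q where V: "V \<subseteq> U" "x \<in> V" "q \<in> plots (lazy_order k) n V" "\<forall>y\<in>V. p y = lazy_class (q y)"
      by (rule thin_arrows_plotE[OF p])
    have "f \<circ> p \<in> plots E n V" by (rule E.plot_cong[OF lift[OF V(3)]]) (simp add: V(4))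
    with V(1,2) show "\<exists>V\<subseteq>U. x \<in> V \<and> f \<circ> p \<in> plots E n V" by metis
  qed
qed

end

context lie_groupoid
begin

lemma lazy_src_nth: "\<Gamma> \<in> \<P> \<Longrightarrow> lazy_src G \<Gamma> = src G (fst \<Gamma> ! 0)"
  by (erule lazy_splitE_first) simp

lemma lazy_tgt_nth: "\<Gamma> \<in> \<P> \<Longrightarrow> lazy_tgt G \<Gamma> = tgt G (fst \<Gamma> ! length (snd \<Gamma>))"
  by (erule lazy_splitE_last) (simp add: nth_append)

lemma src_map_thin: "diffeological_map thin_arrows (manifold_diffeology X0) (src thin)"
proof (rule diffeological_map_from_thin[OF diffeological_space_manifold[OF charted_X0]])
  interpret T: groupoid thin by (rule groupoid_thin)
  show "src thin c \<in> dcarrier (manifold_diffeology X0)" if "c \<in> mor thin" for c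
    using T.src_obj[OF that] obj_eq by (simp add: thin_obj manifold_diffeology_def)
  fix k n V q assume q: "q \<in> plots (lazy_order k) n V"
  then have g: "smooth_map (Rn n) X1 V (\<lambda>x. fst (q x) ! 0)" by (simp add: lazy_order_plots)
  have "smooth_map (Rn n) X0 V (src G \<circ> (\<lambda>x. fst (q x) ! 0))"
    by (rule smooth_map_compose[OF charted_Rn charted_X1 charted_X0 g src_smooth smooth_map_range[OF charted_X1 g]])
  then show "(\<lambda>x. src thin (lazy_class (q x))) \<in> plots (manifold_diffeology X0) n V"
    unfolding manifold_plots
    by (rule smooth_map_cong[OF charted_Rn, rotated]) (use q in \<open>simp add: lazy_order_plots thin_src lazy_src_nth\<close>)
qed

lemma tgt_map_thin: "diffeological_map thin_arrows (manifold_diffeology X0) (tgt thin)"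
proof (rule diffeological_map_from_thin[OF diffeological_space_manifold[OF charted_X0]])
  interpret T: groupoid thin by (rule groupoid_thin)
  show "tgt thin c \<in> dcarrier (manifold_diffeology X0)" if "c \<in> mor thin" for c
    using T.tgt_obj[OF that] obj_eq by (simp add: thin_obj manifold_diffeology_def)
  fix k n V q assume q: "q \<in> plots (lazy_order k) n V"
  then have g: "smooth_map (Rn n) X1 V (\<lambda>x. fst (q x) ! k)" by (simp add: lazy_order_plots)
  have "smooth_map (Rn n) X0 V (tgt G \<circ> (\<lambda>x. fst (q x) ! k))"
    by (rule smooth_map_compose[OF charted_Rn charted_X1 charted_X0 g tgt_smooth smooth_map_range[OF charted_X1 g]])
  then show "(\<lambda>x. tgt thin (lazy_class (q x))) \<in> plots (manifold_diffeology X0) n V"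
    unfolding manifold_plots
    by (rule smooth_map_cong[OF charted_Rn, rotated]) (use q in \<open>simp add: lazy_order_plots thin_tgt lazy_tgt_nth\<close>)
qed

lemma const_path_plot:
  assumes p: "smooth_map (Rn n) X0 U p"
  shows "(\<lambda>x. const_path (p x)) \<in> plots (path_diffeology X0) n U"
  unfolding path_plots
proof (intro conjI)
  show U: "openin (Euclidean_space n) U" using smooth_map_open[OF p] by simp
  show "(\<lambda>x. const_path (p x)) ` U \<subseteq> sitting_paths X0"
    using const_path_sitting[OF charted_X0] smooth_map_range[OF charted_X0 p] by (simp add: image_subset_iff)
  have "smooth_on (cylinder n) X0 (U \<times> {0..1}) (\<lambda>x. p (fst x))"
    by (rule smooth_on_compose[OF charted_cylinder charted_Rn charted_X0 smooth_on_cylinder_fst[OF U]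
          smooth_on_of_map[OF p order_refl]]) auto
  then show "smooth_on (cylinder n) X0 (U \<times> {0..1}) (\<lambda>(r, a). const_path (p r) a)"
    by (rule smooth_on_cong) auto
qed

lemma rev_path_plot:
  assumes M: "charted M" and p: "p \<in> plots (path_diffeology M) n U"
  shows "(\<lambda>x. rev_path (p x)) \<in> plots (path_diffeology M) n U"
  unfolding path_plots
proof (intro conjI)
  show U: "openin (Euclidean_space n) U" using p by (simp add: path_plots)
  show "(\<lambda>x. rev_path (p x)) ` U \<subseteq> sitting_paths M"
    using p rev_path_sitting[OF M] by (simp add: path_plots image_subset_iff)
  have "smooth_map real_line real_line UNIV (\<lambda>a. 1 - a)"
    by (rule smooth_map_line_real) (intro smooth_fun_diff smooth_fun_const smooth_fun_open)
  then have "smooth_on (cylinder n) real_line (U \<times> {0..1}) (\<lambda>x. 1 - snd x)"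
    by (intro smooth_on_compose[OF charted_cylinder charted_real_line charted_real_line
          smooth_on_cylinder_snd[OF U] smooth_on_of_map[of _ _ UNIV, OF _ order_refl]]) auto
  then have "smooth_on (cylinder n) (cylinder n) (U \<times> {0..1}) (\<lambda>x. (fst x, 1 - snd x))"
    by (rule smooth_on_pair[OF charted_cylinder charted_Rn charted_real_line smooth_on_cylinder_fst[OF U]])
  moreover have "smooth_on (cylinder n) M (U \<times> {0..1}) (\<lambda>(r, a). p r a)" using p by (simp add: path_plots)
  ultimately have "smooth_on (cylinder n) M (U \<times> {0..1}) (\<lambda>x. (\<lambda>(r, a). p r a) (fst x, 1 - snd x))"
    by (rule smooth_on_compose[OF charted_cylinder charted_cylinder M]) auto
  then show "smooth_on (cylinder n) M (U \<times> {0..1}) (\<lambda>(r, a). rev_path (p r) a)"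
    by (rule smooth_on_cong) auto
qed

lemma unt_map_thin: "diffeological_map (manifold_diffeology X0) thin_arrows (unt thin)"
  unfolding diffeological_map_def
proof (intro conjI allI ballI)
  interpret T: groupoid thin by (rule groupoid_thin)
  show "unt thin ` dcarrier (manifold_diffeology X0) \<subseteq> dcarrier thin_arrows"
    using T.unt_mor obj_eq by (simp add: thin_arrows_carrier manifold_diffeology_def thin_obj image_subset_iff)
  fix n U p assume "p \<in> plots (manifold_diffeology X0) n U"
  then have p: "smooth_map (Rn n) X0 U p" by (simp add: manifold_plots)
  have u: "smooth_map (Rn n) X1 U (unt G \<circ> p)"
    by (rule smooth_map_compose[OF charted_Rn charted_X0 charted_X1 p unt_smooth smooth_map_range[OF charted_X0 p]])
  have "(\<lambda>x. lazy_unt G (p x)) \<in> plots (lazy_order 1) n U"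
    unfolding lazy_order_plots
  proof (intro conjI allI impI ballI)
    show "openin (Euclidean_space n) U" using smooth_map_open[OF p] by simp
    fix x assume "x \<in> U"
    then have "p x \<in> obj G" using smooth_map_range[OF charted_X0 p] obj_eq by blast
    then show "lazy_unt G (p x) \<in> \<P>" using const_path_obj by (simp add: lazy_unt_eq)
    show "length (snd (lazy_unt G (p x))) = 1" by (simp add: lazy_unt_def)
  next
    fix i :: nat assume "i \<le> 1"
    then have "i = 0 \<or> i = 1" by auto
    then show "smooth_map (Rn n) X1 U (\<lambda>x. fst (lazy_unt G (p x)) ! i)"
      using u by (auto simp: lazy_unt_def comp_def)
  next
    fix i :: nat assume "i < 1"
    then show "(\<lambda>x. snd (lazy_unt G (p x)) ! i) \<in> plots (path_diffeology X0) n U"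
      using const_path_plot[OF p] by (simp add: lazy_unt_def)
  qed
  from thin_arrows_plotI[OF this] show "unt thin \<circ> p \<in> plots thin_arrows n U"
    by (simp add: comp_def thin_unt)
qed

lemma ivs_map_thin: "diffeological_map thin_arrows thin_arrows (ivs thin)"
proof (rule diffeological_map_from_thin[OF diffeological_space_thin_arrows])
  interpret T: groupoid thin by (rule groupoid_thin)
  show "ivs thin c \<in> dcarrier thin_arrows" if "c \<in> mor thin" for c
    using T.ivs_mor[OF that] by (simp add: thin_arrows_carrier)
  fix k n V q assume q: "q \<in> plots (lazy_order k) n V"
  then have q1: "openin (Euclidean_space n) V" "\<And>x. x \<in> V \<Longrightarrow> q x \<in> \<P>" "\<And>x. x \<in> V \<Longrightarrow> length (snd (q x)) = k"
    "\<And>i. i \<le> k \<Longrightarrow> smooth_map (Rn n) X1 V (\<lambda>x. fst (q x) ! i)"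
    "\<And>i. i < k \<Longrightarrow> (\<lambda>x. snd (q x) ! i) \<in> plots (path_diffeology X0) n V"
    by (simp_all add: lazy_order_plots)
  have len: "length (fst (q x)) = Suc k" if "x \<in> V" for x
    using q1(2,3)[OF that] lazy_list_length lazy_paths_iff[of "fst (q x)" "snd (q x)" X0 G] by fastforce
  interpret PD: diffeological_space "path_diffeology X0" by (rule diffeological_space_path[OF charted_X0])
  have "(\<lambda>x. lazy_ivs G (q x)) \<in> plots (lazy_order k) n V"
    unfolding lazy_order_plots
  proof (intro conjI allI impI ballI q1(1))
    show "lazy_ivs G (q x) \<in> \<P>" "length (snd (lazy_ivs G (q x))) = k" if "x \<in> V" for x
      using lazy_ivs_facts(1)[OF q1(2)[OF that]] q1(3)[OF that] by (simp_all add: lazy_ivs_def case_prod_beta')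
    show "smooth_map (Rn n) X1 V (\<lambda>x. fst (lazy_ivs G (q x)) ! i)" if i: "i \<le> k" for i
    proof -
      have "smooth_map (Rn n) X1 V (ivs G \<circ> (\<lambda>x. fst (q x) ! (k - i)))"
        by (rule smooth_map_compose[OF charted_Rn charted_X1 charted_X1 _ ivs_smooth smooth_map_range[OF charted_X1]];
            rule q1(4); simp)
      then show ?thesis
        by (rule smooth_map_cong[OF charted_Rn, rotated])
          (use i len in \<open>simp add: lazy_ivs_def case_prod_beta' rev_nth\<close>)
    qed
    show "(\<lambda>x. snd (lazy_ivs G (q x)) ! i) \<in> plots (path_diffeology X0) n V" if i: "i < k" for i
    proof (rule PD.plot_cong)
      show "(\<lambda>x. rev_path (snd (q x) ! (k - Suc i))) \<in> plots (path_diffeology X0) n V"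
        by (rule rev_path_plot[OF charted_X0 q1(5)]) (use i in simp)
      show "snd (lazy_ivs G (q x)) ! i = rev_path (snd (q x) ! (k - Suc i))" if "x \<in> V" for x
        using i q1(3)[OF that] by (simp add: lazy_ivs_def case_prod_beta' rev_nth)
    qed
  qed
  from thin_arrows_plotI[OF this] show "(\<lambda>x. ivs thin (lazy_class (q x))) \<in> plots thin_arrows n V"
    by (rule diffeological_space.plot_cong[OF diffeological_space_thin_arrows]) (simp add: thin_ivs q1(2))
qed

lemma lazy_cmp_nth:
  assumes "\<Delta> \<in> \<P>" "\<Gamma> \<in> \<P>" "length (snd \<Gamma>) = k"
  shows "i < k \<Longrightarrow> fst (\<Delta> \<odot> \<Gamma>) ! i = fst \<Gamma> ! i"
    "fst (\<Delta> \<odot> \<Gamma>) ! k = cmp G (fst \<Delta> ! 0) (fst \<Gamma> ! k)"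
    "k < i \<Longrightarrow> fst (\<Delta> \<odot> \<Gamma>) ! i = fst \<Delta> ! (i - k)"
    "snd (\<Delta> \<odot> \<Gamma>) = snd \<Gamma> @ snd \<Delta>"
proof -
  obtain \<gamma>s g \<alpha>s where g: "\<Gamma> = (\<gamma>s @ [g], \<alpha>s)" "length \<gamma>s = length \<alpha>s"
    by (rule lazy_splitE_last[OF assms(2)]) blast
  obtain ds d \<beta>s where d: "\<Delta> = (d # ds, \<beta>s)"
    by (rule lazy_splitE_first[OF assms(1)]) blast
  have k: "length \<gamma>s = k" using assms(3) g by simp
  show "i < k \<Longrightarrow> fst (\<Delta> \<odot> \<Gamma>) ! i = fst \<Gamma> ! i" using k by (simp add: g d nth_append)
  show "fst (\<Delta> \<odot> \<Gamma>) ! k = cmp G (fst \<Delta> ! 0) (fst \<Gamma> ! k)" using k by (simp add: g d nth_append)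
  show "k < i \<Longrightarrow> fst (\<Delta> \<odot> \<Gamma>) ! i = fst \<Delta> ! (i - k)" using k by (simp add: g d nth_append nth_Cons')
  show "snd (\<Delta> \<odot> \<Gamma>) = snd \<Gamma> @ snd \<Delta>" by (simp add: g d)
qed

text \<open>The entries of the composite are those of the two factors, apart from the one arrow composed in
  the middle, which is smooth because composition of \<open>G\<close> is smooth on composable pairs.\<close>

lemma lazy_cmp_plot:
  assumes q: "q \<in> plots (lazy_order k) n V" and p: "p \<in> plots (lazy_order l) n V"
    and c: "\<And>x. x \<in> V \<Longrightarrow> lazy_src G (q x) = lazy_tgt G (p x)"
  shows "(\<lambda>x. q x \<odot> p x) \<in> plots (lazy_order (l + k)) n V"
proof -
  have q1: "openin (Euclidean_space n) V" "\<And>x. x \<in> V \<Longrightarrow> q x \<in> \<P>" "\<And>x. x \<in> V \<Longrightarrow> length (snd (q x)) = k"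
    "\<And>i. i \<le> k \<Longrightarrow> smooth_map (Rn n) X1 V (\<lambda>x. fst (q x) ! i)"
    "\<And>i. i < k \<Longrightarrow> (\<lambda>x. snd (q x) ! i) \<in> plots (path_diffeology X0) n V"
    using q by (simp_all add: lazy_order_plots)
  have p1: "\<And>x. x \<in> V \<Longrightarrow> p x \<in> \<P>" "\<And>x. x \<in> V \<Longrightarrow> length (snd (p x)) = l"
    "\<And>i. i \<le> l \<Longrightarrow> smooth_map (Rn n) X1 V (\<lambda>x. fst (p x) ! i)"
    "\<And>i. i < l \<Longrightarrow> (\<lambda>x. snd (p x) ! i) \<in> plots (path_diffeology X0) n V"
    using p by (simp_all add: lazy_order_plots)
  interpret PD: diffeological_space "path_diffeology X0" by (rule diffeological_space_path[OF charted_X0])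
  note nth = lazy_cmp_nth[OF q1(2) p1(1,2)]
  have cmp: "smooth_map (Rn n) X1 V (\<lambda>x. cmp G (fst (q x) ! 0) (fst (p x) ! l))"
  proof (rule smooth_on_imp_smooth_map[OF charted_Rn])
    show "openin (mtop (Rn n)) V" using q1(1) by simp
    have s: "smooth_on (Rn n) (prod_manifold X1 X1) V (\<lambda>x. (fst (q x) ! 0, fst (p x) ! l))"
      by (intro smooth_on_pair charted_Rn charted_X1 smooth_on_of_map[OF q1(4) order_refl]
          smooth_on_of_map[OF p1(3) order_refl]) simp_all
    have "(fst (q x) ! 0, fst (p x) ! l) \<in> composable G" if x: "x \<in> V" for x
    proof -
      have "fst (q x) ! 0 \<in> mor G" "fst (p x) ! l \<in> mor G"
        using smooth_map_range[OF charted_X1 q1(4)[of 0]] smooth_map_range[OF charted_X1 p1(3)[of l]] x mor_eq by auto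
      then show ?thesis
        using c[OF x] q1(2)[OF x] p1(1,2)[OF x] by (simp add: composable_def lazy_src_nth lazy_tgt_nth)
    qed
    from smooth_on_compose[OF charted_Rn charted_prod[OF charted_X1 charted_X1] charted_X1 s cmp_smooth this]
    show "smooth_on (Rn n) X1 V (\<lambda>x. cmp G (fst (q x) ! 0) (fst (p x) ! l))" by simp
  qed
  show ?thesis
    unfolding lazy_order_plots
  proof (intro conjI allI impI ballI q1(1))
    show "q x \<odot> p x \<in> \<P>" if "x \<in> V" for x by (rule cat_facts(1)[OF q1(2) p1(1) c]; rule that)
    show "length (snd (q x \<odot> p x)) = l + k" if "x \<in> V" for x
      using nth(4)[OF that that that] q1(3)[OF that] p1(2)[OF that] by simp
    fix i assume "i \<le> l + k"
    then consider "i < l" | "i = l" | "l < i" "i - l \<le> k" by linarith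
    then show "smooth_map (Rn n) X1 V (\<lambda>x. fst (q x \<odot> p x) ! i)"
    proof cases
      case 1
      then show ?thesis by (intro smooth_map_cong[OF charted_Rn _ p1(3)[of i]]) (simp_all add: nth(1))
    next
      case 2
      show ?thesis by (rule smooth_map_cong[OF charted_Rn _ cmp]) (simp add: nth(2) 2)
    next
      case 3
      then show ?thesis by (intro smooth_map_cong[OF charted_Rn _ q1(4)[of "i - l"]]) (simp_all add: nth(3))
    qed
  next
    fix i assume i: "i < l + k"
    show "(\<lambda>x. snd (q x \<odot> p x) ! i) \<in> plots (path_diffeology X0) n V"
    proof (cases "i < l")
      case True
      then show ?thesis by (intro PD.plot_cong[OF p1(4)[of i]]) (simp_all add: nth(4) nth_append p1(2))
    next
      case False
      then show ?thesis using i by (intro PD.plot_cong[OF q1(5)[of "i - l"]]) (simp_all add: nth(4) nth_append p1(2))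
    qed
  qed
qed

lemma cmp_map_thin:
  "diffeological_map (subset_diffeology (prod_diffeology thin_arrows thin_arrows) (composable thin)) thin_arrows
     (\<lambda>(h, g). cmp thin h g)"
  unfolding diffeological_map_def
proof (intro conjI allI ballI)
  interpret T: groupoid thin by (rule groupoid_thin)
  interpret TD: diffeological_space thin_arrows by (rule diffeological_space_thin_arrows)
  show "(\<lambda>(h, g). cmp thin h g) ` dcarrier (subset_diffeology (prod_diffeology thin_arrows thin_arrows) (composable thin))
      \<subseteq> dcarrier thin_arrows"
    using T.cmp_mor by (auto simp: subset_diffeology_def thin_arrows_carrier)
  fix n U p assume "p \<in> plots (subset_diffeology (prod_diffeology thin_arrows thin_arrows) (composable thin)) n U"
  then have p: "fst \<circ> p \<in> plots thin_arrows n U" "snd \<circ> p \<in> plots thin_arrows n U" "p ` U \<subseteq> composable thin"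
    by (simp_all add: subset_plots prod_plots)
  show "(\<lambda>(h, g). cmp thin h g) \<circ> p \<in> plots thin_arrows n U"
  proof (rule TD.plot_local[OF TD.plot_domain[OF p(1)]])
    fix x assume x: "x \<in> U"
    obtain V k q where V: "V \<subseteq> U" "x \<in> V" "q \<in> plots (lazy_order k) n V" "\<forall>y\<in>V. (fst \<circ> p) y = lazy_class (q y)"
      by (rule thin_arrows_plotE[OF p(1) x])
    obtain W l r where W: "W \<subseteq> U" "x \<in> W" "r \<in> plots (lazy_order l) n W" "\<forall>y\<in>W. (snd \<circ> p) y = lazy_class (r y)"
      by (rule thin_arrows_plotE[OF p(2) x])
    have o: "openin (Euclidean_space n) (V \<inter> W)" using V(3) W(3) by (auto simp: lazy_order_plots)
    have q: "q \<in> plots (lazy_order k) n (V \<inter> W)" and r: "r \<in> plots (lazy_order l) n (V \<inter> W)"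
      by (rule plot_subset[OF diffeological_space_lazy_order V(3) o], simp)
        (rule plot_subset[OF diffeological_space_lazy_order W(3) o], simp)
    have P: "q y \<in> \<P>" "r y \<in> \<P>" if "y \<in> V \<inter> W" for y
      using q r that by (simp_all add: lazy_order_plots)
    have py: "p y = (lazy_class (q y), lazy_class (r y))" if "y \<in> V \<inter> W" for y
      using V(4) W(4) that by (simp add: prod_eq_iff)
    have c: "lazy_src G (q y) = lazy_tgt G (r y)" if y: "y \<in> V \<inter> W" for y
    proof -
      have "p y \<in> composable thin" using p(3) y V(1) by blast
      then show ?thesis using P[OF y] by (simp add: py[OF y] composable_def thin_src thin_tgt)
    qed
    have "(\<lambda>(h, g). cmp thin h g) \<circ> p \<in> plots thin_arrows n (V \<inter> W)"
      by (rule TD.plot_cong[OF thin_arrows_plotI[OF lazy_cmp_plot[OF q r c]]]) (simp_all add: py thin_cmp P c)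
    moreover have "V \<inter> W \<subseteq> U" "x \<in> V \<inter> W" using V(1,2) W(2) by auto
    ultimately show "\<exists>V\<subseteq>U. x \<in> V \<and> (\<lambda>(h, g). cmp thin h g) \<circ> p \<in> plots thin_arrows n V" by metis
  qed
qed

lemma diffeological_groupoid_thin: "diffeological_groupoid (manifold_diffeology X0) thin_arrows thin"
  unfolding diffeological_groupoid_def diffeological_groupoid_axioms_def
  by (intro conjI groupoid_thin diffeological_space_manifold[OF charted_X0] diffeological_space_thin_arrows
      src_map_thin tgt_map_thin unt_map_thin ivs_map_thin cmp_map_thin)
    (simp_all add: thin_obj obj_eq thin_arrows_carrier, simp add: manifold_diffeology_def)

end

theorem proposition6p12:
  fixes X0 :: "'o manifold" and X1 :: "'m manifold" and G :: "('o, 'm) groupoid_structure"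
  assumes "lie_groupoid X0 X1 G"
  shows "diffeological_groupoid (manifold_diffeology X0) (thin_arrow_diffeology X0 X1 G)
           (thin_groupoid X0 X1 G)"
  by (rule lie_groupoid.diffeological_groupoid_thin[OF assms])

end
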